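(* Let $(\mu_t)_{t>0}$ be a family of Borel probability measures on $\mathbb R^d$. Assume that: (1) there exists $h_0>0$ such that $$\sup_{h\in(0,h_0)}\frac1h\Big(\int_{\mathbb R^d}(1\wedge|y|^2)\,\mu_h(dy)+\Big|\int_{\{|y|\le1\}}y\,\mu_h(dy)\Big|\Big)<\infty;$$ (2) for every $\varepsilon>0$ there exists $M_\varepsilon>0$ such that $\limsup_{h\downarrow0}\frac1h\,\mu_h(\{y\in\mathbb R^d:|y|>M_\varepsilon\})<\varepsilon$. Then, for every null sequence in $(0,\infty)$, there exist a subsequence $(h_n)_{n\in\mathbb N}$ and a Lévy process $(Y_t)_{t\ge0}$ on some probability space $(\Omega,\mathcal F,\mathbb P)$ such that $$\mu_{h_n}^{\ast k_n}\to\mathbb P\circ Y_t^{-1}\quad\text{in distribution as }n\to\infty$$ for all sequences $(k_n)_{n\in\mathbb N}\subset\mathbb N$ with $k_nh_n\to t\in[0,\infty)$ as $n\to\infty$.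
   Context: $d\in\mathbb N$; $|\cdot|$ is the Euclidean norm. A null sequence in $(0,\infty)$ is a sequence of positive reals converging to $0$. $\mu^{\ast k}$ denotes the $k$-fold convolution $\mu\ast\cdots\ast\mu$. A Lévy process $(Y_t)_{t\ge0}$ is an $\mathbb R^d$-valued process with $Y_0=0$ a.s., stationary independent increments, stochastically continuous, with a.s. càdlàg paths. *)

theory Defs
  imports "HOL-Probability.Probability"
begin

(* The zeroth power is the unit of convolution, the Dirac measure at the origin. *)
primrec convolution_power ::
    "('a::ordered_euclidean_space) measure \<Rightarrow> nat \<Rightarrow> 'a measure" where
  "convolution_power M 0 = return borel 0"
| "convolution_power M (Suc k) = convolution M (convolution_power M k)"

(* Weak convergence of Borel probability measures; weak_conv_m of the library covers only
   measures on the real line. *)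
definition converges_in_distribution ::
    "(nat \<Rightarrow> ('a::euclidean_space) measure) \<Rightarrow> 'a measure \<Rightarrow> bool" where
  "converges_in_distribution M N \<longleftrightarrow>
     (\<forall>f :: 'a \<Rightarrow> real. continuous_on UNIV f \<and> bounded (range f) \<longrightarrow>
        (\<lambda>n. integral\<^sup>L (M n) f) \<longlonglongrightarrow> integral\<^sup>L N f)"

(* Paths and processes are functions on all of real; only their values at times t >= 0 matter. *)
definition cadlag :: "(real \<Rightarrow> 'a::topological_space) \<Rightarrow> bool" where
  "cadlag x \<longleftrightarrow>
     (\<forall>t\<ge>0. (x \<longlongrightarrow> x t) (at_right t)) \<and> (\<forall>t>0. \<exists>l. (x \<longlongrightarrow> l) (at_left t))"

definition levy_process ::
    "'w measure \<Rightarrow> (real \<Rightarrow> 'w \<Rightarrow> 'a::euclidean_space) \<Rightarrow> bool" where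
  "levy_process P Y \<longleftrightarrow>
     prob_space P \<and>
     (\<forall>t\<ge>0. Y t \<in> borel_measurable P) \<and>
     (AE \<omega> in P. Y 0 \<omega> = 0) \<and>
     (\<forall>s\<ge>0. \<forall>h\<ge>0. distr P borel (\<lambda>\<omega>. Y (s + h) \<omega> - Y s \<omega>) =
                   distr P borel (\<lambda>\<omega>. Y h \<omega> - Y 0 \<omega>)) \<and>
     (\<forall>(n::nat) (t::nat \<Rightarrow> real). 0 \<le> t 0 \<and> (\<forall>i<n. t i \<le> t (Suc i)) \<longrightarrow>
        prob_space.indep_vars P (\<lambda>_. borel) (\<lambda>i \<omega>. Y (t (Suc i)) \<omega> - Y (t i) \<omega>) {..<n}) \<and>
     (\<forall>t\<ge>0. \<forall>\<epsilon>>0.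
        ((\<lambda>s. measure P {\<omega> \<in> space P. norm (Y s \<omega> - Y t \<omega>) > \<epsilon>}) \<longlongrightarrow> 0) (at t within {0..})) \<and>
     (AE \<omega> in P. cadlag (\<lambda>t. Y t \<omega>))"

end

theory Submission
  imports Defs
begin

text \<open>
  Let $g(x) = |x|^2/(1+|x|^2)$. A Taylor estimate of $g(x+y) - g(x)$ turns (1) into
  $E\,g(W_k) \le K k h$ for the random walk $W$ with step law $\mu_h$, uniformly in small $h$, and with (2)
  the rescaled version $g(\cdot/R)$ gives tightness of $W_k$ for $k h \le T$. So the walks
  $W_{\lfloor t/h_n \rfloor}$, $t$ dyadic, are countably many tight sequences; along a subsequence they can
  be realised on one probability space, with the same joint laws and converging almost surely to some
  $Z_t$. The limit inherits stationary independent increments and $E\,g(Z_t - Z_s) \le K(t-s)$, hence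
  $P(|Z_s - Z_q| > a, |Z_t - Z_s| > a) = O(a^{-4}(s-q)(t-s))$. Chaining over dyadic levels with Borel--Cantelli
  shows that $\min(|Z_s - Z_q|, |Z_t - Z_s|)$ is small whenever $q \le s \le t$ are close, which forces
  one-sided limits; $Y_t$ is the right limit of $Z$ at $t$. Since
  $|f(x) - f(y)| \le e + A\,g(x-y)$ for bounded uniformly continuous $f$, the same bound on $E\,g$ compares
  the laws after $k_n$ and $\lfloor t/h_n \rfloor$ steps.
\<close>

text \<open>A single increment over a step of length \<open>2^-m\<close> can be large with
  probability of order \<open>2^-m\<close>, which is not summable over the \<open>2^m\<close> steps
  of level \<open>m\<close>: jumps may persist in the limit, and no control of single increments can
  exclude them. Two adjacent increments are both large with probability of order \<open>4^-m\<close>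
  only, up to powers of the threshold; this is why path regularity is phrased through a minimum of
  two increments. Skorokhod's representation is applied to laws on the real line, so the whole
  family of walks is packed into one real number from which every coordinate can be read off
  continuously. This keeps the joint laws, which carry the independence of increments, together with
  almost sure convergence. The process is thus built from the walks themselves, without
  characteristic functions. Rounding times to the grid of mesh \<open>h\<close> is not additive, so
  stationarity holds for the walks only up to a few steps; a bound on the expectation of
  \<open>g\<close> that is linear in \<open>k h\<close> makes such discrepancies vanish in the
  limit.\<close>

section \<open>Almost sure realisation of tight sequences\<close>

text \<open>
  The digit function of Schoenberg's space-filling curve: if $y$ lies in the Cantor set, then $3^i y$ is an
  even integer plus a number in $[0,1/3]$ or in $[2/3,1]$ according to the $i$-th digit of $y$. Thus all
  digits are read off by functions continuous on the whole line, and a weak limit of laws on the real line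
  carries the joint limit of countably many coordinates.
\<close>

definition schoenberg :: "real \<Rightarrow> real" where
  "schoenberg z = max 0 (min 1 (1/2 - cos (pi * z)))"

lemma continuous_schoenberg: "continuous_on A schoenberg"
  unfolding schoenberg_def by (intro continuous_intros)

lemma schoenberg_bounds: "0 \<le> schoenberg z" "schoenberg z \<le> 1"
  by (auto simp: schoenberg_def)

lemma schoenberg_digit:
  fixes b :: "nat \<Rightarrow> real"
  assumes b: "\<And>k. b k \<in> {0, 1}"
  shows "schoenberg (3 ^ i * (\<Sum>k. 2 * b k / 3 ^ Suc k)) = b i"
proof -
  have b01: "0 \<le> b k" "b k \<le> 1" for k using b[of k] by auto
  have geo: "(\<lambda>k. 2 * (1/3::real) ^ Suc k) sums 1"
    using sums_mult[OF geometric_sums[of "1/3::real"], of "2/3"] by simp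
  have summ: "summable (\<lambda>k. 2 * b (k + j) / 3 ^ Suc k)" for j
    by (rule summable_comparison_test'[OF sums_summable[OF geo]])
       (use b01 in \<open>auto simp: field_simps\<close>)
  \<comment> \<open>The tail of the expansion behind digit \<open>i\<close>, rescaled to
    \<open>[0, 1]\<close>.\<close>
  define T where "T = (\<Sum>k. 2 * b (k + Suc i) / 3 ^ Suc k)"
  have T: "0 \<le> T" "T \<le> 1"
  proof -
    show "0 \<le> T" unfolding T_def using b01 by (intro suminf_nonneg summ) auto
    have "T \<le> (\<Sum>k. 2 * (1/3::real) ^ Suc k)" unfolding T_def
      using b01 by (intro suminf_le summ sums_summable[OF geo]) (auto simp: field_simps)
    then show "T \<le> 1" using sums_unique[OF geo] by simp
  qed
  have "(\<Sum>k. 2 * b k / 3 ^ Suc k) = (\<Sum>k. 2 * b (k + Suc i) / 3 ^ Suc (k + Suc i)) + (\<Sum>k<Suc i. 2 * b k / 3 ^ Suc k)"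
    using suminf_split_initial_segment[of "\<lambda>k. 2 * b k / 3 ^ Suc k" "Suc i"] summ[of 0] by simp
  also have "(\<Sum>k. 2 * b (k + Suc i) / 3 ^ Suc (k + Suc i)) = T / 3 ^ Suc i"
    unfolding T_def suminf_divide[OF summ, symmetric] by (simp add: power_add)
  finally have "3 ^ i * (\<Sum>k. 2 * b k / 3 ^ Suc k)
      = T / 3 + 2 * b i / 3 + (\<Sum>k<i. 3 ^ i * (2 * b k / 3 ^ Suc k))"
    by (simp add: algebra_simps sum_distrib_left)
  also have "(\<Sum>k<i. 3 ^ i * (2 * b k / 3 ^ Suc k)) = (\<Sum>k<i. 2 * (b k * 3 ^ (i - Suc k)))"
    by (intro sum.cong refl) (simp add: power_diff)
  also have "\<dots> = 2 * (\<Sum>k<i. b k * 3 ^ (i - Suc k))" by (simp add: sum_distrib_left)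
  finally have eq: "3 ^ i * (\<Sum>k. 2 * b k / 3 ^ Suc k)
      = T / 3 + 2 * b i / 3 + 2 * (\<Sum>k<i. b k * 3 ^ (i - Suc k))" .
  \<comment> \<open>The digits before \<open>i\<close> contribute an even integer, a period of
    \<open>cos (pi * z)\<close>; only digit \<open>i\<close> and the tail remain.\<close>
  have "(\<Sum>k<i. b k * 3 ^ (i - Suc k)) \<in> \<int>"
    using b by (intro Ints_sum Ints_mult) (metis Ints_0 Ints_1 insertE singletonD, auto)
  then obtain N where N: "(\<Sum>k<i. b k * 3 ^ (i - Suc k)) = of_int N" by (auto elim: Ints_cases)
  have cosN: "cos (pi * (z + 2 * of_int N)) = cos (pi * z)" for z
    using cos_add[of "pi * z" "2 * pi * of_int N"] cos_int_2pin[of N] sin_int_2pin[of N]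
    by (simp add: algebra_simps)
  \<comment> \<open>The remaining argument is \<open>T / 3\<close> in \<open>[0, 1/3]\<close>, where
    \<open>1/2 - cos\<close> is at most 0, or \<open>T / 3 + 2 / 3\<close> in
    \<open>[2/3, 1]\<close>, where it is at least 1; clipping then returns the digit
    exactly.\<close>
  show ?thesis
  proof (cases "b i = 0")
    case True
    have "cos (pi / 3) \<le> cos (pi * (T / 3))"
      using T mult_left_mono[OF T(2), of pi] by (intro cos_monotone_0_pi_le) (auto simp: field_simps)
    then show ?thesis unfolding eq N schoenberg_def cosN using True by (simp add: cos_60)
  next
    case False
    then have bi: "b i = 1" using b[of i] by auto
    have "cos (pi * (T / 3 + 2 / 3)) \<le> cos (2 * pi / 3)"
      using T mult_left_mono[OF T(2), of pi]
      by (intro cos_monotone_0_pi_le) (auto simp: field_simps)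
    moreover have "cos (2 * pi / 3) = - 1 / 2" by (simp add: cos_120)
    ultimately show ?thesis unfolding eq N schoenberg_def cosN using bi by simp
  qed
qed

section \<open>Binary digits and the packing of a sequence of reals into one real\<close>

text \<open>The digit of weight \<open>1 / 2 ^ Suc m\<close>; as a difference of floors it is
  measurable and lets the digit series telescope.\<close>

definition bit_digit :: "nat \<Rightarrow> real \<Rightarrow> real" where
  "bit_digit m u = of_int \<lfloor>2 ^ Suc m * u\<rfloor> - 2 * of_int \<lfloor>2 ^ m * u\<rfloor>"

lemma bit_digit_01: "bit_digit m u \<in> {0, 1}"
proof -
  have "2 * \<lfloor>2 ^ m * u\<rfloor> \<le> \<lfloor>2 ^ Suc m * u\<rfloor>" "\<lfloor>2 ^ Suc m * u\<rfloor> \<le> 2 * \<lfloor>2 ^ m * u\<rfloor> + 1"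
    by (simp_all add: le_floor_iff floor_le_iff) linarith+
  then have "\<lfloor>2 ^ Suc m * u\<rfloor> = 2 * \<lfloor>2 ^ m * u\<rfloor> \<or> \<lfloor>2 ^ Suc m * u\<rfloor> = 2 * \<lfloor>2 ^ m * u\<rfloor> + 1"
    by linarith
  then show ?thesis unfolding bit_digit_def by auto
qed

lemma floor_dyadic_tendsto: "(\<lambda>m. of_int \<lfloor>2 ^ m * u\<rfloor> / 2 ^ m) \<longlonglongrightarrow> (u::real)"
proof (rule tendsto_sandwich)
  show "\<forall>\<^sub>F m in sequentially. u - (1/2) ^ m \<le> of_int \<lfloor>2 ^ m * u\<rfloor> / 2 ^ m"
  proof (intro always_eventually allI)
    fix m :: nat
    have "(2::real) ^ m * u - 1 \<le> of_int \<lfloor>2 ^ m * u\<rfloor>" by linarith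
    then have "(2 ^ m * u - 1) / 2 ^ m \<le> of_int \<lfloor>2 ^ m * u\<rfloor> / 2 ^ m" by (rule divide_right_mono) simp
    then show "u - (1/2) ^ m \<le> of_int \<lfloor>2 ^ m * u\<rfloor> / 2 ^ m" by (simp add: diff_divide_distrib power_one_over)
  qed
  show "\<forall>\<^sub>F m in sequentially. of_int \<lfloor>2 ^ m * u\<rfloor> / 2 ^ m \<le> u"
    by (rule always_eventually) (auto simp: field_simps)
  show "(\<lambda>m. u - (1/2) ^ m) \<longlonglongrightarrow> u"
    using tendsto_diff[OF tendsto_const LIMSEQ_realpow_zero[of "1/2"], of u] by simp
qed simp

text \<open>The series telescopes to \<open>u\<close> minus its integer part. The half-open interval
  matters: at \<open>u = 1\<close> all digits vanish.\<close>

lemma bit_digit_sums: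
  assumes "0 \<le> u" "u < 1"
  shows "(\<lambda>m. bit_digit m u / 2 ^ Suc m) sums u"
proof -
  have "(\<lambda>m. of_int \<lfloor>2 ^ Suc m * u\<rfloor> / 2 ^ Suc m - of_int \<lfloor>2 ^ m * u\<rfloor> / 2 ^ m) sums (u - of_int \<lfloor>2 ^ 0 * u\<rfloor> / 2 ^ 0)"
    by (rule telescope_sums[OF floor_dyadic_tendsto])
  moreover have "\<lfloor>u\<rfloor> = 0" using assms by (simp add: floor_eq_iff)
  ultimately show ?thesis by (simp add: bit_digit_def field_simps)
qed

lemma bit_digit_measurable [measurable]: "bit_digit m \<in> borel_measurable borel"
  unfolding bit_digit_def by measurable

text \<open>The pairing function interleaves the binary digits of all \<open>u j\<close>, and
  doubling them gives ternary digits 0 and 2, so the value lies in the Cantor set. For this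
  direction measurability is enough; continuity is required of the way back,
  \<open>decode\<close>.\<close>

definition encode :: "(nat \<Rightarrow> real) \<Rightarrow> real" where
  "encode u = (\<Sum>k. 2 * bit_digit (snd (prod_decode k)) (u (fst (prod_decode k))) / 3 ^ Suc k)"

definition decode :: "nat \<Rightarrow> real \<Rightarrow> real" where
  "decode j y = (\<Sum>m. schoenberg (3 ^ prod_encode (j, m) * y) / 2 ^ Suc m)"

lemma summable_half: "summable (\<lambda>m. 1 / 2 ^ Suc m :: real)"
  using sums_summable[OF power_half_series] by (simp add: power_one_over)

lemma continuous_decode: "continuous_on UNIV (decode j)"
proof -
  have "uniform_limit UNIV (\<lambda>n y. \<Sum>m<n. schoenberg (3 ^ prod_encode (j, m) * y) / 2 ^ Suc m) (decode j) sequentially"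
    unfolding decode_def
    by (rule Weierstrass_m_test[OF _ summable_half]) (use schoenberg_bounds in \<open>auto simp: field_simps\<close>)
  then show ?thesis
    by (rule uniform_limit_theorem[rotated])
       (auto intro!: always_eventually continuous_intros continuous_on_compose2[OF continuous_schoenberg[of UNIV]])
qed

lemma decode_encode:
  assumes "0 \<le> u j" "u j < 1"
  shows "decode j (encode u) = u j"
proof -
  have "schoenberg (3 ^ prod_encode (j, m) * encode u) = bit_digit m (u j)" for m
    unfolding encode_def
    by (subst schoenberg_digit[where b = "\<lambda>k. bit_digit (snd (prod_decode k)) (u (fst (prod_decode k)))"])
       (use bit_digit_01 in auto)
  then show ?thesis unfolding decode_def using sums_unique[OF bit_digit_sums[OF assms]] by simp
qed

lemma encode_bounds: "0 \<le> encode u" "encode u \<le> 1"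
proof -
  have geo: "(\<lambda>k. 2 * (1/3::real) ^ Suc k) sums 1"
    using sums_mult[OF geometric_sums[of "1/3::real"], of "2/3"] by simp
  have b01: "0 \<le> bit_digit m v" "bit_digit m v \<le> 1" for m v using bit_digit_01[of m v] by auto
  have summ: "summable (\<lambda>k. 2 * bit_digit (snd (prod_decode k)) (u (fst (prod_decode k))) / 3 ^ Suc k)"
    by (rule summable_comparison_test'[OF sums_summable[OF geo]])
       (use b01 in \<open>auto simp: field_simps\<close>)
  show "0 \<le> encode u" unfolding encode_def using b01 by (intro suminf_nonneg summ) auto
  have "encode u \<le> (\<Sum>k. 2 * (1/3::real) ^ Suc k)" unfolding encode_def
    using b01 by (intro suminf_le summ sums_summable[OF geo]) (auto simp: field_simps)
  then show "encode u \<le> 1" using sums_unique[OF geo] by simp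
qed

text \<open>The packed variables live in \<open>[0, 1]\<close>, so their laws are tight at once, and
  the continuity of \<open>decode\<close> sends their almost sure limit back to every coordinate.
  The hypothesis \<open>tight\<close> keeps the decoded limits off the endpoints, which stand for
  infinity. Since decoding inverts packing exactly, the law of the whole sequence is preserved and
  not just its marginals.\<close>

lemma real_skorokhod_coupling:
  fixes \<xi> :: "nat \<Rightarrow> nat \<Rightarrow> 's \<Rightarrow> real"
  assumes prob: "\<And>n. prob_space (S n)"
    and meas [measurable]: "\<And>n j. \<xi> n j \<in> borel_measurable (S n)"
    and tight: "\<forall>j. \<forall>\<eta>>0. \<exists>R. \<forall>\<^sub>F n in sequentially.
      measure (S n) {x \<in> space (S n). \<bar>\<xi> n j x\<bar> > R} \<le> \<eta>"
  shows "\<exists>(r :: nat \<Rightarrow> nat) (P :: real measure) X Y. strict_mono r \<and> prob_space P \<and>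
    (\<forall>n j. X n j \<in> borel_measurable P) \<and> (\<forall>j. Y j \<in> borel_measurable P) \<and>
    (\<forall>n. distr P (PiM UNIV (\<lambda>_. borel)) (\<lambda>\<omega> j. X n j \<omega>) =
         distr (S (r n)) (PiM UNIV (\<lambda>_. borel)) (\<lambda>\<omega> j. \<xi> (r n) j \<omega>)) \<and>
    (\<forall>j. AE \<omega> in P. (\<lambda>n. X n j \<omega>) \<longlonglongrightarrow> Y j \<omega>)"
proof -
  \<comment> \<open>The arctangent compresses the line into \<open>(0, 1)\<close>, where binary
    digits are available.\<close>
  define sq :: "real \<Rightarrow> real" where "sq x = 1/2 + arctan x / pi" for x
  define unsq :: "real \<Rightarrow> real" where "unsq u = tan (pi * (u - 1/2))" for u
  have sq01: "0 < sq x" "sq x < 1" for x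
    using arctan_bounded[of x] pi_gt_zero by (auto simp: sq_def field_simps)
  have unsq_sq: "unsq (sq x) = x" for x by (simp add: unsq_def sq_def tan_arctan)
  have [measurable]: "sq \<in> borel_measurable borel"
    unfolding sq_def by (intro borel_measurable_continuous_onI continuous_intros) auto
  have [measurable]: "unsq \<in> borel_measurable borel"
    unfolding unsq_def tan_def by measurable
  define Z where "Z n x = encode (\<lambda>j. sq (\<xi> n j x))" for n x
  have Zm [measurable]: "Z n \<in> borel_measurable (S n)" for n
    unfolding Z_def encode_def by measurable
  have dec_Z: "decode j (Z n x) = sq (\<xi> n j x)" for j n x
    unfolding Z_def using sq01 by (subst decode_encode) (auto intro: less_imp_le)
  have decm [measurable]: "decode j \<in> borel_measurable borel" for j
    by (intro borel_measurable_continuous_onI continuous_decode)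
  define L where "L n = distr (S n) borel (Z n)" for n
  interpret S: prob_space "S n" for n by fact
  have rd: "real_distribution (L n)" for n
    unfolding L_def by (intro real_distribution.intro S.prob_space_distr real_distribution_axioms.intro) auto
  have "tight L"
    unfolding tight_def
  proof (intro conjI allI impI rd)
    fix e :: real assume e: "e > 0"
    have "measure (L n) {- 1<..2} = 1" for n
    proof -
      have "Z n x \<in> {- 1<..2}" for x using encode_bounds[of "\<lambda>j. sq (\<xi> n j x)"] by (auto simp: Z_def)
      then have "Z n -` {- 1<..2} \<inter> space (S n) = space (S n)" by auto
      then show ?thesis unfolding L_def by (subst measure_distr) (auto simp: S.prob_space)
    qed
    then show "\<exists>a b. a < b \<and> (\<forall>n. 1 - e < measure (L n) {a<..b})"
      using e by (intro exI[of _ "-1"] exI[of _ 2]) auto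
  qed
  from tight_imp_convergent_subsubsequence[OF this strict_mono_id]
  obtain r M where r: "strict_mono r" and M: "real_distribution M" and wc: "weak_conv_m (L \<circ> id \<circ> r) M"
    by auto
  have "real_distribution ((L \<circ> id \<circ> r) n)" for n using rd by simp
  note Skorohod[OF this M wc]
  then obtain P :: "real measure" and Zs Z' where P: "prob_space P"
    and Zs': "\<forall>n. Zs n \<in> borel_measurable P" "\<forall>n. distr P borel (Zs n) = (L \<circ> id \<circ> r) n"
    and Z': "Z' \<in> measurable P lborel" "distr P borel Z' = M"
    and conv': "\<forall>x\<in>space P. (\<lambda>n. Zs n x) \<longlonglongrightarrow> Z' x"
    by - (elim exE conjE, rule that)
  have Zs [measurable]: "Zs n \<in> borel_measurable P" and Zs_law: "distr P borel (Zs n) = L (r n)" for n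
    using Zs' by auto
  have [measurable]: "Z' \<in> borel_measurable P" using Z'(1) by simp
  have conv: "(\<lambda>n. Zs n x) \<longlonglongrightarrow> Z' x" if "x \<in> space P" for x using conv' that by blast
  interpret P: prob_space P by fact
  have dec_law: "measure P {\<omega> \<in> space P. Q (Zs n \<omega>)} = measure (S (r n)) {x \<in> space (S (r n)). Q (Z (r n) x)}"
    if [measurable]: "Measurable.pred borel Q" for Q n
  proof -
    have "measure P {\<omega> \<in> space P. Q (Zs n \<omega>)} = measure (distr P borel (Zs n)) {y. Q y}"
      by (subst measure_distr) (auto intro!: arg_cong[where f = "measure P"])
    also have "\<dots> = measure (S (r n)) {x \<in> space (S (r n)). Q (Z (r n) x)}"
      unfolding Zs_law L_def by (subst measure_distr) (auto intro!: arg_cong[where f = "measure (S (r n))"])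
    finally show ?thesis .
  qed
  have dec_conv: "(\<lambda>n. decode j (Zs n \<omega>)) \<longlonglongrightarrow> decode j (Z' \<omega>)" if "\<omega> \<in> space P" for j \<omega>
    using continuous_on_tendsto_compose[OF continuous_decode conv[OF that]] by auto
  \<comment> \<open>No mass escapes to infinity: the decoded limit avoids 0 and 1, where the tangent
    in \<open>unsq\<close> has its poles.\<close>
  have interior: "AE \<omega> in P. \<bar>decode j (Z' \<omega>) - 1/2\<bar> < 1/2" for j
  proof -
    define A where "A = {\<omega> \<in> space P. \<not> \<bar>decode j (Z' \<omega>) - 1/2\<bar> < 1/2}"
    have A [measurable]: "A \<in> sets P" unfolding A_def by measurable
    have le_eps: "measure P A \<le> \<eta>" if \<eta>: "\<eta> > 0" for \<eta>
    proof -
      obtain R where R: "\<forall>\<^sub>F n in sequentially. measure (S n) {x \<in> space (S n). \<bar>\<xi> n j x\<bar> > R} \<le> \<eta>"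
        using tight \<eta> by blast
      define R' where "R' = max R 0"
      define c where "c = arctan R' / pi"
      have c: "0 \<le> c" "c < 1/2"
        using arctan_bounded[of R'] pi_gt_zero by (auto simp: c_def field_simps R'_def)
      \<comment> \<open>This function lies between the indicators of the points at distance at least
        \<open>1/2\<close> and of those at distance more than \<open>c\<close> from the midpoint.
        Being continuous, it carries the tail bound of the original variables over to the
        limit.\<close>
      define \<phi> where "\<phi> u = max 0 (min 1 ((\<bar>u - 1/2\<bar> - c) / (1/2 - c)))" for u :: real
      have \<phi>01: "0 \<le> \<phi> u" "\<phi> u \<le> 1" for u by (auto simp: \<phi>_def)
      have \<phi>cont: "continuous_on UNIV \<phi>" unfolding \<phi>_def using c by (intro continuous_intros) auto
      have [measurable]: "\<phi> \<in> borel_measurable borel" using \<phi>cont by (rule borel_measurable_continuous_onI)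
      have lim: "(\<lambda>n. \<integral>\<omega>. \<phi> (decode j (Zs n \<omega>)) \<partial>P) \<longlonglongrightarrow> (\<integral>\<omega>. \<phi> (decode j (Z' \<omega>)) \<partial>P)"
      proof (rule integral_dominated_convergence[where w = "\<lambda>_. 1"])
        show "AE \<omega> in P. (\<lambda>n. \<phi> (decode j (Zs n \<omega>))) \<longlonglongrightarrow> \<phi> (decode j (Z' \<omega>))"
          using continuous_on_tendsto_compose[OF \<phi>cont dec_conv] by (intro AE_I2) auto
      qed (use \<phi>01 in \<open>auto simp: abs_le_iff intro: order_trans[OF _ \<phi>01(1)]\<close>)
      have "\<forall>\<^sub>F n in sequentially. (\<integral>\<omega>. \<phi> (decode j (Zs n \<omega>)) \<partial>P) \<le> \<eta>"
        using eventually_compose_filterlim[OF R filterlim_subseq[OF r]]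
      proof eventually_elim
        case (elim n)
        let ?B = "{\<omega> \<in> space P. \<bar>decode j (Zs n \<omega>) - 1/2\<bar> > c}"
        have B: "?B \<in> sets P" by measurable
        have "(\<integral>\<omega>. \<phi> (decode j (Zs n \<omega>)) \<partial>P) \<le> (\<integral>\<omega>. indicator ?B \<omega> \<partial>P)"
        proof (rule integral_mono)
          show "integrable P (\<lambda>\<omega>. \<phi> (decode j (Zs n \<omega>)))"
            by (rule P.integrable_const_bound[where B = 1]) (use \<phi>01 in \<open>auto simp: abs_le_iff intro: order_trans[OF _ \<phi>01(1)]\<close>)
          show "\<phi> (decode j (Zs n \<omega>)) \<le> indicator ?B \<omega>" if "\<omega> \<in> space P" for \<omega>
            using that \<phi>01 c by (auto simp: indicator_def \<phi>_def field_simps max_def)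
          show "integrable P (indicat_real ?B)"
            by (rule integrable_real_indicator[OF B]) (simp add: less_top[symmetric])
        qed
        also have "\<dots> = measure P ?B" by simp
        also have "\<dots> = measure (S (r n)) {x \<in> space (S (r n)). \<bar>decode j (Z (r n) x) - 1/2\<bar> > c}"
          by (rule dec_law) measurable
        also have "\<dots> \<le> measure (S (r n)) {x \<in> space (S (r n)). \<bar>\<xi> (r n) j x\<bar> > R}"
        proof (rule S.finite_measure_mono)
          have "\<bar>x\<bar> > R" if "\<bar>sq x - 1/2\<bar> > c" for x
          proof (rule ccontr)
            assume "\<not> \<bar>x\<bar> > R"
            then have "x \<le> R'" "- R' \<le> x" by (auto simp: R'_def)
            then have "arctan x \<le> arctan R'" "- arctan R' \<le> arctan x"
              by (auto simp: arctan_le_iff simp flip: arctan_minus)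
            then have "\<bar>arctan x / pi\<bar> \<le> c" unfolding c_def by (auto simp: divide_simps abs_le_iff)
            with that show False by (simp add: sq_def)
          qed
          then show "{x \<in> space (S (r n)). \<bar>decode j (Z (r n) x) - 1/2\<bar> > c} \<subseteq> {x \<in> space (S (r n)). \<bar>\<xi> (r n) j x\<bar> > R}"
            by (auto simp: dec_Z)
        qed measurable
        finally show ?case using elim by simp
      qed
      then have le: "(\<integral>\<omega>. \<phi> (decode j (Z' \<omega>)) \<partial>P) \<le> \<eta>"
        by (intro tendsto_upperbound[OF lim]) auto
      have "measure P A = (\<integral>\<omega>. indicator A \<omega> \<partial>P)" by simp
      also have "\<dots> \<le> (\<integral>\<omega>. \<phi> (decode j (Z' \<omega>)) \<partial>P)"
      proof (rule integral_mono)
        show "integrable P (\<lambda>\<omega>. \<phi> (decode j (Z' \<omega>)))"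
          by (rule P.integrable_const_bound[where B = 1]) (use \<phi>01 in \<open>auto simp: abs_le_iff intro: order_trans[OF _ \<phi>01(1)]\<close>)
        show "indicator A \<omega> \<le> \<phi> (decode j (Z' \<omega>))" for \<omega>
          using \<phi>01 c by (auto simp: indicator_def \<phi>_def A_def field_simps max_def min_def)
        show "integrable P (indicat_real A)"
          by (rule integrable_real_indicator[OF A]) (simp add: less_top[symmetric])
      qed
      finally show ?thesis using le by simp
    qed
    have "measure P A \<le> 0" by (rule field_le_epsilon) (simp add: le_eps)
    then have "emeasure P A = 0" by (simp add: P.emeasure_eq_measure measure_le_0_iff)
    then show ?thesis by (rule AE_I[where N = A, rotated, OF _ A]) (auto simp: A_def)
  qed
  show ?thesis
  proof (intro exI conjI allI)
    show "strict_mono r" "prob_space P" by fact+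
    show "(\<lambda>\<omega>. unsq (decode j (Zs n \<omega>))) \<in> borel_measurable P" for n j by measurable
    show "(\<lambda>\<omega>. unsq (decode j (Z' \<omega>))) \<in> borel_measurable P" for j by measurable
    show "distr P (PiM UNIV (\<lambda>_. borel)) (\<lambda>\<omega> j. unsq (decode j (Zs n \<omega>))) =
          distr (S (r n)) (PiM UNIV (\<lambda>_. borel)) (\<lambda>\<omega> j. \<xi> (r n) j \<omega>)" for n
    proof -
      have "distr P (PiM UNIV (\<lambda>_. borel)) (\<lambda>\<omega> j. unsq (decode j (Zs n \<omega>)))
          = distr (distr P borel (Zs n)) (PiM UNIV (\<lambda>_. borel)) (\<lambda>y j. unsq (decode j y))"
        by (subst distr_distr) (auto simp: comp_def intro!: measurable_PiM_single')
      also have "\<dots> = distr (S (r n)) (PiM UNIV (\<lambda>_. borel)) (\<lambda>\<omega> j. \<xi> (r n) j \<omega>)"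
        unfolding Zs_law L_def
        by (subst distr_distr) (auto simp: comp_def dec_Z unsq_sq intro!: measurable_PiM_single')
      finally show ?thesis .
    qed
    show "AE \<omega> in P. (\<lambda>n. unsq (decode j (Zs n \<omega>))) \<longlonglongrightarrow> unsq (decode j (Z' \<omega>))" for j
      using interior[of j] AE_space
    proof eventually_elim
      case (elim \<omega>)
      have "\<bar>pi * (decode j (Z' \<omega>) - 1/2)\<bar> < pi / 2"
        using elim(1) pi_gt_zero by (simp add: abs_mult)
      then have "- (pi / 2) < pi * (decode j (Z' \<omega>) - 1/2)" "pi * (decode j (Z' \<omega>) - 1/2) < pi / 2"
        by linarith+
      from cos_gt_zero_pi[OF this] have "cos (pi * (decode j (Z' \<omega>) - 1/2)) \<noteq> 0" by linarith
      moreover have "(\<lambda>n. pi * (decode j (Zs n \<omega>) - 1/2)) \<longlonglongrightarrow> pi * (decode j (Z' \<omega>) - 1/2)"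
        by (intro tendsto_intros dec_conv elim(2))
      ultimately show ?case unfolding unsq_def by (intro isCont_tendsto_compose[OF isCont_tan])
    qed
  qed
qed

text \<open>Pairs of an index and a basis direction are enumerated as one sequence of reals, and
  \<open>G\<close> reassembles the vectors; as a measurable map of whole sequences it carries the
  joint law along.\<close>

lemma skorokhod_coupling:
  fixes \<xi> :: "nat \<Rightarrow> nat \<Rightarrow> 's \<Rightarrow> 'a::euclidean_space"
  assumes prob: "\<And>n. prob_space (S n)"
    and meas [measurable]: "\<And>n j. \<xi> n j \<in> borel_measurable (S n)"
    and tight: "\<forall>j. \<forall>\<eta>>0. \<exists>R. \<forall>\<^sub>F n in sequentially.
      measure (S n) {x \<in> space (S n). norm (\<xi> n j x) > R} \<le> \<eta>"
  shows "\<exists>(r :: nat \<Rightarrow> nat) (P :: real measure) X Y. strict_mono r \<and> prob_space P \<and>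
    (\<forall>n j. X n j \<in> borel_measurable P) \<and> (\<forall>j. Y j \<in> borel_measurable P) \<and>
    (\<forall>n. distr P (PiM UNIV (\<lambda>_. borel)) (\<lambda>\<omega> j. X n j \<omega>) =
         distr (S (r n)) (PiM UNIV (\<lambda>_. borel)) (\<lambda>\<omega> j. \<xi> (r n) j \<omega>)) \<and>
    (\<forall>j. AE \<omega> in P. (\<lambda>n. X n j \<omega>) \<longlonglongrightarrow> Y j \<omega>)"
proof -
  \<comment> \<open>\<open>B\<close> is total: numbers beyond the dimension fall back on some basis
    vector, while \<open>G\<close> reads only the indices \<open>c b\<close>.\<close>
  define B :: "nat \<Rightarrow> 'a" where "B = from_nat_into Basis"
  define c :: "'a \<Rightarrow> nat" where "c = to_nat_on Basis"
  have B: "B i \<in> Basis" for i unfolding B_def by (rule from_nat_into) auto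
  have Bc: "B (c b) = b" if "b \<in> Basis" for b
    unfolding B_def c_def using that by (simp add: countable_finite)
  define \<xi>' where "\<xi>' n i x = \<xi> n (fst (prod_decode i)) x \<bullet> B (snd (prod_decode i))" for n i x
  have \<xi>'_meas [measurable]: "\<xi>' n i \<in> borel_measurable (S n)" for n i unfolding \<xi>'_def by measurable
  interpret S: prob_space "S n" for n by fact
  have "\<forall>i. \<forall>\<eta>>0. \<exists>R. \<forall>\<^sub>F n in sequentially. measure (S n) {x \<in> space (S n). \<bar>\<xi>' n i x\<bar> > R} \<le> \<eta>"
  proof (intro allI impI)
    fix i and \<eta> :: real assume "\<eta> > 0"
    obtain R where R: "\<forall>\<^sub>F n in sequentially. measure (S n) {x \<in> space (S n). norm (\<xi> n (fst (prod_decode i)) x) > R} \<le> \<eta>"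
      using tight \<open>\<eta> > 0\<close> by blast
    have "measure (S n) {x \<in> space (S n). \<bar>\<xi>' n i x\<bar> > R} \<le> measure (S n) {x \<in> space (S n). norm (\<xi> n (fst (prod_decode i)) x) > R}" for n
      unfolding \<xi>'_def
      by (intro S.finite_measure_mono) (auto intro: less_le_trans[OF _ Basis_le_norm[OF B]])
    then show "\<exists>R. \<forall>\<^sub>F n in sequentially. measure (S n) {x \<in> space (S n). \<bar>\<xi>' n i x\<bar> > R} \<le> \<eta>"
      by (intro exI[of _ R] eventually_mono[OF R]) (rule order_trans)
  qed
  from real_skorokhod_coupling[where S = S and \<xi> = \<xi>', OF prob \<xi>'_meas this]
  obtain r and P :: "real measure" and X Y where r: "strict_mono r" and P: "prob_space P"
    and X': "\<forall>n j. X n j \<in> borel_measurable P" and Y': "\<forall>j. Y j \<in> borel_measurable P"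
    and law': "\<forall>n. distr P (PiM UNIV (\<lambda>_. borel)) (\<lambda>\<omega> j. X n j \<omega>) =
         distr (S (r n)) (PiM UNIV (\<lambda>_. borel)) (\<lambda>\<omega> j. \<xi>' (r n) j \<omega>)"
    and conv': "\<forall>j. AE \<omega> in P. (\<lambda>n. X n j \<omega>) \<longlonglongrightarrow> Y j \<omega>"
    by - (elim exE conjE, rule that)
  have [measurable]: "X n j \<in> borel_measurable P" "Y j \<in> borel_measurable P" for n j
    using X' Y' by auto
  note law = law'[rule_format] and conv = conv'[rule_format]
  define G :: "(nat \<Rightarrow> real) \<Rightarrow> nat \<Rightarrow> 'a" where "G x j = (\<Sum>b\<in>Basis. x (prod_encode (j, c b)) *\<^sub>R b)" for x j
  have G [measurable]: "G \<in> measurable (PiM UNIV (\<lambda>_. borel)) (PiM UNIV (\<lambda>_. borel))"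
    unfolding G_def by (rule measurable_PiM_single') (auto intro!: borel_measurable_sum borel_measurable_scaleR)
  have G\<xi>: "G (\<lambda>i. \<xi>' n i x) = (\<lambda>j. \<xi> n j x)" for n x
    by (rule ext) (simp add: G_def \<xi>'_def Bc euclidean_representation)
  show ?thesis
  proof (intro exI conjI allI)
    show "strict_mono r" "prob_space P" by fact+
    show "(\<lambda>\<omega>. G (\<lambda>i. X n i \<omega>) j) \<in> borel_measurable P" for n j unfolding G_def by measurable
    show "(\<lambda>\<omega>. G (\<lambda>i. Y i \<omega>) j) \<in> borel_measurable P" for j unfolding G_def by measurable
    show "AE \<omega> in P. (\<lambda>n. G (\<lambda>i. X n i \<omega>) j) \<longlonglongrightarrow> G (\<lambda>i. Y i \<omega>) j" for j
    proof -
      have "AE \<omega> in P. \<forall>b\<in>Basis. (\<lambda>n. X n (prod_encode (j, c b)) \<omega>) \<longlonglongrightarrow> Y (prod_encode (j, c b)) \<omega>"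
        using conv by (intro AE_finite_allI) auto
      then show ?thesis unfolding G_def
        by eventually_elim (auto intro!: tendsto_intros)
    qed
    show "distr P (PiM UNIV (\<lambda>_. borel)) (\<lambda>\<omega> j. G (\<lambda>i. X n i \<omega>) j) =
         distr (S (r n)) (PiM UNIV (\<lambda>_. borel)) (\<lambda>\<omega> j. \<xi> (r n) j \<omega>)" for n
    proof -
      have [measurable]: "(\<lambda>\<omega> j. X n j \<omega>) \<in> measurable P (PiM UNIV (\<lambda>_. borel))"
        by (rule measurable_PiM_single') auto
      have [measurable]: "(\<lambda>\<omega> j. \<xi>' (r n) j \<omega>) \<in> measurable (S (r n)) (PiM UNIV (\<lambda>_. borel))"
        by (rule measurable_PiM_single') auto
      have "distr P (PiM UNIV (\<lambda>_. borel)) (\<lambda>\<omega>. G (\<lambda>i. X n i \<omega>))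
          = distr (distr P (PiM UNIV (\<lambda>_. borel)) (\<lambda>\<omega> j. X n j \<omega>)) (PiM UNIV (\<lambda>_. borel)) G"
        by (subst distr_distr) (auto simp: comp_def)
      also have "\<dots> = distr (S (r n)) (PiM UNIV (\<lambda>_. borel)) (\<lambda>\<omega>. G (\<lambda>i. \<xi>' (r n) i \<omega>))"
        unfolding law by (subst distr_distr) (auto simp: comp_def)
      finally show ?thesis by (simp add: G\<xi>)
    qed
  qed
qed


section \<open>Regularity along dyadic times\<close>

text \<open>
  Each point of level $j+1$ is moved to a neighbour of level $j$ at which $x$ differs by at most
  $\theta_{j+1}$; these moves preserve the order of the three points.
\<close>

lemma dyadic_chaining:
  fixes x :: "nat \<Rightarrow> nat \<Rightarrow> 'a::real_normed_vector"
  assumes refine: "\<And>j i. x (Suc j) (2 * i) = x j i"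
    and \<theta>: "\<And>j. 0 \<le> \<theta> j"
    and triple: "\<And>j i. m \<le> j \<Longrightarrow> i + 2 \<le> N * 2 ^ j \<Longrightarrow>
      min (norm (x j (i + 1) - x j i)) (norm (x j (i + 2) - x j (i + 1))) \<le> \<theta> j"
    and "a \<le> b" "b \<le> c" "c \<le> N * 2 ^ (m + l)" "c < a + 2 ^ l"
  shows "min (norm (x (m + l) b - x (m + l) a)) (norm (x (m + l) c - x (m + l) b)) \<le> 2 * (\<Sum>j=m..m+l. \<theta> j)"
proof -
  \<comment> \<open>For the induction the window is widened by 2: rounding its ends to the coarser
    level may stretch it by 2, and \<open>2 + 2 ^ Suc l\<close> plus 2 is twice
    \<open>2 + 2 ^ l\<close>. Each finer level charges both endpoints of an increment; at level
    \<open>m\<close> the three points are adjacent or coincide, which costs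
    \<open>\<theta> m\<close> once.\<close>
  have gen: "min (norm (x (m + l) b - x (m + l) a)) (norm (x (m + l) c - x (m + l) b)) \<le> \<theta> m + 2 * (\<Sum>j\<in>{m<..m+l}. \<theta> j)"
    if "a \<le> b" "b \<le> c" "c \<le> N * 2 ^ (m + l)" "c < a + 2 + 2 ^ l" for a b c
    using that
  proof (induction l arbitrary: a b c)
    case 0
    then consider "a = b" | "b = c" | "b = a + 1" "c = a + 2" by force
    then show ?case
      using triple[of m a] 0 \<theta>[of m] by cases auto
  next
    case (Suc l)
    let ?k = "m + l"
    define Q where "Q = N * 2 ^ ?k"
    have Q: "N * 2 ^ Suc ?k = 2 * Q" by (simp add: Q_def)
    have "\<exists>a'. a \<le> 2 * a' + 1 \<and> 2 * a' \<le> a + 1 \<and> (even a \<longrightarrow> a = 2 * a') \<and> norm (x (Suc ?k) a - x ?k a') \<le> \<theta> (Suc ?k)"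
      if a: "a \<le> N * 2 ^ Suc ?k" for a
    proof (cases "even a")
      case True
      then obtain a' where "a = 2 * a'" by blast
      then show ?thesis using \<theta> by (intro exI[of _ a']) (simp add: refine)
    next
      case False
      then obtain a' where a': "a = 2 * a' + 1" by (blast elim: oddE)
      \<comment> \<open>An odd index lies strictly below the even bound, so its right neighbour is
        still in range. One of the two increments next to it is small, and the neighbour across that
        increment is the one to move to.\<close>
      have "2 * a' + 2 \<le> N * 2 ^ Suc ?k" using a a' unfolding Q by presburger
      from triple[OF _ this] have "min (norm (x (Suc ?k) a - x ?k a')) (norm (x ?k (Suc a') - x (Suc ?k) a)) \<le> \<theta> (Suc ?k)"
        using refine[of ?k a'] refine[of ?k "Suc a'"] by (simp add: a')
      then consider "norm (x (Suc ?k) a - x ?k a') \<le> \<theta> (Suc ?k)" | "norm (x (Suc ?k) a - x ?k (Suc a')) \<le> \<theta> (Suc ?k)"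
        by (auto simp: min_le_iff_disj norm_minus_commute)
      then show ?thesis
      proof cases
        case 1 then show ?thesis using a' by (intro exI[of _ a']) auto
      next
        case 2 then show ?thesis using a' by (intro exI[of _ "Suc a'"]) auto
      qed
    qed
    note pr = this
    define p where "p = (\<lambda>a. SOME a'. a \<le> 2 * a' + 1 \<and> 2 * a' \<le> a + 1 \<and> (even a \<longrightarrow> a = 2 * a') \<and> norm (x (Suc ?k) a - x ?k a') \<le> \<theta> (Suc ?k))"
    have p: "a \<le> 2 * p a + 1 \<and> 2 * p a \<le> a + 1 \<and> (even a \<longrightarrow> a = 2 * p a) \<and> norm (x (Suc ?k) a - x ?k (p a)) \<le> \<theta> (Suc ?k)"
      if "a \<le> N * 2 ^ Suc ?k" for a unfolding p_def by (rule someI_ex[OF pr[OF that]])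
    have ev: "even (N * 2 ^ Suc ?k)" by simp
    have le: "a \<le> N * 2 ^ Suc ?k" "b \<le> N * 2 ^ Suc ?k" "c \<le> N * 2 ^ Suc ?k" using Suc.prems by auto
    \<comment> \<open>Measured on the finer level, even indices stay put and odd ones move by one,
      while distinct odd indices are at least two apart; so rounding never crosses.\<close>
    have mono: "p u \<le> p v" if "u \<le> v" "v \<le> N * 2 ^ Suc ?k" for u v
    proof (cases "u = v")
      case False
      with that p[of u] p[of v] show ?thesis proof -
      have "u < v" using False that by simp
      show ?thesis
      proof (cases "even u \<or> even v")
        case True
        with p[of u] p[of v] that \<open>u < v\<close> show ?thesis by auto
      next
        case False
        then have "u + 2 \<le> v" using \<open>u < v\<close> by presburger
        with p[of u] p[of v] that show ?thesis by auto
      qed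
    qed
    qed simp
    have 1: "p a \<le> p b" "p b \<le> p c" using mono Suc.prems le by auto
    have 2: "p c \<le> N * 2 ^ ?k"
    proof -
      have "2 * p c \<le> c + 1" "even c \<longrightarrow> c = 2 * p c" "c \<le> 2 * Q" using p[OF le(3)] le(3) Q by auto
      then have "p c \<le> Q" by presburger
      then show ?thesis unfolding Q_def .
    qed
    have 3: "p c < p a + 2 + 2 ^ l"
    proof -
      have "2 * p c < 2 * (p a + 2 + 2 ^ l)" using p[OF le(3)] p[OF le(1)] Suc.prems(4) by simp
      then show ?thesis by simp
    qed
    have IH: "min (norm (x ?k (p b) - x ?k (p a))) (norm (x ?k (p c) - x ?k (p b))) \<le> \<theta> m + 2 * (\<Sum>j\<in>{m<..m+l}. \<theta> j)"
      using Suc.IH[OF 1 2 3] .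
    have tri: "norm (x (Suc ?k) v - x (Suc ?k) u) \<le> norm (x ?k (p v) - x ?k (p u)) + 2 * \<theta> (Suc ?k)"
      if "u \<le> N * 2 ^ Suc ?k" "v \<le> N * 2 ^ Suc ?k" for u v
    proof -
      have "x (Suc ?k) v - x (Suc ?k) u = (x ?k (p v) - x ?k (p u)) + (x (Suc ?k) v - x ?k (p v)) - (x (Suc ?k) u - x ?k (p u))" by simp
      also have "norm \<dots> \<le> norm (x ?k (p v) - x ?k (p u)) + norm (x (Suc ?k) v - x ?k (p v)) + norm (x (Suc ?k) u - x ?k (p u))"
        by (intro order_trans[OF norm_triangle_ineq4] add_right_mono norm_triangle_ineq)
      finally show ?thesis using p[OF that(1)] p[OF that(2)] by linarith
    qed
    have "{m<..m + Suc l} = insert (Suc ?k) {m<..m+l}" by auto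
    then have "(\<Sum>j\<in>{m<..m + Suc l}. \<theta> j) = \<theta> (Suc ?k) + (\<Sum>j\<in>{m<..m+l}. \<theta> j)" by simp
    with IH tri[OF le(1,2)] tri[OF le(2,3)] show ?case by (simp add: min_le_iff_disj) linarith
  qed
  have "{m..m+l} = insert m {m<..m+l}" by auto
  then have "2 * (\<Sum>j=m..m+l. \<theta> j) = 2 * \<theta> m + 2 * (\<Sum>j\<in>{m<..m+l}. \<theta> j)" by simp
  moreover have "c < a + 2 + 2 ^ l" using assms(7) by linarith
  ultimately show ?thesis using gen[OF assms(4-6)] \<theta>[of m] by linarith
qed

section \<open>Dyadic times and rounding to them\<close>

definition dyadic_times :: "real set" where
  "dyadic_times = {real i / 2 ^ m | i m. True}"

text \<open>For nonnegative \<open>t\<close> this is the first point of level \<open>m\<close>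
  strictly after \<open>t\<close>. Strictness makes it an approach from the right even when
  \<open>t\<close> itself is dyadic; being monotone in \<open>t\<close>, it keeps ordered times
  ordered.\<close>

definition dyadic_above :: "nat \<Rightarrow> real \<Rightarrow> real" where
  "dyadic_above m t = real (nat \<lfloor>t * 2 ^ m\<rfloor> + 1) / 2 ^ m"

lemma dyadic_timesI [intro]: "real i / 2 ^ m \<in> dyadic_times"
  unfolding dyadic_times_def by blast

lemma dyadic_above_in [simp]: "dyadic_above m t \<in> dyadic_times"
  unfolding dyadic_above_def by blast

text \<open>Phrased for all levels beyond some \<open>M\<close>, so that several times can be
  brought to one common level by a maximum or a sum.\<close>

lemma dyadic_times_common_level:
  assumes "t \<in> dyadic_times"
  obtains M where "\<And>k. M \<le> k \<Longrightarrow> \<exists>i. t = real i / 2 ^ k"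
proof -
  obtain i m where t: "t = real i / 2 ^ m" using assms by (auto simp: dyadic_times_def)
  show ?thesis
  proof (rule that[of m])
    fix k assume "m \<le> k"
    then have "(2::real) ^ k = 2 ^ (k - m) * 2 ^ m" by (simp flip: power_add)
    then have "t = real (i * 2 ^ (k - m)) / 2 ^ k" using t by simp
    then show "\<exists>i. t = real i / 2 ^ k" by blast
  qed
qed

lemma dyadic_times_add: assumes "s \<in> dyadic_times" "t \<in> dyadic_times" shows "s + t \<in> dyadic_times"
proof -
  obtain M M' where M: "\<And>k. M \<le> k \<Longrightarrow> \<exists>i. s = real i / 2 ^ k" "\<And>k. M' \<le> k \<Longrightarrow> \<exists>i. t = real i / 2 ^ k"
    using assms by (metis dyadic_times_common_level)
  then obtain i j where "s = real i / 2 ^ max M M'" "t = real j / 2 ^ max M M'" by (meson max.cobounded1 max.cobounded2)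
  then have "s + t = real (i + j) / 2 ^ max M M'" by (simp add: add_divide_distrib)
  then show ?thesis by (simp only: dyadic_timesI)
qed

lemma dyadic_times_diff:
  assumes "s \<in> dyadic_times" "t \<in> dyadic_times" "s \<le> t" shows "t - s \<in> dyadic_times"
proof -
  obtain M M' where M: "\<And>k. M \<le> k \<Longrightarrow> \<exists>i. s = real i / 2 ^ k" "\<And>k. M' \<le> k \<Longrightarrow> \<exists>i. t = real i / 2 ^ k"
    using assms by (metis dyadic_times_common_level)
  then obtain i j where ij: "s = real i / 2 ^ max M M'" "t = real j / 2 ^ max M M'" by (meson max.cobounded1 max.cobounded2)
  then have "i \<le> j" using assms(3) by (simp add: divide_le_cancel)
  then have "t - s = real (j - i) / 2 ^ max M M'" using ij by (simp add: of_nat_diff diff_divide_distrib)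
  then show ?thesis by (simp only: dyadic_timesI)
qed

lemma dyadic_times_nonneg: "t \<in> dyadic_times \<Longrightarrow> 0 \<le> t"
  by (auto simp: dyadic_times_def)

lemma countable_dyadic_times: "countable dyadic_times"
proof -
  have "dyadic_times = (\<lambda>(i, m). real i / 2 ^ m) ` UNIV" by (auto simp: dyadic_times_def)
  then show ?thesis by (metis countable_image countableI_type)
qed

lemma
  assumes "0 \<le> t"
  shows dyadic_above_gt: "t < dyadic_above m t" and dyadic_above_le: "dyadic_above m t \<le> t + (1/2) ^ m"
proof -
  have "real (nat \<lfloor>t * 2 ^ m\<rfloor>) = of_int \<lfloor>t * 2 ^ m\<rfloor>" using assms by simp
  then have "t * 2 ^ m < real (nat \<lfloor>t * 2 ^ m\<rfloor> + 1)" "real (nat \<lfloor>t * 2 ^ m\<rfloor> + 1) \<le> t * 2 ^ m + 1" by linarith+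
  then have "t * 2 ^ m / 2 ^ m < dyadic_above m t" "dyadic_above m t \<le> (t * 2 ^ m + 1) / 2 ^ m"
    unfolding dyadic_above_def by (intro divide_strict_right_mono divide_right_mono; simp)+
  then show "t < dyadic_above m t" "dyadic_above m t \<le> t + (1/2) ^ m"
    by (simp_all add: add_divide_distrib power_one_over)
qed

lemma dyadic_above_mono: "s \<le> t \<Longrightarrow> dyadic_above m s \<le> dyadic_above m t"
  unfolding dyadic_above_def by (intro divide_right_mono) (auto intro!: nat_mono floor_mono)

lemma dyadic_above_tendsto:
  assumes "0 \<le> t" shows "(\<lambda>m. dyadic_above m t) \<longlonglongrightarrow> t"
proof (rule tendsto_sandwich)
  show "\<forall>\<^sub>F m in sequentially. t \<le> dyadic_above m t"
    using dyadic_above_gt[OF assms] by (intro always_eventually allI less_imp_le)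
  show "\<forall>\<^sub>F m in sequentially. dyadic_above m t \<le> t + (1/2) ^ m"
    using dyadic_above_le[OF assms] by (intro always_eventually allI)
  show "(\<lambda>m. t + (1/2) ^ m) \<longlonglongrightarrow> t"
    using tendsto_add[OF tendsto_const LIMSEQ_realpow_zero[of "1/2"], of t] by simp
qed simp

text \<open>Counterpart of \<open>dyadic_above\<close> for left limits: the last point of level
  \<open>m\<close> strictly before a positive \<open>t\<close>.\<close>

definition dyadic_below :: "nat \<Rightarrow> real \<Rightarrow> real" where
  "dyadic_below m t = real (nat (\<lceil>t * 2 ^ m\<rceil> - 1)) / 2 ^ m"

lemma dyadic_below_in [simp]: "dyadic_below m t \<in> dyadic_times"
  unfolding dyadic_below_def by blast

lemma
  assumes "0 < t"
  shows dyadic_below_less: "dyadic_below m t < t" and dyadic_below_ge: "t - (1/2) ^ m \<le> dyadic_below m t"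
proof -
  have "0 < t * 2 ^ m" using assms by simp
  then have "real (nat (\<lceil>t * 2 ^ m\<rceil> - 1)) = of_int \<lceil>t * 2 ^ m\<rceil> - 1" by simp
  then have "real (nat (\<lceil>t * 2 ^ m\<rceil> - 1)) < t * 2 ^ m" "t * 2 ^ m - 1 \<le> real (nat (\<lceil>t * 2 ^ m\<rceil> - 1))" by linarith+
  then have "dyadic_below m t < t * 2 ^ m / 2 ^ m" "(t * 2 ^ m - 1) / 2 ^ m \<le> dyadic_below m t"
    unfolding dyadic_below_def by (intro divide_strict_right_mono divide_right_mono; simp)+
  then show "dyadic_below m t < t" "t - (1/2) ^ m \<le> dyadic_below m t"
    by (simp_all add: diff_divide_distrib power_one_over)
qed

lemma dyadic_below_tendsto:
  assumes "0 < t" shows "(\<lambda>m. dyadic_below m t) \<longlonglongrightarrow> t"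
proof (rule tendsto_sandwich)
  show "\<forall>\<^sub>F m in sequentially. dyadic_below m t \<le> t"
    using dyadic_below_less[OF assms] by (intro always_eventually allI less_imp_le)
  show "\<forall>\<^sub>F m in sequentially. t - (1/2) ^ m \<le> dyadic_below m t"
    using dyadic_below_ge[OF assms] by (intro always_eventually allI)
  show "(\<lambda>m. t - (1/2) ^ m) \<longlonglongrightarrow> t"
    using tendsto_diff[OF tendsto_const LIMSEQ_realpow_zero[of "1/2"], of t] by simp
qed simp

section \<open>One-sided limits along dyadic times and cadlag paths\<close>

text \<open>Completeness provides a limit along a sequence; \<open>s\<close> supplies this
  candidate, and the two-point condition spreads it to the whole punctured neighbourhood.\<close>

lemma Cauchy_within_imp_tendsto:
  fixes X :: "real \<Rightarrow> 'a::complete_space"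
  assumes s: "\<And>n. s n \<in> A - {t}" "s \<longlonglongrightarrow> t"
    and C: "\<And>e. e > 0 \<Longrightarrow> \<exists>d>0. \<forall>u\<in>A - {t}. \<forall>v\<in>A - {t}. \<bar>u - t\<bar> < d \<longrightarrow> \<bar>v - t\<bar> < d \<longrightarrow> dist (X u) (X v) \<le> e"
  shows "\<exists>l. (X \<longlongrightarrow> l) (at t within A)"
proof -
  have s_ev: "\<exists>n0. \<forall>n\<ge>n0. \<bar>s n - t\<bar> < d" if "d > 0" for d
    using s(2) that unfolding LIMSEQ_def dist_real_def by blast
  have "Cauchy (\<lambda>n. X (s n))"
    unfolding Cauchy_altdef2
  proof (intro allI impI)
    fix e :: real assume "e > 0"
    then obtain d where d: "d > 0" "\<And>u v. u \<in> A - {t} \<Longrightarrow> v \<in> A - {t} \<Longrightarrow> \<bar>u - t\<bar> < d \<Longrightarrow> \<bar>v - t\<bar> < d \<Longrightarrow> dist (X u) (X v) \<le> e/2"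
      using C[of "e/2"] by auto
    obtain n0 where "\<forall>n\<ge>n0. \<bar>s n - t\<bar> < d" using s_ev[OF d(1)] by blast
    then have "dist (X (s n)) (X (s n0)) \<le> e/2" if "n \<ge> n0" for n using d(2) s(1) that by blast
    then show "\<exists>N. \<forall>n\<ge>N. dist (X (s n)) (X (s N)) < e" using \<open>e > 0\<close> by (intro exI[of _ n0]) force
  qed
  then obtain l where l: "(\<lambda>n. X (s n)) \<longlonglongrightarrow> l" using Cauchy_convergent convergent_def by blast
  have "(X \<longlongrightarrow> l) (at t within A)"
  proof (rule Lim_withinI)
    fix e :: real assume "e > 0"
    then obtain d where d: "d > 0" "\<And>u v. u \<in> A - {t} \<Longrightarrow> v \<in> A - {t} \<Longrightarrow> \<bar>u - t\<bar> < d \<Longrightarrow> \<bar>v - t\<bar> < d \<Longrightarrow> dist (X u) (X v) \<le> e"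
      using C[of e] by auto
    obtain n0 where n0: "\<forall>n\<ge>n0. \<bar>s n - t\<bar> < d" using s_ev[OF d(1)] by blast
    have "dist (X u) l \<le> e" if "u \<in> A" "0 < dist u t" "dist u t < d" for u
    proof (rule LIMSEQ_le_const2[OF tendsto_dist[OF tendsto_const l]])
      show "\<exists>N. \<forall>n\<ge>N. dist (X u) (X (s n)) \<le> e"
        using that d(2)[of u] s(1) n0 by (intro exI[of _ n0]) (auto simp: dist_real_def)
    qed
    then show "\<exists>d>0. \<forall>x\<in>A. 0 < dist x t \<and> dist x t < d \<longrightarrow> dist (X x) l \<le> e" using d(1) by blast
  qed
  then show ?thesis by blast
qed

text \<open>This says that the modulus known as w'' in the theory of the Skorokhod space tends to 0,
  restricted to dyadic times up to \<open>N\<close>. A single jump inside a short window enlarges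
  only one of the two increments, so jumps are allowed; two large jumps close together are
  not.\<close>

definition three_point_regular :: "(real \<Rightarrow> 'a::real_normed_vector) \<Rightarrow> bool" where
  "three_point_regular X \<longleftrightarrow> (\<forall>e>0. \<forall>N::nat. \<exists>d>0. \<forall>r\<in>dyadic_times. \<forall>s\<in>dyadic_times. \<forall>t\<in>dyadic_times.
     r \<le> s \<longrightarrow> s \<le> t \<longrightarrow> t \<le> real N \<longrightarrow> t - r < d \<longrightarrow> min (norm (X s - X r)) (norm (X t - X s)) \<le> e)"

text \<open>Geometric thresholds have a finite sum, so the chaining bound stays below
  \<open>2 / (1 - \<theta>) * \<theta> ^ m\<close>, uniformly in the level \<open>m + l\<close> on
  which the three times happen to lie.\<close>

lemma three_point_regular_chaining:
  fixes X :: "real \<Rightarrow> 'a::real_normed_vector"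
  assumes \<theta>: "0 < \<theta>" "\<theta> < 1"
    and triple: "\<And>N::nat. \<exists>m0. \<forall>m\<ge>m0. \<forall>i. i + 2 \<le> N * 2 ^ m \<longrightarrow>
      min (norm (X (real (i + 1) / 2 ^ m) - X (real i / 2 ^ m)))
          (norm (X (real (i + 2) / 2 ^ m) - X (real (i + 1) / 2 ^ m))) \<le> \<theta> ^ m"
  shows "three_point_regular X"
  unfolding three_point_regular_def
proof (intro allI impI)
  fix e :: real and N :: nat assume e: "e > 0"
  obtain m0 where m0: "\<And>m i. m \<ge> m0 \<Longrightarrow> i + 2 \<le> N * 2 ^ m \<Longrightarrow>
      min (norm (X (real (i + 1) / 2 ^ m) - X (real i / 2 ^ m)))
          (norm (X (real (i + 2) / 2 ^ m) - X (real (i + 1) / 2 ^ m))) \<le> \<theta> ^ m"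
    using triple[of N] by blast
  have "(\<lambda>m. 2 / (1 - \<theta>) * \<theta> ^ m) \<longlonglongrightarrow> 2 / (1 - \<theta>) * 0"
    using \<theta> by (intro tendsto_mult_left LIMSEQ_realpow_zero) auto
  then have "\<forall>\<^sub>F m in sequentially. 2 / (1 - \<theta>) * \<theta> ^ m < e" using e by (intro order_tendstoD(2)) auto
  then obtain m where m: "m \<ge> m0" "2 / (1 - \<theta>) * \<theta> ^ m < e"
    using eventually_conj[OF eventually_ge_at_top[of m0]] eventually_happens' sequentially_bot by (metis (mono_tags, lifting))
  show "\<exists>d>0. \<forall>r\<in>dyadic_times. \<forall>s\<in>dyadic_times. \<forall>t\<in>dyadic_times.
     r \<le> s \<longrightarrow> s \<le> t \<longrightarrow> t \<le> real N \<longrightarrow> t - r < d \<longrightarrow> min (norm (X s - X r)) (norm (X t - X s)) \<le> e"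
  proof (intro exI[of _ "1 / 2 ^ m"] conjI ballI impI)
    fix r s t assume rst: "r \<in> dyadic_times" "s \<in> dyadic_times" "t \<in> dyadic_times" "r \<le> s" "s \<le> t" "t \<le> real N" "t - r < 1 / 2 ^ m"
    obtain Mr Ms Mt where M: "\<And>k. Mr \<le> k \<Longrightarrow> \<exists>i. r = real i / 2 ^ k" "\<And>k. Ms \<le> k \<Longrightarrow> \<exists>i. s = real i / 2 ^ k"
      "\<And>k. Mt \<le> k \<Longrightarrow> \<exists>i. t = real i / 2 ^ k"
      using rst(1-3) by (metis dyadic_times_common_level)
    define l where "l = Mr + Ms + Mt"
    obtain a b c where abc: "r = real a / 2 ^ (m + l)" "s = real b / 2 ^ (m + l)" "t = real c / 2 ^ (m + l)"
      using M(1)[of "m + l"] M(2)[of "m + l"] M(3)[of "m + l"] by (auto simp: l_def)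
    have ord: "a \<le> b" "b \<le> c" using rst by (simp_all add: abc divide_le_cancel)
    have "real c \<le> real (N * 2 ^ (m + l))" using rst(6) by (simp add: abc field_simps)
    then have cN: "c \<le> N * 2 ^ (m + l)" by (simp only: of_nat_le_iff)
    have "(real c - real a) / 2 ^ (m + l) < 2 ^ l / 2 ^ (m + l)"
      using rst(7) by (simp add: abc diff_divide_distrib power_add)
    then have "real c - real a < 2 ^ l" by (simp add: divide_less_cancel)
    then have "real c < real (a + 2 ^ l)" by simp
    then have cd: "c < a + 2 ^ l" by (simp only: of_nat_less_iff)
    have "min (norm (X s - X r)) (norm (X t - X s)) \<le> 2 * (\<Sum>j=m..m+l. \<theta> ^ j)"
      unfolding abc
    proof (rule dyadic_chaining[where x = "\<lambda>k i. X (real i / 2 ^ k)" and \<theta> = "\<lambda>j. \<theta> ^ j", OF _ _ _ ord cN cd])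
      show "X (real (2 * i) / 2 ^ Suc j) = X (real i / 2 ^ j)" for i j by simp
    qed (use m0 m \<theta> in \<open>auto intro: order_trans\<close>)
    also have "(\<Sum>j=m..m+l. \<theta> ^ j) = (\<theta> ^ m - \<theta> ^ Suc (m + l)) / (1 - \<theta>)"
      using \<theta> by (subst sum_gp) auto
    also have "\<dots> \<le> \<theta> ^ m / (1 - \<theta>)" using \<theta> by (intro divide_right_mono) auto
    finally show "min (norm (X s - X r)) (norm (X t - X s)) \<le> e" using m(2) by simp
  qed simp
qed

text \<open>
  If $u < v$ are close to $t$ and $|X_v - X_u|$ is large, then every $X_r$ with $r$ between $t$ and $u$ must be
  close to $X_u$, so $X$ is Cauchy at $t$ in either case.
\<close>

lemma three_point_regular_right:
  fixes X :: "real \<Rightarrow> 'a::banach"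
  assumes X: "three_point_regular X" and t: "0 \<le> t"
  shows "\<exists>l. (X \<longlongrightarrow> l) (at t within dyadic_times \<inter> {t<..})"
proof (rule Cauchy_within_imp_tendsto)
  show "(\<lambda>m. dyadic_above m t) \<longlonglongrightarrow> t" using t by (rule dyadic_above_tendsto)
  show "dyadic_above m t \<in> dyadic_times \<inter> {t<..} - {t}" for m using dyadic_above_gt[OF t, of m] by simp
  fix e :: real assume "e > 0"
  \<comment> \<open>All points considered lie in a window of length at most 1 after
    \<open>t\<close>, hence below \<open>N\<close>.\<close>
  define N where "N = nat \<lceil>t\<rceil> + 1"
  have N: "t + 1 \<le> real N" unfolding N_def by linarith
  obtain d where d: "d > 0" "\<And>r s u. r \<in> dyadic_times \<Longrightarrow> s \<in> dyadic_times \<Longrightarrow> u \<in> dyadic_times \<Longrightarrow> r \<le> s \<Longrightarrow> s \<le> u \<Longrightarrow> u \<le> real N \<Longrightarrow> u - r < d \<Longrightarrow>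
      min (norm (X s - X r)) (norm (X u - X s)) \<le> e / 2"
    using X[unfolded three_point_regular_def, rule_format, of "e/2" N] \<open>e > 0\<close> by auto
  define d' where "d' = min d 1"
  have d': "d' > 0" "d' \<le> d" "d' \<le> 1" using d(1) by (auto simp: d'_def)
  let ?A = "dyadic_times \<inter> {t<..} - {t}"
  show "\<exists>d>0. \<forall>u\<in>?A. \<forall>v\<in>?A. \<bar>u - t\<bar> < d \<longrightarrow> \<bar>v - t\<bar> < d \<longrightarrow> dist (X u) (X v) \<le> e"
  proof (cases "\<exists>u v. u \<in> dyadic_times \<and> v \<in> dyadic_times \<and> t < u \<and> u < v \<and> v < t + d' \<and> dist (X u) (X v) > e / 2")
    case True
    then obtain u v where uv: "u \<in> dyadic_times" "v \<in> dyadic_times" "t < u" "u < v" "v < t + d'" "dist (X u) (X v) > e / 2" by blast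
    have *: "dist (X r) (X u) \<le> e / 2" if "r \<in> dyadic_times" "t < r" "r < u" for r
      using d(2)[of r u v] uv that d' N by (auto simp: dist_norm norm_minus_commute min_le_iff_disj)
    show ?thesis
    proof (intro exI[of _ "u - t"] conjI ballI impI)
      fix r r' assume "r \<in> ?A" "r' \<in> ?A" "\<bar>r - t\<bar> < u - t" "\<bar>r' - t\<bar> < u - t"
      then have "dist (X r) (X u) \<le> e / 2" "dist (X r') (X u) \<le> e / 2" using * by auto
      then show "dist (X r) (X r') \<le> e" using dist_triangle2[of "X r" "X r'" "X u"] by linarith
    qed (use uv in simp)
  next
    case False
    show ?thesis
    proof (intro exI[of _ d'] conjI ballI impI)
      fix u v assume "u \<in> ?A" "v \<in> ?A" "\<bar>u - t\<bar> < d'" "\<bar>v - t\<bar> < d'"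
      then show "dist (X u) (X v) \<le> e" using False \<open>e > 0\<close>
        by (cases u v rule: linorder_cases) (force simp: dist_commute not_less)+
    qed (use d' in simp)
  qed
qed

lemma three_point_regular_left:
  fixes X :: "real \<Rightarrow> 'a::banach"
  assumes X: "three_point_regular X" and t: "0 < t"
  shows "\<exists>l. (X \<longlongrightarrow> l) (at t within dyadic_times \<inter> {..<t})"
proof (rule Cauchy_within_imp_tendsto)
  show "(\<lambda>m. dyadic_below m t) \<longlonglongrightarrow> t" using t by (rule dyadic_below_tendsto)
  show "dyadic_below m t \<in> dyadic_times \<inter> {..<t} - {t}" for m using dyadic_below_less[OF t, of m] by simp
  fix e :: real assume "e > 0"
  define N where "N = nat \<lceil>t\<rceil> + 1"
  have N: "t \<le> real N" unfolding N_def by linarith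
  obtain d where d: "d > 0" "\<And>r s u. r \<in> dyadic_times \<Longrightarrow> s \<in> dyadic_times \<Longrightarrow> u \<in> dyadic_times \<Longrightarrow> r \<le> s \<Longrightarrow> s \<le> u \<Longrightarrow> u \<le> real N \<Longrightarrow> u - r < d \<Longrightarrow>
      min (norm (X s - X r)) (norm (X u - X s)) \<le> e / 2"
    using X[unfolded three_point_regular_def, rule_format, of "e/2" N] \<open>e > 0\<close> by auto
  let ?A = "dyadic_times \<inter> {..<t} - {t}"
  show "\<exists>d>0. \<forall>u\<in>?A. \<forall>v\<in>?A. \<bar>u - t\<bar> < d \<longrightarrow> \<bar>v - t\<bar> < d \<longrightarrow> dist (X u) (X v) \<le> e"
  proof (cases "\<exists>u v. u \<in> dyadic_times \<and> v \<in> dyadic_times \<and> t - d < u \<and> u < v \<and> v < t \<and> dist (X u) (X v) > e / 2")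
    case True
    then obtain u v where uv: "u \<in> dyadic_times" "v \<in> dyadic_times" "t - d < u" "u < v" "v < t" "dist (X u) (X v) > e / 2" by blast
    have *: "dist (X r) (X v) \<le> e / 2" if "r \<in> dyadic_times" "v < r" "r < t" for r
      using d(2)[of u v r] uv that N by (auto simp: dist_norm norm_minus_commute min_le_iff_disj)
    show ?thesis
    proof (intro exI[of _ "t - v"] conjI ballI impI)
      fix r r' assume "r \<in> ?A" "r' \<in> ?A" "\<bar>r - t\<bar> < t - v" "\<bar>r' - t\<bar> < t - v"
      then have "dist (X r) (X v) \<le> e / 2" "dist (X r') (X v) \<le> e / 2" using * by auto
      then show "dist (X r) (X r') \<le> e" using dist_triangle2[of "X r" "X r'" "X v"] by linarith
    qed (use uv in simp)
  next
    case False
    show ?thesis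
    proof (intro exI[of _ d] conjI ballI impI)
      fix u v assume "u \<in> ?A" "v \<in> ?A" "\<bar>u - t\<bar> < d" "\<bar>v - t\<bar> < d"
      then show "dist (X u) (X v) \<le> e" using False \<open>e > 0\<close>
        by (cases u v rule: linorder_cases) (force simp: dist_commute not_less)+
    qed (use d in simp)
  qed
qed

lemma tendsto_within_dyadic_times_above:
  assumes "(X \<longlongrightarrow> l) (at t within dyadic_times \<inter> {t<..})"
    and "\<And>m. s m \<in> dyadic_times" "\<And>m. t < s m" "s \<longlonglongrightarrow> t"
  shows "(\<lambda>m. X (s m)) \<longlonglongrightarrow> l"
proof (rule filterlim_compose[OF assms(1)])
  show "filterlim s (at t within dyadic_times \<inter> {t<..}) sequentially"
    unfolding filterlim_at using assms(2-4) by (auto intro!: always_eventually simp: less_imp_neq[symmetric])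
qed

text \<open>A bound on the distance of \<open>X\<close> from a point, valid at the dyadic times of
  an interval, passes to \<open>Y\<close> throughout the interval, because each \<open>Y s\<close>
  is a limit of values of \<open>X\<close> just to the right of \<open>s\<close>; this is
  \<open>close\<close>. One-sided limits of \<open>X\<close> along dyadic times thus become
  one-sided limits of \<open>Y\<close>.\<close>

lemma cadlag_right_limits:
  fixes X :: "real \<Rightarrow> 'a::metric_space"
  assumes Y: "\<And>t. 0 \<le> t \<Longrightarrow> (X \<longlongrightarrow> Y t) (at t within dyadic_times \<inter> {t<..})"
    and L: "\<And>t. 0 < t \<Longrightarrow> \<exists>l. (X \<longlongrightarrow> l) (at t within dyadic_times \<inter> {..<t})"
  shows "cadlag Y"
proof -
  have close: "dist (Y s) l \<le> e" if "0 \<le> s" "s < b" "\<And>q. q \<in> dyadic_times \<Longrightarrow> s < q \<Longrightarrow> q < b \<Longrightarrow> dist (X q) l \<le> e" for s b l e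
  proof (rule LIMSEQ_le_const2)
    show "(\<lambda>m. dist (X (dyadic_above m s)) l) \<longlonglongrightarrow> dist (Y s) l"
      using that(1) by (intro tendsto_dist tendsto_within_dyadic_times_above[OF Y] dyadic_above_gt dyadic_above_tendsto tendsto_const) auto
    have "\<forall>\<^sub>F m in sequentially. dyadic_above m s < b"
      using order_tendstoD(2)[OF dyadic_above_tendsto] that by blast
    then show "\<exists>N. \<forall>n\<ge>N. dist (X (dyadic_above n s)) l \<le> e"
      unfolding eventually_sequentially using that(3) dyadic_above_gt[OF that(1)] by (meson dyadic_above_in)
  qed
  show ?thesis
    unfolding cadlag_def
  proof (intro conjI allI impI)
    fix t :: real assume t: "0 \<le> t"
    show "(Y \<longlongrightarrow> Y t) (at_right t)"
    proof (rule Lim_withinI)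
      fix e :: real assume "e > 0"
      then obtain d where d: "d > 0" "\<And>q. q \<in> dyadic_times \<Longrightarrow> t < q \<Longrightarrow> dist q t < d \<Longrightarrow> dist (X q) (Y t) < e"
        using Y[OF t] unfolding Lim_within by force
      then have "dist (Y s) (Y t) \<le> e" if "t < s" "s < t + d" for s
        using that t by (intro close[of s "t + d"]) (auto simp: dist_real_def intro!: less_imp_le[OF d(2)])
      then show "\<exists>d>0. \<forall>x\<in>{t<..}. 0 < dist x t \<and> dist x t < d \<longrightarrow> dist (Y x) (Y t) \<le> e"
        using d(1) by (intro exI[of _ d]) (auto simp: dist_real_def)
    qed
  next
    fix t :: real assume t: "0 < t"
    then obtain l where l: "(X \<longlongrightarrow> l) (at t within dyadic_times \<inter> {..<t})" using L by blast
    have "(Y \<longlongrightarrow> l) (at_left t)"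
    proof (rule Lim_withinI)
      fix e :: real assume "e > 0"
      then obtain d where d: "d > 0" "\<And>q. q \<in> dyadic_times \<Longrightarrow> q < t \<Longrightarrow> dist q t < d \<Longrightarrow> dist (X q) l < e"
        using l unfolding Lim_within by force
      then have "dist (Y s) l \<le> e" if "0 \<le> s" "s < t" "t - d < s" for s
        using that t by (intro close[of s t]) (auto simp: dist_real_def intro!: less_imp_le[OF d(2)])
      \<comment> \<open>The radius is capped by \<open>t\<close>, since \<open>Y s\<close> is a
        right limit of \<open>X\<close> only for nonnegative \<open>s\<close>.\<close>
      then show "\<exists>d>0. \<forall>x\<in>{..<t}. 0 < dist x t \<and> dist x t < d \<longrightarrow> dist (Y x) l \<le> e"
        using d(1) t by (intro exI[of _ "min d t"]) (auto simp: dist_real_def)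
    qed
    then show "\<exists>l. (Y \<longlongrightarrow> l) (at_left t)" by blast
  qed
qed


section \<open>Random walks with small steps\<close>

text \<open>Comparable to \<open>min 1 ((norm x)\<^sup>2)\<close>, but smooth. Being bounded, it has
  an expectation under every law; being smooth, it has a Taylor expansion in which a step enters
  through the two quantities controlled by (1).\<close>

definition saturated :: "'a::real_inner \<Rightarrow> real" where
  "saturated x = (norm x)\<^sup>2 / (1 + (norm x)\<^sup>2)"

lemma one_plus_norm_pos: "0 < 1 + (norm x)\<^sup>2"
  by (simp add: add_pos_nonneg)

lemma saturated_nonneg: "0 \<le> saturated x"
  by (simp add: saturated_def)

lemma saturated_less_1: "saturated x < 1"
  using one_plus_norm_pos[of x] by (simp add: saturated_def)

lemma saturated_le_1: "saturated x \<le> 1"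
  using saturated_less_1[of x] by simp

lemma saturated_zero [simp]: "saturated 0 = 0"
  by (simp add: saturated_def)

lemma saturated_eq_0_iff: "saturated x = 0 \<longleftrightarrow> x = 0"
  using one_plus_norm_pos[of x] by (simp add: saturated_def)

lemma saturated_minus: "saturated (x - y) = saturated (y - x)"
  by (simp add: saturated_def norm_minus_commute)

lemma saturated_eq: "saturated x = 1 - 1 / (1 + (norm x)\<^sup>2)"
  using one_plus_norm_pos[of x] by (simp add: saturated_def field_simps)

lemma saturated_ge: "0 \<le> a \<Longrightarrow> a \<le> norm x \<Longrightarrow> a\<^sup>2 / (1 + a\<^sup>2) \<le> saturated x"
  using one_plus_norm_pos[of x] power_mono[of a "norm x" 2] add_pos_nonneg[of 1 "a\<^sup>2"]
  by (simp add: saturated_def divide_simps) (simp add: algebra_simps)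

lemma continuous_saturated: "continuous_on A saturated"
  unfolding saturated_def
proof (intro continuous_intros ballI)
  show "1 + (norm x)\<^sup>2 \<noteq> 0" for x :: 'a using one_plus_norm_pos[of x] by simp
qed

lemma saturated_measurable [measurable]: "(saturated :: 'a::euclidean_space \<Rightarrow> real) \<in> borel_measurable borel"
  by (intro borel_measurable_continuous_onI continuous_saturated)

text \<open>The linear term carries the exact gradient at \<open>x\<close>. The increment equals
  \<open>1 / u - 1 / v\<close>; expanding it about \<open>u\<close> leaves a square with negative
  sign, which is dropped, and two terms bounded by \<open>4 * b\<close> and \<open>b\<close>, whence
  the constant 5.\<close>

lemma saturated_increment:
  "saturated (x + y) - saturated x \<le> (2 / (1 + (norm x)\<^sup>2)\<^sup>2) * (x \<bullet> y) + 5 * (norm y)\<^sup>2"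
proof -
  define u where "u = 1 + (norm x)\<^sup>2"
  define v where "v = 1 + (norm (x + y))\<^sup>2"
  define p where "p = x \<bullet> y"
  define b where "b = (norm y)\<^sup>2"
  have uv: "1 \<le> u" "1 \<le> v" by (auto simp: u_def v_def)
  have b: "0 \<le> b" by (simp add: b_def)
  have vu: "v - u = 2 * p + b"
    by (simp add: u_def v_def p_def b_def power2_norm_eq_inner inner_simps inner_commute)
  \<comment> \<open>The squared norm of \<open>x + (x + y)\<close> is nonnegative; this bounds the
    inner product from below, however large \<open>y\<close> is, and so controls the mixed term in
    \<open>p\<close> and \<open>b\<close>.\<close>
  have "- (2 * p) \<le> 3 * u + v"
  proof -
    have "0 \<le> (norm (x + (x + y)))\<^sup>2" by simp
    also have "\<dots> = (norm x)\<^sup>2 + 2 * (x \<bullet> (x + y)) + (norm (x + y))\<^sup>2"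
      by (simp add: power2_norm_eq_inner inner_simps inner_commute)
    also have "x \<bullet> (x + y) = (norm x)\<^sup>2 + p" by (simp add: p_def inner_simps power2_norm_eq_inner)
    finally have "- (2 * p) \<le> 3 * (norm x)\<^sup>2 + (norm (x + y))\<^sup>2" by (simp add: algebra_simps)
    then show ?thesis unfolding u_def v_def by simp
  qed
  also have "3 * u + v \<le> 4 * (u * v)"
  proof -
    have "u * 1 \<le> u * v" "1 * v \<le> u * v" using uv by (intro mult_mono; simp)+
    then show ?thesis by simp
  qed
  also have "\<dots> \<le> 4 * (u * v) * u" using uv mult_left_mono[of 1 u "4 * (u * v)"] by simp
  finally have p: "- (2 * p) \<le> 4 * (u * v) * u" .
  have sq: "4 * p\<^sup>2 / (u\<^sup>2 * v) \<ge> 0" using uv by simp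
  have "saturated (x + y) - saturated x = 1 / u - 1 / v"
    by (simp add: saturated_eq u_def v_def)
  also have "\<dots> = 2 * p / u\<^sup>2 - 4 * p\<^sup>2 / (u\<^sup>2 * v) + (- (2 * p)) * b / (u\<^sup>2 * v) + b / (u * v)"
  proof -
    have v: "v = u + 2 * p + b" using vu by simp
    have nz: "u \<noteq> 0" "v \<noteq> 0" using uv by auto
    have "(1 / u - 1 / v) * (u\<^sup>2 * v) = u * v - u * u"
      using nz by (simp add: field_simps power2_eq_square)
    moreover have "(2 * p / u\<^sup>2 - 4 * p\<^sup>2 / (u\<^sup>2 * v) + (- (2 * p)) * b / (u\<^sup>2 * v) + b / (u * v)) * (u\<^sup>2 * v)
        = 2 * p * v - 4 * p\<^sup>2 - 2 * p * b + b * u"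
    proof -
      have "2 * p / u\<^sup>2 * (u\<^sup>2 * v) = 2 * p * v" "4 * p\<^sup>2 / (u\<^sup>2 * v) * (u\<^sup>2 * v) = 4 * p\<^sup>2"
        "(- (2 * p)) * b / (u\<^sup>2 * v) * (u\<^sup>2 * v) = - (2 * p * b)" "b / (u * v) * (u\<^sup>2 * v) = b * u"
        using nz by (simp_all add: power2_eq_square)
      then show ?thesis by (simp only: distrib_right left_diff_distrib)
    qed
    moreover have "u * v - u * u = 2 * p * v - 4 * p\<^sup>2 - 2 * p * b + b * u"
      unfolding v by (simp add: algebra_simps power2_eq_square)
    ultimately have "(1 / u - 1 / v) * (u\<^sup>2 * v) = (2 * p / u\<^sup>2 - 4 * p\<^sup>2 / (u\<^sup>2 * v) + (- (2 * p)) * b / (u\<^sup>2 * v) + b / (u * v)) * (u\<^sup>2 * v)"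
      by simp
    then show ?thesis using nz by simp
  qed
  also have "(- (2 * p)) * b / (u\<^sup>2 * v) \<le> 4 * b"
  proof -
    have "(- (2 * p)) * b \<le> 4 * (u * v) * u * b" using p b by (rule mult_right_mono)
    then have "(- (2 * p)) * b / (u\<^sup>2 * v) \<le> 4 * (u * v) * u * b / (u\<^sup>2 * v)"
      using uv by (intro divide_right_mono) auto
    also have "\<dots> = 4 * b" using uv by (simp add: power2_eq_square)
    finally show ?thesis .
  qed
  also have "b / (u * v) \<le> b"
    using uv b mult_mono[of 1 u 1 v] mult_left_mono[of 1 "u * v" b] by (simp add: pos_divide_le_eq)
  finally have "saturated (x + y) - saturated x \<le> 2 * p / u\<^sup>2 + 5 * b" using sq by linarith
  then show ?thesis by (simp add: u_def p_def b_def)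
qed

text \<open>Bounds the coefficient of the linear term uniformly in the position of the walk.\<close>

lemma saturated_gradient_bound: "norm ((2 / (1 + (norm x)\<^sup>2)\<^sup>2) *\<^sub>R x) \<le> 1"
proof -
  have "2 * norm x \<le> 1 + (norm x)\<^sup>2" using sum_squares_bound[of 1 "norm x"] by simp
  also have "\<dots> \<le> (1 + (norm x)\<^sup>2)\<^sup>2" using one_plus_norm_pos[of x]
    by (simp add: power2_eq_square[of "1 + _"] mult_le_cancel_left1)
  finally show ?thesis using one_plus_norm_pos[of x] by (simp add: pos_divide_le_eq)
qed

text \<open>Three ranges of \<open>y\<close>. Up to norm 1 the Taylor bound is kept and its linear
  part left for the truncated mean. Between 1 and \<open>M\<close> the linear and quadratic parts
  are at most \<open>M / R\<close> and \<open>5 * M\<^sup>2 / R\<^sup>2\<close>, and the factor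
  \<open>min 1 ((norm y)\<^sup>2)\<close> equals 1. Beyond \<open>M\<close> the trivial bound 1
  remains. The vector \<open>l\<close>, a gradient at \<open>x\<close>, is the same for all
  \<open>y\<close> and can be taken out of an integral; for fixed \<open>M\<close> all but the last
  term become small as \<open>R\<close> grows.\<close>

lemma saturated_increment_scaled:
  fixes x y :: "'a::euclidean_space"
  assumes R: "R > 0" and M: "M \<ge> 1"
  shows "\<exists>l. norm l \<le> 1 / R \<and> (\<forall>y. saturated ((x + y) /\<^sub>R R) - saturated (x /\<^sub>R R)
    \<le> l \<bullet> (indicator {y. norm y \<le> 1} y *\<^sub>R y) + (5 / R\<^sup>2 + M / R + 5 * M\<^sup>2 / R\<^sup>2) * min 1 ((norm y)\<^sup>2)
      + indicator {y. norm y > M} y)"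
proof -
  define l where "l = ((2 / (1 + (norm (x /\<^sub>R R))\<^sup>2)\<^sup>2) *\<^sub>R (x /\<^sub>R R)) /\<^sub>R R"
  have l: "norm l \<le> 1 / R"
    unfolding l_def norm_scaleR[of "inverse R"] using saturated_gradient_bound[of "x /\<^sub>R R"] R
    by (simp add: field_simps)
  have inc: "saturated ((x + y) /\<^sub>R R) - saturated (x /\<^sub>R R) \<le> l \<bullet> y + 5 / R\<^sup>2 * (norm y)\<^sup>2" for y
    using saturated_increment[of "x /\<^sub>R R" "y /\<^sub>R R"] R
    by (simp add: l_def scaleR_add_right power_mult_distrib power_inverse field_simps)
  have "saturated ((x + y) /\<^sub>R R) - saturated (x /\<^sub>R R)
    \<le> l \<bullet> (indicator {y. norm y \<le> 1} y *\<^sub>R y) + (5 / R\<^sup>2 + M / R + 5 * M\<^sup>2 / R\<^sup>2) * min 1 ((norm y)\<^sup>2)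
      + indicator {y. norm y > M} y" for y
  proof -
    have pos: "0 \<le> 5 / R\<^sup>2" "0 \<le> M / R" "0 \<le> 5 * M\<^sup>2 / R\<^sup>2" using R M by auto
    consider "norm y \<le> 1" | "1 < norm y" "norm y \<le> M" | "M < norm y" by linarith
    then show ?thesis
    proof cases
      case 1
      then have "(norm y)\<^sup>2 \<le> 1" by (simp add: power_le_one)
      then have "(5 / R\<^sup>2 + M / R + 5 * M\<^sup>2 / R\<^sup>2) * min 1 ((norm y)\<^sup>2) \<ge> 5 / R\<^sup>2 * (norm y)\<^sup>2"
        using pos by (intro mult_mono) auto
      then show ?thesis using inc[of y] 1 M by (simp add: indicator_def)
    next
      case 2
      have "l \<bullet> y \<le> norm l * norm y" by (rule norm_cauchy_schwarz)
      also have "\<dots> \<le> 1 / R * M" using l 2 R by (intro mult_mono) auto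
      finally have "l \<bullet> y \<le> M / R" by simp
      moreover have "5 / R\<^sup>2 * (norm y)\<^sup>2 \<le> 5 / R\<^sup>2 * M\<^sup>2" using 2 by (intro mult_left_mono power_mono) auto
      moreover have "1 \<le> (norm y)\<^sup>2" using 2 by (simp add: one_le_power)
      ultimately show ?thesis using inc[of y] 2 by (simp add: indicator_def min_def) (use pos(1) in linarith)
    next
      case 3
      have "saturated ((x + y) /\<^sub>R R) - saturated (x /\<^sub>R R) \<le> 1"
        using saturated_le_1[of "(x + y) /\<^sub>R R"] saturated_nonneg[of "x /\<^sub>R R"] by linarith
      moreover have "0 \<le> (5 / R\<^sup>2 + M / R + 5 * M\<^sup>2 / R\<^sup>2) * min 1 ((norm y)\<^sup>2)" using pos by (intro mult_nonneg_nonneg) auto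
      ultimately show ?thesis using 3 M by (simp add: indicator_def)
    qed
  qed
  with l show ?thesis by blast
qed

section \<open>Convolution powers and random walks\<close>

lemma prob_space_convolution:
  assumes "prob_space M" "prob_space N" "sets M = sets borel" "sets N = sets borel"
  shows "prob_space (convolution M N)"
proof -
  interpret M: prob_space M by fact
  interpret N: prob_space N by fact
  interpret pair_prob_space M N ..
  note assms(3,4)[measurable_cong]
  show ?thesis unfolding convolution_def by (rule prob_space_distr) measurable
qed

lemma sets_convolution_power [simp, measurable_cong]: "sets (convolution_power M k) = sets borel"
  by (cases k) auto

lemma space_convolution_power [simp]: "space (convolution_power M k) = UNIV"
  by (cases k) auto

lemma prob_space_convolution_power:
  assumes "prob_space M" "sets M = sets borel"
  shows "prob_space (convolution_power M k)"
  by (induction k) (auto intro!: prob_space_return prob_space_convolution assms)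

lemma integral_convolution:
  fixes f :: "'a::ordered_euclidean_space \<Rightarrow> real"
  assumes "prob_space M" "prob_space N" and [measurable_cong]: "sets M = sets borel" "sets N = sets borel"
    and [measurable]: "f \<in> borel_measurable borel" and B: "\<And>x. \<bar>f x\<bar> \<le> B"
  shows "(\<integral>x. f x \<partial>convolution M N) = (\<integral>x. \<integral>y. f (y + x) \<partial>M \<partial>N)"
proof -
  interpret M: prob_space M by fact
  interpret N: prob_space N by fact
  interpret pair_prob_space M N ..
  have int: "integrable (M \<Otimes>\<^sub>M N) (\<lambda>(y, x). f (y + x))"
    by (rule integrable_const_bound[where B = B]) (use B in auto)
  have "(\<integral>x. f x \<partial>convolution M N) = (\<integral>z. (case z of (y, x) \<Rightarrow> f (y + x)) \<partial>(M \<Otimes>\<^sub>M N))"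
    unfolding convolution_def by (subst integral_distr) (auto simp: case_prod_unfold)
  also have "\<dots> = (\<integral>x. \<integral>y. f (y + x) \<partial>M \<partial>N)" using integral_snd[OF int] by simp
  finally show ?thesis .
qed

text \<open>Appending one factor raises the expectation by at most a constant independent of the
  current position, because \<open>l\<close> in the one-step bound is bounded uniformly; hence
  linear growth in \<open>k\<close>. Keeping \<open>R\<close> and \<open>M\<close> free lets the
  bound serve both small increments and tightness.\<close>

lemma saturated_convolution_power_bound:
  fixes \<nu> :: "'a::ordered_euclidean_space measure"
  assumes \<nu>: "prob_space \<nu>" and sets [measurable_cong]: "sets \<nu> = sets borel"
    and c1: "(\<integral>y. min 1 ((norm y)\<^sup>2) \<partial>\<nu>) \<le> c" and c2: "norm (LINT y:{y. norm y \<le> 1}|\<nu>. y) \<le> c"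
    and R: "R > 0" and M: "M \<ge> 1"
  shows "(\<integral>x. saturated (x /\<^sub>R R) \<partial>convolution_power \<nu> k)
    \<le> real k * (c * (1 / R + 5 / R\<^sup>2 + M / R + 5 * M\<^sup>2 / R\<^sup>2) + measure \<nu> {y. norm y > M})"
proof (induction k)
  case 0
  show ?case by (simp add: integral_return)
next
  case (Suc k)
  define K where "K = 5 / R\<^sup>2 + M / R + 5 * M\<^sup>2 / R\<^sup>2"
  define C where "C = c * (1 / R + K) + measure \<nu> {y. norm y > M}"
  have K: "K \<ge> 0" using R M by (simp add: K_def)
  interpret \<nu>: prob_space \<nu> by fact
  interpret N: prob_space "convolution_power \<nu> k" by (rule prob_space_convolution_power) fact+
  have sp: "space \<nu> = UNIV" using sets_eq_imp_space_eq[OF sets] by simp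
  have sat_int: "integrable \<nu> (\<lambda>y. saturated ((y + x) /\<^sub>R R))" for x
    by (rule \<nu>.integrable_const_bound[where B = 1]) (auto simp: saturated_nonneg saturated_le_1)
  have satk: "integrable (convolution_power \<nu> k) (\<lambda>x. saturated (x /\<^sub>R R))"
    by (rule N.integrable_const_bound[where B = 1]) (auto simp: saturated_nonneg saturated_le_1)
  have step: "(\<integral>y. saturated ((y + x) /\<^sub>R R) \<partial>\<nu>) \<le> saturated (x /\<^sub>R R) + C" for x
  proof -
    obtain l where l: "norm l \<le> 1 / R" and le: "\<And>y. saturated ((x + y) /\<^sub>R R) - saturated (x /\<^sub>R R)
      \<le> l \<bullet> (indicator {y. norm y \<le> 1} y *\<^sub>R y) + K * min 1 ((norm y)\<^sup>2) + indicator {y. norm y > M} y"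
      using saturated_increment_scaled[OF R M, of x] unfolding K_def by blast
    have int1: "integrable \<nu> (\<lambda>y. indicator {y. norm y \<le> 1} y *\<^sub>R y)"
      by (rule \<nu>.integrable_const_bound[where B = 1]) (auto simp: indicator_def)
    have int2: "integrable \<nu> (\<lambda>y. min 1 ((norm y)\<^sup>2))"
      by (rule \<nu>.integrable_const_bound[where B = 1]) auto
    have int3: "integrable \<nu> (indicator {y. norm y > M} :: 'a \<Rightarrow> real)"
      by (rule \<nu>.integrable_const_bound[where B = 1]) (auto simp: indicator_def)
    have "(\<integral>y. saturated ((y + x) /\<^sub>R R) \<partial>\<nu>) - saturated (x /\<^sub>R R)
        = (\<integral>y. saturated ((x + y) /\<^sub>R R) - saturated (x /\<^sub>R R) \<partial>\<nu>)"
      using sat_int[of x] by (simp add: add.commute \<nu>.prob_space)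
    also have "\<dots> \<le> (\<integral>y. l \<bullet> (indicator {y. norm y \<le> 1} y *\<^sub>R y) + K * min 1 ((norm y)\<^sup>2) + indicator {y. norm y > M} y \<partial>\<nu>)"
      using sat_int[of x] int1 int2 int3 le by (intro integral_mono Bochner_Integration.integrable_diff Bochner_Integration.integrable_add) (auto simp: add.commute simp del: inner_scaleR_right)
    also have "\<dots> = l \<bullet> (LINT y:{y. norm y \<le> 1}|\<nu>. y) + K * (\<integral>y. min 1 ((norm y)\<^sup>2) \<partial>\<nu>) + measure \<nu> {y. norm y > M}"
      using int1 int2 int3 by (simp add: set_lebesgue_integral_def sp del: inner_scaleR_right)
    also have "l \<bullet> (LINT y:{y. norm y \<le> 1}|\<nu>. y) \<le> norm l * norm (LINT y:{y. norm y \<le> 1}|\<nu>. y)"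
      by (rule norm_cauchy_schwarz)
    also have "\<dots> \<le> 1 / R * c" using l c2 R by (intro mult_mono) auto
    also have "K * (\<integral>y. min 1 ((norm y)\<^sup>2) \<partial>\<nu>) \<le> K * c" using c1 K by (rule mult_left_mono)
    finally show ?thesis by (simp add: C_def algebra_simps)
  qed
  have "(\<integral>x. saturated (x /\<^sub>R R) \<partial>convolution_power \<nu> (Suc k))
      = (\<integral>x. \<integral>y. saturated ((y + x) /\<^sub>R R) \<partial>\<nu> \<partial>convolution_power \<nu> k)"
    unfolding convolution_power.simps
    by (rule integral_convolution[where B = 1, OF \<nu> N.prob_space_axioms sets]) (auto simp: saturated_nonneg saturated_le_1)
  also have "\<dots> \<le> (\<integral>x. saturated (x /\<^sub>R R) + C \<partial>convolution_power \<nu> k)"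
  proof (rule integral_mono)
    have "\<bar>\<integral>y. saturated ((y + x) /\<^sub>R R) \<partial>\<nu>\<bar> \<le> 1" for x
      using \<nu>.integral_le_const[OF sat_int[of x], of 1]
      by (auto simp: saturated_nonneg saturated_le_1 abs_le_iff intro: order_trans[OF _ Bochner_Integration.integral_nonneg])
    then show "integrable (convolution_power \<nu> k) (\<lambda>x. \<integral>y. saturated ((y + x) /\<^sub>R R) \<partial>\<nu>)"
      by (intro N.integrable_const_bound[where B = 1]) auto
    show "integrable (convolution_power \<nu> k) (\<lambda>x. saturated (x /\<^sub>R R) + C)" using satk by simp
  qed (use step in auto)
  also have "\<dots> = (\<integral>x. saturated (x /\<^sub>R R) \<partial>convolution_power \<nu> k) + C"
    using satk N.prob_space by simp
  also have "\<dots> \<le> real k * C + C" using Suc unfolding C_def K_def by (simp add: add.assoc)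
  also have "\<dots> = real (Suc k) * C" by (simp add: algebra_simps)
  finally show ?case unfolding C_def K_def by (simp add: add.assoc)
qed

lemma indep_vars_coordinates:
  fixes \<nu> :: "'a::ordered_euclidean_space measure"
  assumes \<nu>: "prob_space \<nu>" and sets: "sets \<nu> = sets borel"
  shows "prob_space.indep_vars (PiM UNIV (\<lambda>_::nat. \<nu>)) (\<lambda>_. borel) (\<lambda>i \<omega>. \<omega> i) UNIV"
proof -
  interpret P: prob_space "PiM UNIV (\<lambda>_::nat. \<nu>)" by (intro prob_space_PiM \<nu>)
  have distr: "distr (PiM UNIV (\<lambda>_::nat. \<nu>)) borel (\<lambda>\<omega>. \<omega> i) = \<nu>" for i
    using distr_PiM_component[of UNIV "\<lambda>_::nat. \<nu>" i] \<nu> by (simp add: sets cong: distr_cong)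
  have "distr (PiM UNIV (\<lambda>_::nat. \<nu>)) (PiM UNIV (\<lambda>_. borel)) (\<lambda>\<omega>. \<lambda>i\<in>UNIV. \<omega> i) = PiM UNIV (\<lambda>_::nat. \<nu>)"
    by (subst distr_id2[symmetric, of "PiM UNIV (\<lambda>_::nat. \<nu>)" "PiM UNIV (\<lambda>_. borel)"])
       (auto intro!: sets_PiM_cong simp: sets restrict_UNIV cong: distr_cong)
  then show ?thesis
    by (subst P.indep_vars_iff_distr_eq_PiM') (auto simp: distr sets measurable_cong_sets[OF sets refl] intro!: measurable_component_singleton[THEN measurable_compose])
qed

text \<open>Blocks start at an arbitrary \<open>j\<close>, so that laws of increments are covered
  together with laws of the walk.\<close>

lemma random_walk_distr:
  fixes \<nu> :: "'a::ordered_euclidean_space measure"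
  assumes \<nu>: "prob_space \<nu>" and sets [measurable_cong]: "sets \<nu> = sets borel"
  shows "distr (PiM UNIV (\<lambda>_::nat. \<nu>)) borel (\<lambda>\<omega>. \<Sum>i\<in>{j..<j+k}. \<omega> i) = convolution_power \<nu> k"
proof (induction k)
  case 0
  interpret P: prob_space "PiM UNIV (\<lambda>_::nat. \<nu>)" by (intro prob_space_PiM \<nu>)
  show ?case using P.distr_const[of 0 borel] by simp
next
  case (Suc k)
  interpret P: prob_space "PiM UNIV (\<lambda>_::nat. \<nu>)" by (intro prob_space_PiM \<nu>)
  have "P.indep_var
    borel ((\<lambda>f. f (j + k)) \<circ> (\<lambda>\<omega>. restrict (\<lambda>i. \<omega> i) {j + k}))
    borel ((\<lambda>f. \<Sum>i\<in>{j..<j+k}. f i) \<circ> (\<lambda>\<omega>. restrict (\<lambda>i. \<omega> i) {j..<j+k}))"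
    by (intro P.indep_var_compose[OF P.indep_var_restrict[OF indep_vars_coordinates[OF \<nu> sets]]])
       (auto intro!: borel_measurable_sum)
  then have "P.indep_var borel (\<lambda>\<omega>. \<omega> (j + k)) borel (\<lambda>\<omega>. \<Sum>i\<in>{j..<j+k}. \<omega> i)"
    unfolding comp_def restrict_apply by (simp cong: sum.cong_simp)
  from P.sum_indep_random_variable[OF this] show ?case
    using Suc distr_PiM_component[of UNIV "\<lambda>_::nat. \<nu>" "j + k"] \<nu>
    by (simp add: add.commute sets cong: distr_cong)
qed

text \<open>Independence of increments is recorded as a product formula for expectations: in this
  form it can be transported to another probability space and passed to a limit.\<close>

lemma random_walk_increments:
  fixes \<nu> :: "'a::ordered_euclidean_space measure" and f :: "nat \<Rightarrow> 'a \<Rightarrow> real"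
  assumes \<nu>: "prob_space \<nu>" and sets [measurable_cong]: "sets \<nu> = sets borel"
    and j: "\<And>i. i < m \<Longrightarrow> j i \<le> j (Suc i)"
    and f [measurable]: "\<And>i. f i \<in> borel_measurable borel" and B: "\<And>i x. \<bar>f i x\<bar> \<le> B i"
  shows "(\<integral>\<omega>. (\<Prod>i<m. f i ((\<Sum>l<j (Suc i). \<omega> l) - (\<Sum>l<j i. \<omega> l))) \<partial>PiM UNIV (\<lambda>_::nat. \<nu>))
    = (\<Prod>i<m. \<integral>x. f i x \<partial>convolution_power \<nu> (j (Suc i) - j i))"
proof -
  interpret P: prob_space "PiM UNIV (\<lambda>_::nat. \<nu>)" by (intro prob_space_PiM \<nu>)
  define K where "K i = {j i..<j (Suc i)}" for i
  have diff: "(\<Sum>l<j (Suc i). \<omega> l) - (\<Sum>l<j i. \<omega> l) = (\<Sum>l\<in>K i. \<omega> l)" if "i < m" for i and \<omega> :: "nat \<Rightarrow> 'a"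
    using sum_diff[of "{..<j (Suc i)}" "{..<j i}" \<omega>] j[OF that]
    by (simp add: K_def lessThan_minus_lessThan)
  have jmono: "j a \<le> j b" if "a \<le> b" "b \<le> m" for a b
    using that
  proof (induction b rule: dec_induct)
    case (step n)
    then have "j a \<le> j n" by simp
    also have "\<dots> \<le> j (Suc n)" using step by (intro j) simp
    finally show ?case .
  qed simp
  \<comment> \<open>Increments over successive time intervals use disjoint blocks of
    coordinates.\<close>
  have disj: "disjoint_family_on K {..<m}"
    unfolding disjoint_family_on_def
  proof (intro ballI impI)
    fix a b assume ab: "a \<in> {..<m}" "b \<in> {..<m}" "a \<noteq> b"
    have "K a \<inter> K b = {}" if "a < b" "b < m" for a b
      using jmono[of "Suc a" b] that by (auto simp: K_def)
    then show "K a \<inter> K b = {}" using ab by (cases a b rule: linorder_cases) auto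
  qed
  have "P.indep_vars (\<lambda>i. PiM (K i) (\<lambda>_. borel)) (\<lambda>i \<omega>. restrict (\<lambda>l. \<omega> l) (K i)) {..<m}"
    using disj by (intro P.indep_vars_restrict[OF indep_vars_coordinates[OF \<nu> sets]]) auto
  then have "P.indep_vars (\<lambda>_. borel) (\<lambda>i \<omega>. (\<lambda>g. f i (\<Sum>l\<in>K i. g l)) (restrict (\<lambda>l. \<omega> l) (K i))) {..<m}"
    by (rule P.indep_vars_compose2) measurable
  then have indep: "P.indep_vars (\<lambda>_. borel) (\<lambda>i \<omega>. f i (\<Sum>l\<in>K i. \<omega> l)) {..<m}"
    by (simp cong: sum.cong)
  have "(\<integral>\<omega>. (\<Prod>i<m. f i ((\<Sum>l<j (Suc i). \<omega> l) - (\<Sum>l<j i. \<omega> l))) \<partial>PiM UNIV (\<lambda>_::nat. \<nu>))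
    = (\<integral>\<omega>. (\<Prod>i<m. f i (\<Sum>l\<in>K i. \<omega> l)) \<partial>PiM UNIV (\<lambda>_::nat. \<nu>))"
    by (intro Bochner_Integration.integral_cong prod.cong refl) (simp add: diff)
  also have "\<dots> = (\<Prod>i<m. \<integral>\<omega>. f i (\<Sum>l\<in>K i. \<omega> l) \<partial>PiM UNIV (\<lambda>_::nat. \<nu>))"
    by (rule P.indep_vars_lebesgue_integral[OF _ indep])
       (auto intro!: P.integrable_const_bound[OF AE_I2] B)
  also have "\<dots> = (\<Prod>i<m. \<integral>x. f i x \<partial>convolution_power \<nu> (j (Suc i) - j i))"
  proof (intro prod.cong refl)
    fix i assume "i \<in> {..<m}"
    then have "K i = {j i..<j i + (j (Suc i) - j i)}" using j by (auto simp: K_def)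
    then show "(\<integral>\<omega>. f i (\<Sum>l\<in>K i. \<omega> l) \<partial>PiM UNIV (\<lambda>_::nat. \<nu>)) = (\<integral>x. f i x \<partial>convolution_power \<nu> (j (Suc i) - j i))"
      by (subst random_walk_distr[OF \<nu> sets, of "j i", symmetric], subst integral_distr) auto
  qed
  finally show ?thesis .
qed


section \<open>Bounded uniformly continuous test functions\<close>

lemma saturated_diff_le:
  fixes x y :: "'a::euclidean_space"
  shows "\<bar>saturated x - saturated y\<bar> \<le> norm (x - y) + 5 * (norm (x - y))\<^sup>2"
proof -
  have *: "saturated a - saturated b \<le> norm (a - b) + 5 * (norm (a - b))\<^sup>2" for a b :: 'a
  proof -
    let ?l = "(2 / (1 + (norm b)\<^sup>2)\<^sup>2) *\<^sub>R b"
    have "?l \<bullet> (a - b) \<le> norm ?l * norm (a - b)" by (rule norm_cauchy_schwarz)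
    also have "\<dots> \<le> norm (a - b)"
      using saturated_gradient_bound[of b] by (intro mult_left_le_one_le) auto
    finally show ?thesis using saturated_increment[of b "a - b"] by simp
  qed
  from *[of x y] *[of y x] show ?thesis by (simp add: norm_minus_commute abs_le_iff)
qed

lemma uniformly_continuous_saturated:
  "uniformly_continuous_on UNIV (saturated :: 'a::euclidean_space \<Rightarrow> real)"
  unfolding uniformly_continuous_on_def
proof (intro allI impI)
  fix e :: real assume e: "e > 0"
  \<comment> \<open>At distance at most 1 the square is below the distance, so
    \<open>saturated_diff_le\<close> gives at most six times the distance.\<close>
  define d where "d = min 1 (e / 6)"
  have d: "0 < d" "d \<le> 1" "6 * d \<le> e" using e by (auto simp: d_def)
  have "dist (saturated x') (saturated x) < e" if "dist x' x < d" for x x' :: 'a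
  proof -
    have n: "norm (x' - x) < d" "norm (x' - x) \<le> 1" using that d by (auto simp: dist_norm)
    then have "(norm (x' - x))\<^sup>2 \<le> norm (x' - x)" by (simp add: power2_eq_square mult_left_le_one_le)
    then show ?thesis using saturated_diff_le[of x' x] n d by (simp add: dist_real_def)
  qed
  with d(1) show "\<exists>d>0. \<forall>x\<in>UNIV. \<forall>x'\<in>UNIV. dist x' x < d \<longrightarrow> dist (saturated x' :: real) (saturated (x :: 'a)) < e"
    by (intro exI[of _ d]) simp
qed

text \<open>Within distance \<open>d\<close> uniform continuity gives \<open>e\<close>; beyond it
  \<open>saturated\<close> is at least \<open>d\<^sup>2 / (1 + d\<^sup>2)\<close>, and
  \<open>A\<close> is the factor that raises this to \<open>2 * B\<close>, a bound for any
  difference of values of \<open>f\<close>.\<close>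

lemma uniformly_continuous_saturated_modulus:
  fixes f :: "'a::euclidean_space \<Rightarrow> real"
  assumes f: "uniformly_continuous_on UNIV f" and B: "\<And>x. \<bar>f x\<bar> \<le> B" and e: "e > 0"
  obtains A where "A \<ge> 0" "\<And>x y. \<bar>f x - f y\<bar> \<le> e + A * saturated (x - y)"
proof -
  obtain d where d: "d > 0" "\<And>x y. dist x y < d \<Longrightarrow> dist (f x) (f y) < e"
    using f e unfolding uniformly_continuous_on_def by blast
  have B0: "B \<ge> 0" using B[of 0] by linarith
  define A where "A = 2 * B * ((1 + d\<^sup>2) / d\<^sup>2)"
  have A: "A \<ge> 0" using B0 by (simp add: A_def)
  show ?thesis
  proof (rule that[OF A])
    fix x y
    show "\<bar>f x - f y\<bar> \<le> e + A * saturated (x - y)"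
    proof (cases "dist x y < d")
      case True
      then have "\<bar>f x - f y\<bar> < e" using d(2) by (simp add: dist_real_def)
      moreover have "0 \<le> A * saturated (x - y)" using A saturated_nonneg by (rule mult_nonneg_nonneg)
      ultimately show ?thesis by linarith
    next
      case False
      then have "d\<^sup>2 / (1 + d\<^sup>2) \<le> saturated (x - y)" using d(1) by (intro saturated_ge) (auto simp: dist_norm)
      then have "A * (d\<^sup>2 / (1 + d\<^sup>2)) \<le> A * saturated (x - y)" using A by (rule mult_left_mono)
      moreover have "A * (d\<^sup>2 / (1 + d\<^sup>2)) = 2 * B"
        using d(1) add_pos_nonneg[of 1 "d\<^sup>2"] by (simp add: A_def)
      moreover have "\<bar>f x - f y\<bar> \<le> 2 * B" using B[of x] B[of y] by linarith
      ultimately show ?thesis using e by linarith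
    qed
  qed
qed

lemma uniformly_continuous_measurable:
  fixes f :: "'a::euclidean_space \<Rightarrow> real"
  shows "uniformly_continuous_on UNIV f \<Longrightarrow> f \<in> borel_measurable borel"
  by (intro borel_measurable_continuous_onI uniformly_continuous_imp_continuous)

lemma closed_indicator_approx:
  fixes A :: "'a::euclidean_space set"
  assumes "closed A"
  obtains f :: "nat \<Rightarrow> 'a \<Rightarrow> real" where "\<And>k. uniformly_continuous_on UNIV (f k)" "\<And>k x. 0 \<le> f k x" "\<And>k x. f k x \<le> 1"
    "\<And>x. (\<lambda>k. f k x) \<longlonglongrightarrow> indicator A x"
\<comment> \<open>The value of \<open>infdist\<close> for the empty set is 0 by convention, so the
  formula used below would give the constant 1 there.\<close>
proof (cases "A = {}")
  case True
  then show ?thesis by (intro that[of "\<lambda>_ _. 0"]) (auto intro: uniformly_continuous_on_const)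
next
  case False
  define f where "f k x = max 0 (1 - real k * infdist x A)" for k x
  show ?thesis
  proof (rule that[of f])
    fix k
    show "uniformly_continuous_on UNIV (f k)"
      unfolding uniformly_continuous_on_def
    proof (intro allI impI)
      fix e :: real assume "e > 0"
      show "\<exists>d>0. \<forall>x\<in>UNIV. \<forall>x'\<in>UNIV. dist x' x < d \<longrightarrow> dist (f k x') (f k x) < e"
      proof (intro exI[of _ "e / (real k + 1)"] conjI ballI impI)
        fix x x' :: 'a assume d: "dist x' x < e / (real k + 1)"
        have "\<bar>infdist x' A - infdist x A\<bar> \<le> dist x' x"
          using infdist_triangle[of x A x'] infdist_triangle[of x' A x] by (simp add: dist_commute abs_le_iff)
        then have "real k * \<bar>infdist x' A - infdist x A\<bar> \<le> real k * dist x' x" by (rule mult_left_mono) simp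
        moreover have "dist (f k x') (f k x) \<le> \<bar>real k * infdist x' A - real k * infdist x A\<bar>"
          by (auto simp: f_def dist_real_def max_def)
        moreover have "\<bar>real k * infdist x' A - real k * infdist x A\<bar> = real k * \<bar>infdist x' A - infdist x A\<bar>"
          by (simp add: abs_mult flip: right_diff_distrib)
        moreover have "real k * dist x' x \<le> (real k + 1) * dist x' x" by (intro mult_right_mono) auto
        moreover have "(real k + 1) * dist x' x < e" using d by (simp add: pos_less_divide_eq mult.commute)
        ultimately show "dist (f k x') (f k x) < e" by linarith
      qed (use \<open>e > 0\<close> in simp)
    qed
    show "0 \<le> f k x" "f k x \<le> 1" for x by (auto simp: f_def infdist_nonneg)
  next
    fix x
    show "(\<lambda>k. f k x) \<longlonglongrightarrow> indicator A x"
    proof (cases "x \<in> A")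
      case True
      then show ?thesis by (simp add: f_def)
    next
      case notin: False
      then have pos: "infdist x A > 0"
        using in_closed_iff_infdist_zero[OF assms False, of x] infdist_nonneg[of x A] by linarith
      obtain n where n: "1 / infdist x A < real n" using reals_Archimedean2 by blast
      have "f k x = 0" if "k \<ge> n" for k
      proof -
        have "1 / infdist x A \<le> real k" using n that by linarith
        then have "1 \<le> real k * infdist x A" using pos by (simp add: pos_divide_le_eq)
        then show ?thesis by (simp add: f_def)
      qed
      then have "\<forall>\<^sub>F k in sequentially. f k x = 0" using eventually_sequentially by blast
      then show ?thesis using notin by (simp add: tendsto_eventually)
    qed
  qed
qed

text \<open>Limits of expectations are available for uniformly continuous test functions. These
  approximate indicators of closed sets, and the closed sets form a generator stable under
  intersection.\<close>

lemma measure_eqI_uniformly_continuous: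
  fixes M N :: "'a::euclidean_space measure"
  assumes M: "prob_space M" "sets M = sets borel" and N: "prob_space N" "sets N = sets borel"
    and eq: "\<And>f B. uniformly_continuous_on UNIV f \<Longrightarrow> (\<And>x. \<bar>f x\<bar> \<le> B) \<Longrightarrow> (\<integral>x. f x \<partial>M) = (\<integral>x. (f x :: real) \<partial>N)"
  shows "M = N"
proof (rule measure_eqI_generator_eq[where E = "Collect closed" and \<Omega> = UNIV and A = "\<lambda>_. UNIV"])
  interpret M: prob_space M by fact
  interpret N: prob_space N by fact
  note M(2)[measurable_cong] N(2)[measurable_cong]
  show "Int_stable (Collect closed)" by (auto simp: Int_stable_def)
  show "sets M = sigma_sets UNIV (Collect closed)" "sets N = sigma_sets UNIV (Collect closed)"
    using M N by (simp_all add: borel_eq_closed)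
  fix A :: "'a set" assume A: "A \<in> Collect closed"
  then have [measurable]: "A \<in> sets borel" by simp
  obtain f :: "nat \<Rightarrow> 'a \<Rightarrow> real" where f: "\<And>k. uniformly_continuous_on UNIV (f k)" "\<And>k x. 0 \<le> f k x" "\<And>k x. f k x \<le> 1"
    "\<And>x. (\<lambda>k. f k x) \<longlonglongrightarrow> indicator A x" using A closed_indicator_approx by blast
  have fm [measurable]: "f k \<in> borel_measurable borel" for k using f(1) by (rule uniformly_continuous_measurable)
  have fabs: "\<bar>f k x\<bar> \<le> 1" for k x using f(2,3)[of k x] by simp
  have 1: "(\<lambda>k. \<integral>x. f k x \<partial>M) \<longlonglongrightarrow> (\<integral>x. indicator A x \<partial>M)"
    by (rule integral_dominated_convergence[where w = "\<lambda>_. 1"]) (auto simp: f(4) fabs)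
  have 2: "(\<lambda>k. \<integral>x. f k x \<partial>N) \<longlonglongrightarrow> (\<integral>x. indicator A x \<partial>N)"
    by (rule integral_dominated_convergence[where w = "\<lambda>_. 1"]) (auto simp: f(4) fabs)
  have "(\<integral>x. f k x \<partial>M) = (\<integral>x. f k x \<partial>N)" for k
    by (rule eq[of _ 1]) (simp_all add: f(1) fabs)
  with 1 2 have "(\<integral>x. indicator A x \<partial>M) = (\<integral>x. indicat_real A x \<partial>N)" using LIMSEQ_unique by simp
  moreover have "A \<inter> space M = A" "A \<inter> space N = A"
    using sets_eq_imp_space_eq[OF M(2)] sets_eq_imp_space_eq[OF N(2)] by auto
  ultimately show "emeasure M A = emeasure N A" by (simp add: M.emeasure_eq_measure N.emeasure_eq_measure)
qed (auto simp: prob_space.emeasure_space_1[OF M(1)] prob_space.finite_measure[OF M(1)] finite_measure.emeasure_finite)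

text \<open>The same approximation is made in every factor at once, which extends the product
  formula to indicators of closed sets.\<close>

lemma (in prob_space) indep_vars_uniformly_continuousI:
  fixes X :: "nat \<Rightarrow> 'a \<Rightarrow> 'b::euclidean_space"
  assumes X [measurable]: "\<And>i. i < n \<Longrightarrow> X i \<in> borel_measurable M"
    and prod: "\<And>f. (\<And>i. uniformly_continuous_on UNIV (f i)) \<Longrightarrow> (\<And>i x. 0 \<le> f i x) \<Longrightarrow> (\<And>i x. f i x \<le> (1::real)) \<Longrightarrow>
      (\<integral>\<omega>. (\<Prod>i<n. f i (X i \<omega>)) \<partial>M) = (\<Prod>i<n. \<integral>\<omega>. f i (X i \<omega>) \<partial>M)"
  shows "indep_vars (\<lambda>_. borel) X {..<n}"
proof (cases "n = 0")
  case True
  then show ?thesis by (auto simp: indep_vars_def indep_sets_def)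
next
  case False
  show ?thesis
  proof (subst indep_vars_finite[where E = "\<lambda>_. Collect closed"])
    show "{..<n} \<noteq> {}" "finite {..<n}" using False by auto
    show "sets borel = sigma_sets (space borel) (Collect closed)" by (simp add: borel_eq_closed)
    show "Int_stable (Collect closed)" by (auto simp: Int_stable_def)
    show "\<forall>A\<in>{..<n} \<rightarrow> Collect closed.
       prob (\<Inter>j\<in>{..<n}. X j -` A j \<inter> space M) = (\<Prod>j\<in>{..<n}. prob (X j -` A j \<inter> space M))"
    proof
      fix A :: "nat \<Rightarrow> 'b set" assume A: "A \<in> {..<n} \<rightarrow> Collect closed"
      \<comment> \<open>Indices from \<open>n\<close> on receive the empty set, since the hypothesis
        \<open>prod\<close> asks for a test function at every index.\<close>
      define A' where "A' i = (if i < n then A i else {})" for i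
      have cl: "closed (A' i)" for i using A by (auto simp: A'_def Pi_iff)
      then have [measurable]: "A' i \<in> sets borel" for i by simp
      have "\<exists>f. (\<forall>k. uniformly_continuous_on UNIV (f k)) \<and> (\<forall>k x. 0 \<le> f k x) \<and> (\<forall>k x. f k x \<le> (1::real)) \<and>
         (\<forall>x. (\<lambda>k. f k x) \<longlonglongrightarrow> indicator (A' i) x)" for i
        using closed_indicator_approx[OF cl[of i]] by metis
      then obtain f where f: "\<And>i k. uniformly_continuous_on UNIV (f i k)" "\<And>i k x. 0 \<le> f i k x" "\<And>i k x. f i k x \<le> (1::real)"
         "\<And>i x. (\<lambda>k. f i k x) \<longlonglongrightarrow> indicator (A' i) x" by metis
      have fm [measurable]: "f i k \<in> borel_measurable borel" for i k using f(1) by (rule uniformly_continuous_measurable)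
      have fabs: "\<bar>f i k x\<bar> \<le> 1" for i k x using f(2,3)[of i k x] by simp
      have 1: "(\<lambda>k. \<integral>\<omega>. (\<Prod>i<n. f i k (X i \<omega>)) \<partial>M) \<longlonglongrightarrow> (\<integral>\<omega>. (\<Prod>i<n. indicator (A' i) (X i \<omega>)) \<partial>M)"
      proof (rule integral_dominated_convergence[where w = "\<lambda>_. 1"])
        show "AE \<omega> in M. norm (\<Prod>i<n. f i k (X i \<omega>)) \<le> 1" for k
          by (intro AE_I2) (simp add: abs_prod fabs prod_le_1)
        show "AE \<omega> in M. (\<lambda>k. \<Prod>i<n. f i k (X i \<omega>)) \<longlonglongrightarrow> (\<Prod>i<n. indicator (A' i) (X i \<omega>))"
          by (intro AE_I2 tendsto_prod f)
      qed auto
      have 2: "(\<lambda>k. \<Prod>i<n. \<integral>\<omega>. f i k (X i \<omega>) \<partial>M) \<longlonglongrightarrow> (\<Prod>i<n. \<integral>\<omega>. indicator (A' i) (X i \<omega>) \<partial>M)"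
      proof (intro tendsto_prod integral_dominated_convergence[where w = "\<lambda>_. 1"])
        fix i assume "i \<in> {..<n}"
        then have [measurable]: "X i \<in> borel_measurable M" by simp
        show "(\<lambda>\<omega>. f i k (X i \<omega>)) \<in> borel_measurable M" for k by measurable
        show "(\<lambda>\<omega>. indicat_real (A' i) (X i \<omega>)) \<in> borel_measurable M" by measurable
      qed (auto simp: f(4) fabs)
      have "(\<integral>\<omega>. (\<Prod>i<n. f i k (X i \<omega>)) \<partial>M) = (\<Prod>i<n. \<integral>\<omega>. f i k (X i \<omega>) \<partial>M)" for k
        by (rule prod) (rule f)+
      with 1 2 have "(\<integral>\<omega>. (\<Prod>i<n. indicator (A' i) (X i \<omega>)) \<partial>M) = (\<Prod>i<n. \<integral>\<omega>. indicat_real (A' i) (X i \<omega>) \<partial>M)"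
        using LIMSEQ_unique by simp
      moreover have "(\<integral>\<omega>. (\<Prod>i<n. indicat_real (A' i) (X i \<omega>)) \<partial>M) = prob (\<Inter>j\<in>{..<n}. X j -` A j \<inter> space M)"
      proof -
        have "(\<integral>\<omega>. (\<Prod>i<n. indicat_real (A' i) (X i \<omega>)) \<partial>M) = (\<integral>\<omega>. indicat_real (\<Inter>j\<in>{..<n}. X j -` A j \<inter> space M) \<omega> \<partial>M)"
        proof (intro Bochner_Integration.integral_cong refl)
          fix \<omega> assume "\<omega> \<in> space M"
          then show "(\<Prod>i<n. indicat_real (A' i) (X i \<omega>)) = indicat_real (\<Inter>j\<in>{..<n}. X j -` A j \<inter> space M) \<omega>"
            using False by (cases "\<forall>j<n. X j \<omega> \<in> A j") (auto simp: indicator_def A'_def intro!: prod.neutral)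
        qed
        also have "\<dots> = prob ((\<Inter>j\<in>{..<n}. X j -` A j \<inter> space M) \<inter> space M)" by simp
        also have "(\<Inter>j\<in>{..<n}. X j -` A j \<inter> space M) \<inter> space M = (\<Inter>j\<in>{..<n}. X j -` A j \<inter> space M)" using False by auto
        finally show ?thesis .
      qed
      moreover have "(\<integral>\<omega>. indicat_real (A' i) (X i \<omega>) \<partial>M) = prob (X i -` A i \<inter> space M)" if "i < n" for i
      proof -
        have "(\<integral>\<omega>. indicat_real (A' i) (X i \<omega>) \<partial>M) = (\<integral>\<omega>. indicat_real (X i -` A i \<inter> space M) \<omega> \<partial>M)"
          using that by (intro Bochner_Integration.integral_cong refl) (auto simp: indicator_def A'_def)
        also have "\<dots> = prob (X i -` A i \<inter> space M \<inter> space M)" by simp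
        finally show ?thesis by (simp add: Int_assoc)
      qed
      ultimately show "prob (\<Inter>j\<in>{..<n}. X j -` A j \<inter> space M) = (\<Prod>j\<in>{..<n}. prob (X j -` A j \<inter> space M))" by simp
    qed
  qed auto
qed

lemma compact_support_uniformly_continuous:
  fixes f :: "'a::euclidean_space \<Rightarrow> real"
  assumes f: "continuous_on UNIV f" and supp: "\<And>x. norm x > R \<Longrightarrow> f x = 0"
  shows "uniformly_continuous_on UNIV f"
  unfolding uniformly_continuous_on_def
proof (intro allI impI)
  fix e :: real assume e: "e > 0"
  have "uniformly_continuous_on (cball 0 (R + 1)) f"
    using f by (intro compact_uniformly_continuous continuous_on_subset[OF f]) auto
  then obtain d where d: "d > 0" "\<And>x y. x \<in> cball 0 (R + 1) \<Longrightarrow> y \<in> cball 0 (R + 1) \<Longrightarrow> dist y x < d \<Longrightarrow> dist (f y) (f x) < e"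
    using e unfolding uniformly_continuous_on_def by blast
  have "dist (f y) (f x) < e" if "dist y x < min d 1" for x y
  proof (cases "norm x \<le> R \<or> norm y \<le> R")
    case True
    have "norm y \<le> norm x + dist y x" "norm x \<le> norm y + dist y x"
      using norm_triangle_ineq2[of y x] norm_triangle_ineq2[of x y] by (simp_all add: dist_norm norm_minus_commute)
    then show ?thesis using True that by (intro d(2)) auto
  next
    case False
    then show ?thesis using supp e by simp
  qed
  then show "\<exists>d>0. \<forall>x\<in>UNIV. \<forall>x'\<in>UNIV. dist x' x < d \<longrightarrow> dist (f x') (f x) < e"
    using d(1) by (intro exI[of _ "min d 1"]) auto
qed

text \<open>Multiplication by the cutoff \<open>ct R\<close> makes a bounded continuous function
  uniformly continuous. The loss is at most \<open>B\<close> times one minus the integral of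
  \<open>ct R\<close>; it is small under \<open>N\<close> for large \<open>R\<close>, and then under
  \<open>M n\<close> for large \<open>n\<close> because \<open>ct R\<close> is itself a test
  function. Tightness is thus read off from the assumed convergence.\<close>

lemma converges_in_distributionI_uniformly_continuous:
  fixes M :: "nat \<Rightarrow> 'a::euclidean_space measure"
  assumes M: "\<And>n. prob_space (M n)" "\<And>n. sets (M n) = sets borel" and N: "prob_space N" "sets N = sets borel"
    and lim: "\<And>f B. uniformly_continuous_on UNIV f \<Longrightarrow> (\<And>x. \<bar>f x\<bar> \<le> B) \<Longrightarrow> (\<lambda>n. \<integral>x. f x \<partial>M n) \<longlonglongrightarrow> (\<integral>x. (f x :: real) \<partial>N)"
  shows "converges_in_distribution M N"
  unfolding converges_in_distribution_def
proof (intro allI impI)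
  interpret M: prob_space "M n" for n by fact
  interpret N: prob_space N by fact
  note M(2)[measurable_cong] N(2)[measurable_cong]
  fix f :: "'a \<Rightarrow> real" assume "continuous_on UNIV f \<and> bounded (range f)"
  then have f: "continuous_on UNIV f" and "bounded (range f)" by auto
  then obtain B where B: "B > 0" "\<And>x. \<bar>f x\<bar> \<le> B" by (auto simp: bounded_pos)
  have [measurable]: "f \<in> borel_measurable borel" using f by (rule borel_measurable_continuous_onI)
  define ct where "ct R x = max 0 (min 1 (real R + 1 - norm x))" for R :: nat and x :: 'a
  have ct01: "0 \<le> ct R x" "ct R x \<le> 1" for R x by (auto simp: ct_def)
  have ctabs: "\<bar>ct R x\<bar> \<le> 1" for R x using ct01[of R x] by simp
  have ctc: "continuous_on UNIV (ct R)" for R unfolding ct_def by (intro continuous_intros)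
  have ct0: "ct R x = 0" if "norm x > real R + 1" for R x using that by (simp add: ct_def)
  have [measurable]: "ct R \<in> borel_measurable borel" for R using ctc by (rule borel_measurable_continuous_onI)
  have "(\<lambda>R. \<integral>x. ct R x \<partial>N) \<longlonglongrightarrow> (\<integral>x. (1::real) \<partial>N)"
  proof (rule integral_dominated_convergence[where w = "\<lambda>_. 1"])
    show "AE x in N. (\<lambda>R. ct R x) \<longlonglongrightarrow> 1"
    proof (rule AE_I2)
      fix x :: 'a
      obtain n where n: "norm x < real n" using reals_Archimedean2 by blast
      have "ct R x = 1" if "R \<ge> n" for R using n that by (simp add: ct_def)
      then have "\<forall>\<^sub>F R in sequentially. ct R x = 1" using eventually_sequentially by blast
      then show "(\<lambda>R. ct R x) \<longlonglongrightarrow> 1" by (rule tendsto_eventually)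
    qed
  qed (auto simp: ctabs)
  then have ctN: "(\<lambda>R. \<integral>x. ct R x \<partial>N) \<longlonglongrightarrow> 1" by (simp add: N.prob_space)
  show "(\<lambda>n. integral\<^sup>L (M n) f) \<longlonglongrightarrow> integral\<^sup>L N f"
  proof (rule LIMSEQ_I)
    fix e :: real assume e: "e > 0"
    \<comment> \<open>Three errors of at most \<open>e / 4\<close> each: the cutoff under
      \<open>M n\<close>, the cutoff under \<open>N\<close>, and the convergence for the cut
      function.\<close>
    define \<delta> where "\<delta> = e / (4 * B)"
    have \<delta>: "\<delta> > 0" "B * \<delta> = e / 4" using e B by (auto simp: \<delta>_def)
    have "\<forall>\<^sub>F R in sequentially. (\<integral>x. ct R x \<partial>N) > 1 - \<delta>" using \<delta> by (intro order_tendstoD(1)[OF ctN]) auto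
    then obtain R where R: "(\<integral>x. ct R x \<partial>N) > 1 - \<delta>" by (auto simp: eventually_sequentially)
    have 1: "(\<lambda>n. \<integral>x. ct R x \<partial>M n) \<longlonglongrightarrow> (\<integral>x. ct R x \<partial>N)"
      by (rule lim[of _ 1]) (simp_all add: compact_support_uniformly_continuous[OF ctc ct0] ctabs)
    have fb: "\<bar>f x * ct R x\<bar> \<le> B" for x
      using mult_mono[OF B(2)[of x] ct01(2)[of R x]] B(1) ct01[of R x] by (simp add: abs_mult)
    have 2: "(\<lambda>n. \<integral>x. f x * ct R x \<partial>M n) \<longlonglongrightarrow> (\<integral>x. f x * ct R x \<partial>N)"
      by (rule lim[of _ B, OF _ fb], rule compact_support_uniformly_continuous[of _ "real R + 1"])
         (use ct0 in \<open>auto intro!: continuous_intros f ctc\<close>)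
    have cut: "\<bar>(\<integral>x. f x \<partial>Q) - (\<integral>x. f x * ct R x \<partial>Q)\<bar> \<le> B * (1 - (\<integral>x. ct R x \<partial>Q))"
      if Q: "prob_space Q" and [measurable_cong]: "sets Q = sets borel" for Q
    proof -
      interpret Q: prob_space Q by fact
      have i1: "integrable Q f" by (rule Q.integrable_const_bound[where B = B]) (use B in auto)
      have i2: "integrable Q (\<lambda>x. f x * ct R x)" by (rule Q.integrable_const_bound[where B = B]) (use fb in auto)
      have i3: "integrable Q (ct R)" by (rule Q.integrable_const_bound[where B = 1]) (use ct01 in auto)
      have "(\<integral>x. f x \<partial>Q) - (\<integral>x. f x * ct R x \<partial>Q) = (\<integral>x. f x - f x * ct R x \<partial>Q)" using i1 i2 by simp
      also have "\<bar>\<dots>\<bar> \<le> (\<integral>x. B * (1 - ct R x) \<partial>Q)"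
      proof (rule order_trans[OF integral_abs_bound integral_mono])
        fix x
        have "\<bar>f x - f x * ct R x\<bar> = \<bar>f x\<bar> * (1 - ct R x)"
          using ct01[of R x] abs_mult[of "f x" "1 - ct R x"] by (simp add: right_diff_distrib)
        also have "\<dots> \<le> B * (1 - ct R x)" using B ct01 by (intro mult_right_mono) auto
        finally show "\<bar>f x - f x * ct R x\<bar> \<le> B * (1 - ct R x)" .
      qed (use i1 i2 i3 in auto)
      also have "\<dots> = B * (1 - (\<integral>x. ct R x \<partial>Q))" using i3 Q.prob_space by simp
      finally show ?thesis .
    qed
    have "\<forall>\<^sub>F n in sequentially. (\<integral>x. ct R x \<partial>M n) > 1 - \<delta>" using order_tendstoD(1)[OF 1 R] .
    moreover have "\<forall>\<^sub>F n in sequentially. \<bar>(\<integral>x. f x * ct R x \<partial>M n) - (\<integral>x. f x * ct R x \<partial>N)\<bar> < e / 4"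
      using tendstoD[OF 2, of "e/4"] e by (simp add: dist_real_def)
    ultimately have "\<forall>\<^sub>F n in sequentially. norm (integral\<^sup>L (M n) f - integral\<^sup>L N f) < e"
    proof eventually_elim
      case (elim n)
      have "B * (1 - (\<integral>x. ct R x \<partial>M n)) \<le> B * \<delta>" using elim(1) B by (intro mult_left_mono) auto
      moreover have "B * (1 - (\<integral>x. ct R x \<partial>N)) \<le> B * \<delta>" using R B by (intro mult_left_mono) auto
      ultimately show ?case using cut[OF M(1,2), of n] cut[OF N] elim(2) \<delta>(2) e
        unfolding real_norm_def by linarith
    qed
    then show "\<exists>no. \<forall>n\<ge>no. norm (integral\<^sup>L (M n) f - integral\<^sup>L N f) < e" by (simp add: eventually_sequentially)
  qed
qed

section \<open>Null arrays and the limit process\<close>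

text \<open>The final statement prescribes a type of sample points other than \<open>real\<close>.
  Pushing the probability space forward along an injection moves it there, and the inverse of
  \<open>e\<close> recovers all variables on the image.\<close>

lemma skorokhod_coupling_embedded:
  fixes \<xi> :: "nat \<Rightarrow> nat \<Rightarrow> 's \<Rightarrow> 'a::euclidean_space" and e :: "real \<Rightarrow> 'b"
  assumes e: "inj e"
    and prob: "\<And>n. prob_space (S n)"
    and meas [measurable]: "\<And>n j. \<xi> n j \<in> borel_measurable (S n)"
    and tight: "\<forall>j. \<forall>\<eta>>0. \<exists>R. \<forall>\<^sub>F n in sequentially.
      measure (S n) {x \<in> space (S n). norm (\<xi> n j x) > R} \<le> \<eta>"
  shows "\<exists>(r :: nat \<Rightarrow> nat) (P :: 'b measure) X Y. strict_mono r \<and> prob_space P \<and>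
    (\<forall>n j. X n j \<in> borel_measurable P) \<and> (\<forall>j. Y j \<in> borel_measurable P) \<and>
    (\<forall>n. distr P (PiM UNIV (\<lambda>_. borel)) (\<lambda>\<omega> j. X n j \<omega>) =
         distr (S (r n)) (PiM UNIV (\<lambda>_. borel)) (\<lambda>\<omega> j. \<xi> (r n) j \<omega>)) \<and>
    (\<forall>j. AE \<omega> in P. (\<lambda>n. X n j \<omega>) \<longlonglongrightarrow> Y j \<omega>)"
proof -
  obtain r and P :: "real measure" and X Y where r: "strict_mono r" and P: "prob_space P"
    and X: "\<forall>n j. X n j \<in> borel_measurable P" and Y: "\<forall>j. Y j \<in> borel_measurable P"
    and law: "\<forall>n. distr P (PiM UNIV (\<lambda>_. borel)) (\<lambda>\<omega> j. X n j \<omega>) =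
         distr (S (r n)) (PiM UNIV (\<lambda>_. borel)) (\<lambda>\<omega> j. \<xi> (r n) j \<omega>)"
    and conv: "\<forall>j. AE \<omega> in P. (\<lambda>n. X n j \<omega>) \<longlonglongrightarrow> Y j \<omega>"
    using skorokhod_coupling[where S = S and \<xi> = \<xi>, OF prob meas tight] by - (elim exE conjE, rule that)
  interpret P: prob_space P by fact
  define Q where "Q = embed_measure P e"
  have inv: "inv e (e x) = x" for x using e by simp
  have em: "e \<in> measurable P Q" unfolding Q_def using e by (rule measurable_embed_measure2)
  have Q: "Q = distr P Q e" unfolding Q_def using e by (rule embed_measure_eq_distr)
  have Xm [measurable]: "(\<lambda>\<omega>. X n j (inv e \<omega>)) \<in> borel_measurable Q" for n j
    unfolding Q_def using X by (intro measurable_embed_measure1) (simp add: inv)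
  have Ym [measurable]: "(\<lambda>\<omega>. Y j (inv e \<omega>)) \<in> borel_measurable Q" for j
    unfolding Q_def using Y by (intro measurable_embed_measure1) (simp add: inv)
  show ?thesis
  proof (intro exI conjI allI)
    show "strict_mono r" by fact
    show "prob_space Q" by (subst Q) (rule P.prob_space_distr[OF em])
    show "(\<lambda>\<omega>. X n j (inv e \<omega>)) \<in> borel_measurable Q" for n j by fact
    show "(\<lambda>\<omega>. Y j (inv e \<omega>)) \<in> borel_measurable Q" for j by fact
    show "distr Q (PiM UNIV (\<lambda>_. borel)) (\<lambda>\<omega> j. X n j (inv e \<omega>)) =
         distr (S (r n)) (PiM UNIV (\<lambda>_. borel)) (\<lambda>\<omega> j. \<xi> (r n) j \<omega>)" for n
    proof -
      have "(\<lambda>\<omega> j. X n j (inv e \<omega>)) \<in> measurable Q (PiM UNIV (\<lambda>_. borel))"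
        by (rule measurable_PiM_single') auto
      then have "distr (distr P Q e) (PiM UNIV (\<lambda>_. borel)) (\<lambda>\<omega> j. X n j (inv e \<omega>)) = distr P (PiM UNIV (\<lambda>_. borel)) (\<lambda>\<omega> j. X n j \<omega>)"
        using em by (subst distr_distr) (auto simp: comp_def inv)
      then show ?thesis using law Q by simp
    qed
    show "AE \<omega> in Q. (\<lambda>n. X n j (inv e \<omega>)) \<longlonglongrightarrow> Y j (inv e \<omega>)" for j
      unfolding Q_def using conv e by (subst AE_embed_measure) (simp_all add: inv)
  qed
qed

section \<open>Null arrays: moment bounds, tightness and the time grid\<close>

text \<open>The family restricted to one null sequence: \<open>\<nu> n\<close> is the step law at
  time \<open>h n\<close>, and \<open>C\<close> bounds both terms of (1). The assumption
  \<open>tail\<close> is (2) in eventual form, with the factor \<open>1 / h n\<close>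
  cleared.\<close>

locale null_array =
  fixes \<nu> :: "nat \<Rightarrow> 'a::ordered_euclidean_space measure" and h :: "nat \<Rightarrow> real" and C :: real
  assumes prob: "\<And>n. prob_space (\<nu> n)" and sets_\<nu> [measurable_cong]: "\<And>n. sets (\<nu> n) = sets borel"
    and h_pos: "\<And>n. h n > 0" and h_null: "h \<longlonglongrightarrow> 0"
    and second_moment: "\<And>n. (\<integral>y. min 1 ((norm y)\<^sup>2) \<partial>\<nu> n) \<le> C * h n"
    and drift: "\<And>n. norm (LINT y:{y. norm y \<le> 1}|\<nu> n. y) \<le> C * h n"
    and tail: "\<And>\<epsilon>. \<epsilon> > 0 \<Longrightarrow> \<exists>M. \<forall>\<^sub>F n in sequentially. measure (\<nu> n) {y. norm y > M} \<le> \<epsilon> * h n"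
begin

lemma prob_law: "prob_space (convolution_power (\<nu> n) k)"
  using prob sets_\<nu> by (rule prob_space_convolution_power)

lemma space_\<nu>: "space (\<nu> n) = UNIV"
  using sets_eq_imp_space_eq[OF sets_\<nu>] by simp

lemma C_nonneg: "0 \<le> C"
proof -
  have "0 \<le> (\<integral>y. min 1 ((norm y)\<^sup>2) \<partial>\<nu> 0)" by (intro Bochner_Integration.integral_nonneg) auto
  with second_moment[of 0] h_pos[of 0] show ?thesis
    by (metis order_trans zero_le_mult_iff less_le_not_le)
qed

lemma measure_outside_unit: "measure (\<nu> n) {y. norm y > 1} \<le> C * h n"
proof -
  interpret prob_space "\<nu> n" by (rule prob)
  have "measure (\<nu> n) {y. norm y > 1} = (\<integral>y. indicator {y. norm y > 1} y \<partial>\<nu> n)"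
    by (simp add: space_\<nu>)
  also have "\<dots> \<le> (\<integral>y. min 1 ((norm y)\<^sup>2) \<partial>\<nu> n)"
  proof (rule integral_mono)
    show "integrable (\<nu> n) (indicat_real {y. norm y > 1})"
      by (rule integrable_const_bound[where B = 1]) (auto simp: indicator_def)
    show "integrable (\<nu> n) (\<lambda>y. min 1 ((norm y)\<^sup>2))"
      by (rule integrable_const_bound[where B = 1]) auto
    show "indicat_real {y. norm y > 1} y \<le> min 1 ((norm y)\<^sup>2)" for y
      using one_le_power[of "norm y" 2] by (simp add: indicator_def)
  qed
  finally show ?thesis using second_moment[of n] by simp
qed

text \<open>With \<open>R = M = 1\<close> the coefficient is \<open>1 + 5 + 1 + 5 = 12\<close>; the
  mass outside the unit ball, itself at most \<open>C * h n\<close>, makes it 13.\<close>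

lemma saturated_law_bound:
  "(\<integral>x. saturated x \<partial>convolution_power (\<nu> n) k) \<le> 13 * C * (real k * h n)"
proof -
  have "(\<integral>x. saturated x \<partial>convolution_power (\<nu> n) k) \<le> real k * (C * h n * 12 + measure (\<nu> n) {y. norm y > 1})"
    using saturated_convolution_power_bound[OF prob sets_\<nu> second_moment drift, of 1 1 n k] by simp
  also have "\<dots> \<le> real k * (C * h n * 12 + C * h n)" using measure_outside_unit by (intro mult_left_mono) auto
  finally show ?thesis by (simp add: algebra_simps)
qed

text \<open>The order of choice matters: (2) fixes \<open>M\<close>, and only then is
  \<open>R\<close> taken so large that the remaining coefficient falls below
  \<open>\<epsilon>\<close>. Linear growth in the number of steps makes the bound uniform over all
  \<open>k\<close> with \<open>real k * h n \<le> T\<close>.\<close>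

lemma laws_tight:
  assumes \<eta>: "\<eta> > 0"
  shows "\<exists>R. \<forall>\<^sub>F n in sequentially. \<forall>k. real k * h n \<le> T \<longrightarrow> measure (convolution_power (\<nu> n) k) {x. norm x > R} \<le> \<eta>"
proof -
  define T' where "T' = max T 1"
  \<comment> \<open>A factor 2 arises because \<open>saturated\<close> is at least
    \<open>1/2\<close> on vectors of norm at least 1, another from the two contributions
    \<open>\<epsilon> * h n\<close> of each step; \<open>T'\<close> is positive even if
    \<open>T\<close> is not.\<close>
  define \<epsilon> where "\<epsilon> = \<eta> / (4 * T')"
  have T': "T' > 0" "T \<le> T'" by (auto simp: T'_def)
  have \<epsilon>: "\<epsilon> > 0" "4 * (T' * \<epsilon>) = \<eta>" using \<eta> T' by (auto simp: \<epsilon>_def)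
  obtain M0 where M0: "\<forall>\<^sub>F n in sequentially. measure (\<nu> n) {y. norm y > M0} \<le> \<epsilon> * h n" using tail[OF \<epsilon>(1)] by blast
  define M where "M = max M0 1"
  have "((\<lambda>R. C * (1 / R + 5 / R\<^sup>2 + M / R + 5 * M\<^sup>2 / R\<^sup>2)) \<longlongrightarrow> C * (0 + 0 + 0 + 0)) at_top"
    by (intro tendsto_intros tendsto_divide_0[OF tendsto_const] filterlim_at_top_imp_at_infinity filterlim_pow_at_top filterlim_ident) auto
  then have "\<forall>\<^sub>F R in at_top. C * (1 / R + 5 / R\<^sup>2 + M / R + 5 * M\<^sup>2 / R\<^sup>2) < \<epsilon>"
    using \<epsilon> by (intro order_tendstoD(2)) auto
  then have "\<forall>\<^sub>F R in at_top. C * (1 / R + 5 / R\<^sup>2 + M / R + 5 * M\<^sup>2 / R\<^sup>2) < \<epsilon> \<and> R > 0"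
    using eventually_gt_at_top[of 0] by (rule eventually_conj)
  then obtain R where R: "C * (1 / R + 5 / R\<^sup>2 + M / R + 5 * M\<^sup>2 / R\<^sup>2) < \<epsilon>" "R > 0"
    using eventually_happens'[OF trivial_limit_at_top_linorder] by blast
  show ?thesis
  proof (intro exI[of _ R] eventually_mono[OF M0] allI impI)
    fix n k assume n: "measure (\<nu> n) {y. norm y > M0} \<le> \<epsilon> * h n" and k: "real k * h n \<le> T"
    interpret \<nu>: prob_space "\<nu> n" by (rule prob)
    interpret L: prob_space "convolution_power (\<nu> n) k" by (rule prob_law)
    have int: "integrable (convolution_power (\<nu> n) k) (\<lambda>x. saturated (x /\<^sub>R R))"
      by (rule L.integrable_const_bound[where B = 1]) (auto simp: saturated_nonneg saturated_le_1)
    have "measure (\<nu> n) {y. norm y > M} \<le> measure (\<nu> n) {y. norm y > M0}"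
      by (rule \<nu>.finite_measure_mono) (auto simp: M_def)
    then have mM: "measure (\<nu> n) {y. norm y > M} \<le> \<epsilon> * h n" using n by simp
    have "measure (convolution_power (\<nu> n) k) {x. norm x > R} = (\<integral>x. indicator {x. norm x > R} x \<partial>convolution_power (\<nu> n) k)"
      by simp
    also have "\<dots> \<le> (\<integral>x. 2 * saturated (x /\<^sub>R R) \<partial>convolution_power (\<nu> n) k)"
    proof (rule integral_mono)
      show "integrable (convolution_power (\<nu> n) k) (indicat_real {x. norm x > R})"
        by (rule L.integrable_const_bound[where B = 1]) (auto simp: indicator_def)
      show "indicat_real {x. norm x > R} x \<le> 2 * saturated (x /\<^sub>R R)" for x
      proof (cases "norm x > R")
        case True
        then have "1 \<le> norm (x /\<^sub>R R)" using R(2) by (simp add: field_simps)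
        from saturated_ge[OF _ this] show ?thesis using True by simp
      qed (simp add: saturated_nonneg)
    qed (use int in simp)
    also have "\<dots> = 2 * (\<integral>x. saturated (x /\<^sub>R R) \<partial>convolution_power (\<nu> n) k)" by simp
    also have "\<dots> \<le> 2 * (real k * (C * h n * (1 / R + 5 / R\<^sup>2 + M / R + 5 * M\<^sup>2 / R\<^sup>2) + measure (\<nu> n) {y. norm y > M}))"
      by (intro mult_left_mono saturated_convolution_power_bound[OF prob sets_\<nu> second_moment drift R(2)]) (auto simp: M_def)
    also have "\<dots> \<le> 2 * (real k * (\<epsilon> * h n + \<epsilon> * h n))"
      using mM mult_right_mono[OF less_imp_le[OF R(1)] less_imp_le[OF h_pos[of n]]]
      by (intro mult_left_mono add_mono) (auto simp: mult_ac)
    also have "\<dots> = 4 * (real k * h n * \<epsilon>)" by (simp add: algebra_simps)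
    also have "\<dots> \<le> 4 * (T' * \<epsilon>)" using k T' \<epsilon> by (intro mult_left_mono mult_right_mono) auto
    finally show "measure (convolution_power (\<nu> n) k) {x. norm x > R} \<le> \<eta>" using \<epsilon>(2) by simp
  qed
qed

text \<open>Both laws are realised by one walk, observed after \<open>j\<close> and after
  \<open>k\<close> steps. The difference is then governed by an increment of
  \<open>\<bar>k - j\<bar>\<close> steps, however large \<open>j\<close> and \<open>k\<close>
  are.\<close>

lemma law_integral_diff:
  fixes f :: "'a \<Rightarrow> real"
  assumes [measurable]: "f \<in> borel_measurable borel" and B: "\<And>x. \<bar>f x\<bar> \<le> B"
    and A: "A \<ge> 0" "\<And>x y. \<bar>f x - f y\<bar> \<le> e + A * saturated (x - y)"
  shows "\<bar>(\<integral>x. f x \<partial>convolution_power (\<nu> n) k) - (\<integral>x. f x \<partial>convolution_power (\<nu> n) j)\<bar>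
    \<le> e + A * (13 * C * (\<bar>real k - real j\<bar> * h n))"
proof -
  interpret P: prob_space "PiM UNIV (\<lambda>_::nat. \<nu> n)" by (intro prob_space_PiM prob)
  have *: "\<bar>(\<integral>x. f x \<partial>convolution_power (\<nu> n) k) - (\<integral>x. f x \<partial>convolution_power (\<nu> n) j)\<bar>
    \<le> e + A * (13 * C * (\<bar>real k - real j\<bar> * h n))" if "j \<le> k" for j k
  proof -
    let ?W = "\<lambda>k \<omega>. \<Sum>i<k. \<omega> i :: 'a"
    have law: "(\<integral>x. f x \<partial>convolution_power (\<nu> n) k) = (\<integral>\<omega>. f (?W k \<omega>) \<partial>PiM UNIV (\<lambda>_::nat. \<nu> n))" for k
      using random_walk_distr[OF prob sets_\<nu>, of n 0 k]
      by (subst random_walk_distr[OF prob sets_\<nu>, of n 0 k, symmetric], subst integral_distr) (auto simp: atLeast0LessThan)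
    have int: "integrable (PiM UNIV (\<lambda>_::nat. \<nu> n)) (\<lambda>\<omega>. f (?W k \<omega>))" for k
      by (rule P.integrable_const_bound[where B = B]) (use B in auto)
    have diff: "?W k \<omega> - ?W j \<omega> = (\<Sum>i\<in>{j..<j + (k - j)}. \<omega> i)" for \<omega>
      using sum_diff[of "{..<k}" "{..<j}" \<omega>] that by (simp add: lessThan_minus_lessThan)
    have ints: "integrable (PiM UNIV (\<lambda>_::nat. \<nu> n)) (\<lambda>\<omega>. saturated (?W k \<omega> - ?W j \<omega>))"
      by (rule P.integrable_const_bound[where B = 1]) (auto simp: saturated_nonneg saturated_le_1)
    have "\<bar>(\<integral>x. f x \<partial>convolution_power (\<nu> n) k) - (\<integral>x. f x \<partial>convolution_power (\<nu> n) j)\<bar>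
        = \<bar>\<integral>\<omega>. f (?W k \<omega>) - f (?W j \<omega>) \<partial>PiM UNIV (\<lambda>_::nat. \<nu> n)\<bar>"
      unfolding law using int by simp
    also have "\<dots> \<le> (\<integral>\<omega>. e + A * saturated (?W k \<omega> - ?W j \<omega>) \<partial>PiM UNIV (\<lambda>_::nat. \<nu> n))"
      using int ints A by (intro order_trans[OF integral_abs_bound integral_mono]) auto
    also have "\<dots> = e + A * (\<integral>\<omega>. saturated (?W k \<omega> - ?W j \<omega>) \<partial>PiM UNIV (\<lambda>_::nat. \<nu> n))"
      using ints P.prob_space by simp
    also have "(\<integral>\<omega>. saturated (?W k \<omega> - ?W j \<omega>) \<partial>PiM UNIV (\<lambda>_::nat. \<nu> n)) = (\<integral>x. saturated x \<partial>convolution_power (\<nu> n) (k - j))"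
      unfolding diff by (subst random_walk_distr[OF prob sets_\<nu>, of n j "k - j", symmetric], subst integral_distr) auto
    also have "\<dots> \<le> 13 * C * (real (k - j) * h n)" by (rule saturated_law_bound)
    finally show ?thesis using A that by (simp add: of_nat_diff mult_left_mono)
  qed
  show ?thesis
  proof (cases "j \<le> k")
    case True then show ?thesis by (rule *)
  next
    case False
    then show ?thesis using *[of k j] by (simp add: abs_minus_commute)
  qed
qed

definition steps :: "nat \<Rightarrow> real \<Rightarrow> nat" where
  "steps n t = nat \<lfloor>t / h n\<rfloor>"

lemma steps_mono: "s \<le> t \<Longrightarrow> steps n s \<le> steps n t"
  unfolding steps_def using h_pos[of n] by (intro nat_mono floor_mono divide_right_mono) auto

lemma
  assumes "0 \<le> t"
  shows steps_le: "real (steps n t) * h n \<le> t" and steps_gt: "t - h n < real (steps n t) * h n"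
proof -
  have "real (steps n t) = of_int \<lfloor>t / h n\<rfloor>" unfolding steps_def using assms h_pos[of n] by simp
  then have "real (steps n t) \<le> t / h n" "t / h n - 1 < real (steps n t)" by linarith+
  then have "real (steps n t) * h n \<le> t / h n * h n" "(t / h n - 1) * h n < real (steps n t) * h n"
    using h_pos[of n] by (intro mult_right_mono mult_strict_right_mono; simp)+
  then show "real (steps n t) * h n \<le> t" "t - h n < real (steps n t) * h n"
    using h_pos[of n] by (simp_all add: left_diff_distrib)
qed

text \<open>Rounding to the grid is not additive, but the discrepancy amounts to at most two steps.
  It vanishes with \<open>h\<close>, which yields exactly stationary increments in the
  limit.\<close>

lemma steps_diff:
  assumes "0 \<le> s" "s \<le> t"
  shows "\<bar>real (steps n t - steps n s) - real (steps n (t - s))\<bar> * h n \<le> 2 * h n"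
proof -
  have "real (steps n t - steps n s) = real (steps n t) - real (steps n s)"
    using steps_mono[OF assms(2)] by (simp add: of_nat_diff)
  then have eq: "\<bar>real (steps n t - steps n s) - real (steps n (t - s))\<bar> * h n
      = \<bar>real (steps n t) * h n - real (steps n s) * h n - real (steps n (t - s)) * h n\<bar>"
    using h_pos[of n] abs_mult[of "real (steps n t) - real (steps n s) - real (steps n (t - s))" "h n"]
    by (simp add: left_diff_distrib)
  show ?thesis unfolding eq
    using steps_le[of t n] steps_gt[of t n] steps_le[of s n] steps_gt[of s n] steps_le[of "t - s" n] steps_gt[of "t - s" n] assms h_pos[of n]
    by (simp add: abs_le_iff)
qed

end

text \<open>The walks, read at an enumeration of the dyadic times, are the countably many tight
  sequences to be coupled. Of their joint law, the marginals and the product formula for increments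
  are recorded; these are what the limit inherits.\<close>

lemma (in null_array) coupled_walks_exist:
  fixes e :: "real \<Rightarrow> 'b"
  assumes e: "inj e"
  shows "\<exists>r (P :: 'b measure) X Z. strict_mono r \<and> prob_space P \<and> (\<forall>n t. X n t \<in> borel_measurable P) \<and>
    (\<forall>t. Z t \<in> borel_measurable P) \<and>
    (\<forall>t\<in>dyadic_times. AE \<omega> in P. (\<lambda>n. X n t \<omega>) \<longlonglongrightarrow> Z t \<omega>) \<and>
    (\<forall>n. \<forall>t\<in>dyadic_times. distr P borel (X n t) = convolution_power (\<nu> (r n)) (steps (r n) t)) \<and>
    (\<forall>n m s f B. (\<forall>i. s i \<in> dyadic_times) \<longrightarrow> (\<forall>i<m. s i \<le> s (Suc i)) \<longrightarrow>
      (\<forall>i. f i \<in> borel_measurable borel) \<longrightarrow> (\<forall>i x. \<bar>f i x\<bar> \<le> B i) \<longrightarrow>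
      (\<integral>\<omega>. (\<Prod>i<m. f i (X n (s (Suc i)) \<omega> - X n (s i) \<omega>)) \<partial>P) =
      (\<Prod>i<m. \<integral>x. (f i x :: real) \<partial>convolution_power (\<nu> (r n)) (steps (r n) (s (Suc i)) - steps (r n) (s i))))"
proof -
  define S where "S n = PiM UNIV (\<lambda>_::nat. \<nu> n)" for n
  define tm where "tm = from_nat_into dyadic_times"
  define idx where "idx = to_nat_on dyadic_times"
  have ne: "dyadic_times \<noteq> {}" using dyadic_above_in by blast
  have tm: "tm j \<in> dyadic_times" for j unfolding tm_def by (rule from_nat_into[OF ne])
  have tm_idx: "tm (idx t) = t" if "t \<in> dyadic_times" for t
    unfolding tm_def idx_def using that countable_dyadic_times by simp
  define \<xi> where "\<xi> n j \<omega> = (\<Sum>l<steps n (tm j). \<omega> l)" for n j and \<omega> :: "nat \<Rightarrow> 'a"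
  have Sprob: "prob_space (S n)" for n unfolding S_def by (intro prob_space_PiM prob)
  have \<xi>m [measurable]: "\<xi> n j \<in> borel_measurable (S n)" for n j
    unfolding \<xi>_def S_def by measurable
  have \<xi>_distr: "distr (S n) borel (\<xi> n j) = convolution_power (\<nu> n) (steps n (tm j))" for n j
    using random_walk_distr[OF prob sets_\<nu>, of n 0 "steps n (tm j)"]
    by (simp add: S_def \<xi>_def[abs_def] atLeast0LessThan)
  have tight: "\<forall>j. \<forall>\<eta>>0. \<exists>R. \<forall>\<^sub>F n in sequentially. measure (S n) {x \<in> space (S n). norm (\<xi> n j x) > R} \<le> \<eta>"
  proof (intro allI impI)
    fix j and \<eta> :: real assume "\<eta> > 0"
    then obtain R where R: "\<forall>\<^sub>F n in sequentially. \<forall>k. real k * h n \<le> tm j \<longrightarrow> measure (convolution_power (\<nu> n) k) {x. norm x > R} \<le> \<eta>"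
      using laws_tight by blast
    show "\<exists>R. \<forall>\<^sub>F n in sequentially. measure (S n) {x \<in> space (S n). norm (\<xi> n j x) > R} \<le> \<eta>"
    proof (intro exI[of _ R] eventually_mono[OF R])
      fix n assume "\<forall>k. real k * h n \<le> tm j \<longrightarrow> measure (convolution_power (\<nu> n) k) {x. norm x > R} \<le> \<eta>"
      then have "measure (distr (S n) borel (\<xi> n j)) {x. norm x > R} \<le> \<eta>"
        unfolding \<xi>_distr using steps_le[OF dyadic_times_nonneg[OF tm]] by blast
      then show "measure (S n) {x \<in> space (S n). norm (\<xi> n j x) > R} \<le> \<eta>"
        by (subst (asm) measure_distr) (auto simp: vimage_def Int_def conj_commute)
    qed
  qed
  obtain r and P :: "'b measure" and X Z where r: "strict_mono r" and P: "prob_space P"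
    and X: "\<forall>n j. X n j \<in> borel_measurable P" and Z: "\<forall>j. Z j \<in> borel_measurable P"
    and law: "\<forall>n. distr P (PiM UNIV (\<lambda>_. borel)) (\<lambda>\<omega> j. X n j \<omega>) =
         distr (S (r n)) (PiM UNIV (\<lambda>_. borel)) (\<lambda>\<omega> j. \<xi> (r n) j \<omega>)"
    and conv: "\<forall>j. AE \<omega> in P. (\<lambda>n. X n j \<omega>) \<longlonglongrightarrow> Z j \<omega>"
    using skorokhod_coupling_embedded[where S = S and \<xi> = \<xi>, OF e Sprob \<xi>m tight] by - (elim exE conjE, rule that)
  have Xm [measurable]: "X n j \<in> borel_measurable P" for n j using X by simp
  have XP [measurable]: "(\<lambda>\<omega> j. X n j \<omega>) \<in> measurable P (PiM UNIV (\<lambda>_. borel))" for n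
    by (rule measurable_PiM_single') auto
  have \<xi>P [measurable]: "(\<lambda>\<omega> j. \<xi> n j \<omega>) \<in> measurable (S n) (PiM UNIV (\<lambda>_. borel))" for n
    by (rule measurable_PiM_single') auto
  \<comment> \<open>Equality in law of entire sequences transfers the expectation of any measurable
    functional, in particular of products of increments.\<close>
  have transfer: "(\<integral>\<omega>. \<Phi> (\<lambda>j. X n j \<omega>) \<partial>P) = (\<integral>\<omega>. (\<Phi> (\<lambda>j. \<xi> (r n) j \<omega>) :: real) \<partial>S (r n))"
    if "\<Phi> \<in> borel_measurable (PiM UNIV (\<lambda>_. borel))" for \<Phi> n
  proof -
    have "(\<integral>\<omega>. \<Phi> (\<lambda>j. X n j \<omega>) \<partial>P) = (\<integral>x. \<Phi> x \<partial>distr P (PiM UNIV (\<lambda>_. borel)) (\<lambda>\<omega> j. X n j \<omega>))"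
      by (subst integral_distr[OF XP that]) simp
    also have "\<dots> = (\<integral>\<omega>. \<Phi> (\<lambda>j. \<xi> (r n) j \<omega>) \<partial>S (r n))"
      unfolding law[rule_format] by (subst integral_distr[OF \<xi>P that]) simp
    finally show ?thesis .
  qed
  have marginal: "distr P borel (X n j) = distr (S (r n)) borel (\<xi> (r n) j)" for n j
  proof -
    have "distr P borel (X n j) = distr (distr P (PiM UNIV (\<lambda>_. borel)) (\<lambda>\<omega> j. X n j \<omega>)) borel (\<lambda>x. x j)"
      by (subst distr_distr) (auto simp: comp_def)
    also have "\<dots> = distr (S (r n)) borel (\<xi> (r n) j)"
      unfolding law[rule_format] by (subst distr_distr) (auto simp: comp_def)
    finally show ?thesis .
  qed
  show ?thesis
  proof (intro exI conjI allI impI ballI)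
    show "strict_mono r" "prob_space P" by fact+
    \<comment> \<open>For \<open>t\<close> outside \<open>dyadic_times\<close> the index is
      arbitrary; measurability survives, and the statement claims nothing else about such
      \<open>t\<close>.\<close>
    show "X n (idx t) \<in> borel_measurable P" for n t by simp
    show "Z (idx t) \<in> borel_measurable P" for t using Z by simp
    show "AE \<omega> in P. (\<lambda>n. X n (idx t) \<omega>) \<longlonglongrightarrow> Z (idx t) \<omega>" for t using conv by simp
    show "distr P borel (X n (idx t)) = convolution_power (\<nu> (r n)) (steps (r n) t)" if "t \<in> dyadic_times" for n t
      unfolding marginal \<xi>_distr tm_idx[OF that] ..
    fix n m and s :: "nat \<Rightarrow> real" and f :: "nat \<Rightarrow> 'a \<Rightarrow> real" and B
    assume s: "\<forall>i. s i \<in> dyadic_times" "\<forall>i<m. s i \<le> s (Suc i)"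
      and f: "\<forall>i. f i \<in> borel_measurable borel" "\<forall>i x. \<bar>f i x\<bar> \<le> B i"
    have [measurable]: "f i \<in> borel_measurable borel" for i using f by simp
    have "(\<integral>\<omega>. (\<Prod>i<m. f i (X n (idx (s (Suc i))) \<omega> - X n (idx (s i)) \<omega>)) \<partial>P)
      = (\<integral>\<omega>. (\<Prod>i<m. f i (\<xi> (r n) (idx (s (Suc i))) \<omega> - \<xi> (r n) (idx (s i)) \<omega>)) \<partial>S (r n))"
      by (rule transfer[of "\<lambda>x. \<Prod>i<m. f i (x (idx (s (Suc i))) - x (idx (s i)))"]) measurable
    also have "\<dots> = (\<Prod>i<m. \<integral>x. f i x \<partial>convolution_power (\<nu> (r n)) (steps (r n) (s (Suc i)) - steps (r n) (s i)))"
      unfolding \<xi>_def S_def using s f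
      by (subst random_walk_increments[symmetric, OF prob sets_\<nu>, where B = B]) (auto simp: tm_idx intro: steps_mono)
    finally show "(\<integral>\<omega>. (\<Prod>i<m. f i (X n (idx (s (Suc i))) \<omega> - X n (idx (s i)) \<omega>)) \<partial>P)
      = (\<Prod>i<m. \<integral>x. f i x \<partial>convolution_power (\<nu> (r n)) (steps (r n) (s (Suc i)) - steps (r n) (s i)))" .
  qed
qed

section \<open>The limit on dyadic times\<close>

text \<open>For each \<open>n\<close>, \<open>X n\<close> is a copy of the walk with step law
  \<open>\<nu> (r n)\<close> at dyadic times. The copies for different \<open>n\<close> are linked
  by their almost sure convergence alone.\<close>

locale coupled_walks = null_array \<nu> h C for \<nu> :: "nat \<Rightarrow> 'a::ordered_euclidean_space measure" and h C +
  fixes r :: "nat \<Rightarrow> nat" and P :: "'b measure" and X :: "nat \<Rightarrow> real \<Rightarrow> 'b \<Rightarrow> 'a" and Z :: "real \<Rightarrow> 'b \<Rightarrow> 'a"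
  assumes r: "strict_mono r" and prob_P: "prob_space P"
    and X_meas [measurable]: "\<And>n t. X n t \<in> borel_measurable P"
    and Z_meas [measurable]: "\<And>t. Z t \<in> borel_measurable P"
    and X_tendsto: "\<And>t. t \<in> dyadic_times \<Longrightarrow> AE \<omega> in P. (\<lambda>n. X n t \<omega>) \<longlonglongrightarrow> Z t \<omega>"
    and X_distr: "\<And>n t. t \<in> dyadic_times \<Longrightarrow> distr P borel (X n t) = convolution_power (\<nu> (r n)) (steps (r n) t)"
    and X_increments: "\<And>n m s f B. (\<And>i. s i \<in> dyadic_times) \<Longrightarrow> (\<And>i. i < m \<Longrightarrow> s i \<le> s (Suc i)) \<Longrightarrow>
      (\<And>i. f i \<in> borel_measurable borel) \<Longrightarrow> (\<And>i x. \<bar>f i x\<bar> \<le> B i) \<Longrightarrow>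
      (\<integral>\<omega>. (\<Prod>i<m. f i (X n (s (Suc i)) \<omega> - X n (s i) \<omega>)) \<partial>P) =
      (\<Prod>i<m. \<integral>x. (f i x :: real) \<partial>convolution_power (\<nu> (r n)) (steps (r n) (s (Suc i)) - steps (r n) (s i)))"
begin

sublocale P: prob_space P by (rule prob_P)

lemma hr_null: "(\<lambda>n. h (r n)) \<longlonglongrightarrow> 0"
  using LIMSEQ_subseq_LIMSEQ[OF h_null r] by (simp add: comp_def)

lemma expectation_tendsto:
  fixes f :: "'a \<Rightarrow> real"
  assumes f: "uniformly_continuous_on UNIV f" and B: "\<And>x. \<bar>f x\<bar> \<le> B"
    and U [measurable]: "\<And>n. U n \<in> borel_measurable P" "V \<in> borel_measurable P"
    and lim: "AE \<omega> in P. (\<lambda>n. U n \<omega>) \<longlonglongrightarrow> V \<omega>"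
  shows "(\<lambda>n. \<integral>\<omega>. f (U n \<omega>) \<partial>P) \<longlonglongrightarrow> (\<integral>\<omega>. f (V \<omega>) \<partial>P)"
proof (rule integral_dominated_convergence[where w = "\<lambda>_. B"])
  note uniformly_continuous_measurable[OF f, measurable]
  show "(\<lambda>\<omega>. f (V \<omega>)) \<in> borel_measurable P" "(\<lambda>\<omega>. f (U n \<omega>)) \<in> borel_measurable P" for n by measurable
  show "AE \<omega> in P. (\<lambda>n. f (U n \<omega>)) \<longlonglongrightarrow> f (V \<omega>)"
    using lim by eventually_elim (rule continuous_on_tendsto_compose[OF uniformly_continuous_imp_continuous[OF f]]; simp)
qed (use B in auto)

lemma expectation_prod_tendsto:
  fixes f :: "nat \<Rightarrow> 'a \<Rightarrow> real"
  assumes f: "\<And>i. uniformly_continuous_on UNIV (f i)" and B: "\<And>i x. \<bar>f i x\<bar> \<le> B i"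
    and U [measurable]: "\<And>i n. U i n \<in> borel_measurable P" "\<And>i. V i \<in> borel_measurable P"
    and lim: "\<And>i. i < m \<Longrightarrow> AE \<omega> in P. (\<lambda>n. U i n \<omega>) \<longlonglongrightarrow> V i \<omega>"
  shows "(\<lambda>n. \<integral>\<omega>. (\<Prod>i<m. f i (U i n \<omega>)) \<partial>P) \<longlonglongrightarrow> (\<integral>\<omega>. (\<Prod>i<m. f i (V i \<omega>)) \<partial>P)"
proof (rule integral_dominated_convergence[where w = "\<lambda>_. \<Prod>i<m. B i"])
  have [measurable]: "f i \<in> borel_measurable borel" for i using f by (rule uniformly_continuous_measurable)
  show "(\<lambda>\<omega>. \<Prod>i<m. f i (V i \<omega>)) \<in> borel_measurable P" "(\<lambda>\<omega>. \<Prod>i<m. f i (U i n \<omega>)) \<in> borel_measurable P" for n by measurable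
  have "AE \<omega> in P. \<forall>i\<in>{..<m}. (\<lambda>n. U i n \<omega>) \<longlonglongrightarrow> V i \<omega>" using lim by (intro AE_finite_allI) auto
  then show "AE \<omega> in P. (\<lambda>n. \<Prod>i<m. f i (U i n \<omega>)) \<longlonglongrightarrow> (\<Prod>i<m. f i (V i \<omega>))"
    by eventually_elim (intro tendsto_prod continuous_on_tendsto_compose[OF uniformly_continuous_imp_continuous[OF f]]; simp)
  show "AE \<omega> in P. norm (\<Prod>i<m. f i (U i n \<omega>)) \<le> (\<Prod>i<m. B i)" for n
    using B by (intro AE_I2) (auto simp: abs_prod intro!: prod_mono)
qed auto

lemma Z_law_tendsto:
  fixes f :: "'a \<Rightarrow> real"
  assumes f: "uniformly_continuous_on UNIV f" and B: "\<And>x. \<bar>f x\<bar> \<le> B" and t: "t \<in> dyadic_times"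
  shows "(\<lambda>n. \<integral>x. f x \<partial>convolution_power (\<nu> (r n)) (steps (r n) t)) \<longlonglongrightarrow> (\<integral>\<omega>. f (Z t \<omega>) \<partial>P)"
proof -
  note uniformly_continuous_measurable[OF f, measurable]
  have "(\<integral>x. f x \<partial>convolution_power (\<nu> (r n)) (steps (r n) t)) = (\<integral>\<omega>. f (X n t \<omega>) \<partial>P)" for n
    by (subst X_distr[OF t, symmetric], subst integral_distr) auto
  with expectation_tendsto[OF f B X_meas Z_meas X_tendsto[OF t]] show ?thesis by simp
qed

text \<open>A change in the number of steps that is negligible against \<open>1 / h (r n)\<close>
  does not affect the limit: by \<open>law_integral_diff\<close> it costs an arbitrarily small
  constant plus a multiple of the time it spans.\<close>

lemma law_increment_tendsto:
  fixes f :: "'a \<Rightarrow> real"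
  assumes f: "uniformly_continuous_on UNIV f" and B: "\<And>x. \<bar>f x\<bar> \<le> B"
    and k: "(\<lambda>n. \<bar>real (k n) - real (j n)\<bar> * h (r n)) \<longlonglongrightarrow> 0"
    and lim: "(\<lambda>n. \<integral>x. f x \<partial>convolution_power (\<nu> (r n)) (j n)) \<longlonglongrightarrow> L"
  shows "(\<lambda>n. \<integral>x. f x \<partial>convolution_power (\<nu> (r n)) (k n)) \<longlonglongrightarrow> L"
proof -
  let ?I = "\<lambda>k n. \<integral>x. f x \<partial>convolution_power (\<nu> (r n)) (k n)"
  have "(\<lambda>n. ?I k n - ?I j n) \<longlonglongrightarrow> 0"
  proof (rule LIMSEQ_I)
    fix e :: real assume e: "e > 0"
    then have "e / 2 > 0" by simp
    from uniformly_continuous_saturated_modulus[OF f B this]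
    obtain A where A: "A \<ge> 0" "\<And>x y. \<bar>f x - f y\<bar> \<le> e / 2 + A * saturated (x - y)" by blast
    have "(\<lambda>n. e / 2 + A * (13 * C * (\<bar>real (k n) - real (j n)\<bar> * h (r n)))) \<longlonglongrightarrow> e / 2 + A * (13 * C * 0)"
      by (intro tendsto_intros k)
    then have "\<forall>\<^sub>F n in sequentially. e / 2 + A * (13 * C * (\<bar>real (k n) - real (j n)\<bar> * h (r n))) < e"
      using e by (elim order_tendstoD(2)) auto
    then have "\<forall>\<^sub>F n in sequentially. norm (?I k n - ?I j n - 0) < e"
      by eventually_elim
         (use law_integral_diff[OF uniformly_continuous_measurable[OF f] B A] in \<open>auto intro: order_le_less_trans\<close>)
    then show "\<exists>no. \<forall>n\<ge>no. norm (?I k n - ?I j n - 0) < e" by (simp add: eventually_sequentially)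
  qed
  from tendsto_add[OF this lim] show ?thesis by simp
qed

text \<open>The expectations for the walks have two limits: one by almost sure convergence, the
  other by the laws after \<open>steps t - steps s\<close> steps, which may be replaced by those
  after \<open>steps (t - s)\<close>. Independence and stationarity on dyadic times come out
  together.\<close>

lemma Z_increments:
  fixes f :: "nat \<Rightarrow> 'a \<Rightarrow> real"
  assumes s: "\<And>i. s i \<in> dyadic_times" "\<And>i. i < m \<Longrightarrow> s i \<le> s (Suc i)"
    and f: "\<And>i. uniformly_continuous_on UNIV (f i)" and B: "\<And>i x. \<bar>f i x\<bar> \<le> B i"
  shows "(\<integral>\<omega>. (\<Prod>i<m. f i (Z (s (Suc i)) \<omega> - Z (s i) \<omega>)) \<partial>P) = (\<Prod>i<m. \<integral>\<omega>. f i (Z (s (Suc i) - s i) \<omega>) \<partial>P)"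
proof (rule LIMSEQ_unique)
  show "(\<lambda>n. \<integral>\<omega>. (\<Prod>i<m. f i (X n (s (Suc i)) \<omega> - X n (s i) \<omega>)) \<partial>P) \<longlonglongrightarrow> (\<integral>\<omega>. (\<Prod>i<m. f i (Z (s (Suc i)) \<omega> - Z (s i) \<omega>)) \<partial>P)"
  proof (rule expectation_prod_tendsto[where U = "\<lambda>i n \<omega>. X n (s (Suc i)) \<omega> - X n (s i) \<omega>" and V = "\<lambda>i \<omega>. Z (s (Suc i)) \<omega> - Z (s i) \<omega>", OF f B])
    fix i
    show "AE \<omega> in P. (\<lambda>n. X n (s (Suc i)) \<omega> - X n (s i) \<omega>) \<longlonglongrightarrow> Z (s (Suc i)) \<omega> - Z (s i) \<omega>"
      using X_tendsto[OF s(1)[of "Suc i"]] X_tendsto[OF s(1)[of i]] by eventually_elim (rule tendsto_diff)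
  qed measurable
  have "(\<lambda>n. \<Prod>i<m. \<integral>x. f i x \<partial>convolution_power (\<nu> (r n)) (steps (r n) (s (Suc i)) - steps (r n) (s i)))
      \<longlonglongrightarrow> (\<Prod>i<m. \<integral>\<omega>. f i (Z (s (Suc i) - s i) \<omega>) \<partial>P)"
  proof (intro tendsto_prod law_increment_tendsto[OF f B _ Z_law_tendsto[OF f B]])
    fix i assume "i \<in> {..<m}"
    then have i: "s i \<le> s (Suc i)" "0 \<le> s i" using s dyadic_times_nonneg by auto
    show "s (Suc i) - s i \<in> dyadic_times" using s i by (intro dyadic_times_diff) auto
    show "(\<lambda>n. \<bar>real (steps (r n) (s (Suc i)) - steps (r n) (s i)) - real (steps (r n) (s (Suc i) - s i))\<bar> * h (r n)) \<longlonglongrightarrow> 0"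
    proof (rule tendsto_sandwich[OF _ _ tendsto_const])
      show "\<forall>\<^sub>F n in sequentially. \<bar>real (steps (r n) (s (Suc i)) - steps (r n) (s i)) - real (steps (r n) (s (Suc i) - s i))\<bar> * h (r n) \<le> 2 * h (r n)"
        using steps_diff[OF i(2,1)] by (intro always_eventually allI)
      show "(\<lambda>n. 2 * h (r n)) \<longlonglongrightarrow> 0" using tendsto_mult_left[OF hr_null, of 2] by simp
      show "\<forall>\<^sub>F n in sequentially. 0 \<le> \<bar>real (steps (r n) (s (Suc i)) - steps (r n) (s i)) - real (steps (r n) (s (Suc i) - s i))\<bar> * h (r n)"
        using h_pos by (intro always_eventually allI mult_nonneg_nonneg) (auto intro: less_imp_le)
    qed
  qed
  then show "(\<lambda>n. \<integral>\<omega>. (\<Prod>i<m. f i (X n (s (Suc i)) \<omega> - X n (s i) \<omega>)) \<partial>P) \<longlonglongrightarrow> (\<Prod>i<m. \<integral>\<omega>. f i (Z (s (Suc i) - s i) \<omega>) \<partial>P)"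
    by (subst X_increments[where s = s and f = f and B = B, OF s uniformly_continuous_measurable[OF f] B])
qed

lemma Z_increment:
  fixes f :: "'a \<Rightarrow> real"
  assumes "s \<in> dyadic_times" "t \<in> dyadic_times" "s \<le> t"
    and f: "uniformly_continuous_on UNIV f" and B: "\<And>x. \<bar>f x\<bar> \<le> B"
  shows "(\<integral>\<omega>. f (Z t \<omega> - Z s \<omega>) \<partial>P) = (\<integral>\<omega>. f (Z (t - s) \<omega>) \<partial>P)"
  using Z_increments[where s = "\<lambda>i. if i = 0 then s else t" and m = 1 and f = "\<lambda>_. f" and B = "\<lambda>_. B"] assms by simp

lemma Z_saturated_bound:
  assumes t: "t \<in> dyadic_times"
  shows "(\<integral>\<omega>. saturated (Z t \<omega>) \<partial>P) \<le> 13 * C * t"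
proof (rule LIMSEQ_le_const2[OF Z_law_tendsto[OF uniformly_continuous_saturated _ t]])
  show "\<bar>saturated x\<bar> \<le> 1" for x :: 'a by (simp add: saturated_nonneg saturated_le_1)
  have "(\<integral>x. saturated x \<partial>convolution_power (\<nu> (r n)) (steps (r n) t)) \<le> 13 * C * t" for n
  proof -
    have "(\<integral>x. saturated x \<partial>convolution_power (\<nu> (r n)) (steps (r n) t)) \<le> 13 * C * (real (steps (r n) t) * h (r n))"
      by (rule saturated_law_bound)
    also have "\<dots> \<le> 13 * C * t" using C_nonneg steps_le[OF dyadic_times_nonneg[OF t]] by (intro mult_left_mono) auto
    finally show ?thesis .
  qed
  then show "\<exists>N. \<forall>n\<ge>N. (\<integral>x. saturated x \<partial>convolution_power (\<nu> (r n)) (steps (r n) t)) \<le> 13 * C * t" by blast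
qed

lemma Z_saturated_increment:
  assumes "s \<in> dyadic_times" "t \<in> dyadic_times" "s \<le> t"
  shows "(\<integral>\<omega>. saturated (Z t \<omega> - Z s \<omega>) \<partial>P) \<le> 13 * C * (t - s)"
  using Z_increment[OF assms uniformly_continuous_saturated, of 1] Z_saturated_bound[OF dyadic_times_diff[OF assms]]
  by (simp add: saturated_nonneg saturated_le_1)

text \<open>Independence of adjacent increments turns a bound linear in time into a product of two
  lengths, which is what makes the sum over all adjacent pairs of a level small.\<close>

lemma Z_saturated_increments:
  assumes "q \<in> dyadic_times" "s \<in> dyadic_times" "t \<in> dyadic_times" "q \<le> s" "s \<le> t"
  shows "(\<integral>\<omega>. saturated (Z s \<omega> - Z q \<omega>) * saturated (Z t \<omega> - Z s \<omega>) \<partial>P) \<le> (13 * C * (s - q)) * (13 * C * (t - s))"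
proof -
  have "(\<integral>\<omega>. saturated (Z s \<omega> - Z q \<omega>) * saturated (Z t \<omega> - Z s \<omega>) \<partial>P)
      = (\<integral>\<omega>. saturated (Z (s - q) \<omega>) \<partial>P) * (\<integral>\<omega>. saturated (Z (t - s) \<omega>) \<partial>P)"
    using Z_increments[where s = "\<lambda>i. if i = 0 then q else if i = 1 then s else t" and m = 2 and f = "\<lambda>_. saturated" and B = "\<lambda>_. 1"] assms
    by (simp add: saturated_nonneg saturated_le_1 uniformly_continuous_saturated numeral_2_eq_2 less_Suc_eq)
  also have "\<dots> \<le> (13 * C * (s - q)) * (13 * C * (t - s))"
    using Z_saturated_bound dyadic_times_diff assms C_nonneg
    by (intro mult_mono Bochner_Integration.integral_nonneg) (auto simp: saturated_nonneg)
  finally show ?thesis .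
qed

text \<open>Markov's inequality for a product: as \<open>a\<close> is at most 1, each factor is at
  least \<open>a\<^sup>2 / 2\<close> on the event, whence \<open>4 / a ^ 4\<close>.\<close>

lemma triple_prob_bound:
  assumes a: "0 < a" "a \<le> 1" and q: "q \<in> dyadic_times" "s \<in> dyadic_times" "t \<in> dyadic_times" "q \<le> s" "s \<le> t"
  shows "P.prob {\<omega> \<in> space P. a < min (norm (Z s \<omega> - Z q \<omega>)) (norm (Z t \<omega> - Z s \<omega>))}
    \<le> 4 / a ^ 4 * ((13 * C * (s - q)) * (13 * C * (t - s)))"
proof -
  let ?E = "{\<omega> \<in> space P. a < min (norm (Z s \<omega> - Z q \<omega>)) (norm (Z t \<omega> - Z s \<omega>))}"
  let ?g = "\<lambda>\<omega>. saturated (Z s \<omega> - Z q \<omega>) * saturated (Z t \<omega> - Z s \<omega>)"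
  have E: "?E \<in> sets P" by measurable
  have int: "integrable P ?g"
    by (rule P.integrable_const_bound[where B = 1])
       (auto simp: abs_mult saturated_nonneg saturated_le_1 intro!: mult_le_one)
  have large: "a\<^sup>2 / 2 \<le> saturated x" if "a < norm x" for x :: 'a
  proof -
    have "a\<^sup>2 / 2 \<le> a\<^sup>2 / (1 + a\<^sup>2)" using a power_le_one[of a 2] by (intro divide_left_mono) (auto simp: add_pos_nonneg)
    also have "\<dots> \<le> saturated x" using a that by (intro saturated_ge) auto
    finally show ?thesis .
  qed
  have "P.prob ?E = (\<integral>\<omega>. indicator ?E \<omega> \<partial>P)" using E by simp
  also have "\<dots> \<le> (\<integral>\<omega>. 4 / a ^ 4 * ?g \<omega> \<partial>P)"
  proof (rule integral_mono)
    show "integrable P (indicat_real ?E)" using E by (intro integrable_real_indicator) (auto simp: less_top[symmetric])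
    show "indicat_real ?E \<omega> \<le> 4 / a ^ 4 * ?g \<omega>" if "\<omega> \<in> space P" for \<omega>
    proof (cases "\<omega> \<in> ?E")
      case True
      then have "a\<^sup>2 / 2 * (a\<^sup>2 / 2) \<le> ?g \<omega>" using large by (intro mult_mono) (auto simp: saturated_nonneg)
      then have "4 / a ^ 4 * (a\<^sup>2 / 2 * (a\<^sup>2 / 2)) \<le> 4 / a ^ 4 * ?g \<omega>" using a by (intro mult_left_mono) auto
      moreover have "4 / a ^ 4 * (a\<^sup>2 / 2 * (a\<^sup>2 / 2)) = 1" using a by (simp flip: power_add)
      ultimately show ?thesis using True by simp
    next
      case False
      then show ?thesis using a by (simp add: saturated_nonneg)
    qed
  qed (use int in simp)
  also have "\<dots> = 4 / a ^ 4 * (\<integral>\<omega>. ?g \<omega> \<partial>P)" by simp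
  also have "\<dots> \<le> 4 / a ^ 4 * ((13 * C * (s - q)) * (13 * C * (t - s)))"
    using Z_saturated_increments[OF q] a by (intro mult_left_mono) auto
  finally show ?thesis .
qed

text \<open>Level \<open>m\<close> has at most \<open>N * 2 ^ m\<close> triples, each bad with
  probability of order \<open>(1 / (4 * (9/10) ^ 4)) ^ m\<close>. The base \<open>9/10\<close> is
  below 1, so that chaining converges, and its fourth power exceeds \<open>1/2\<close>, so that the
  probabilities are summable over \<open>m\<close>. The factor 676 is
  \<open>4 * 13\<^sup>2\<close>.\<close>

lemma AE_three_point_regular: "AE \<omega> in P. three_point_regular (\<lambda>t. Z t \<omega>)"
proof -
  define E where "E m i = {\<omega> \<in> space P. (9/10) ^ m < min (norm (Z (real (i + 1) / 2 ^ m) \<omega> - Z (real i / 2 ^ m) \<omega>))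
          (norm (Z (real (i + 2) / 2 ^ m) \<omega> - Z (real (i + 1) / 2 ^ m) \<omega>))}" for m i
  define A where "A N m = (\<Union>i\<in>{i. i + 2 \<le> N * 2 ^ m}. E m i)" for N m :: nat
  have fin: "finite {i. i + 2 \<le> N * 2 ^ m}" for N m :: nat
    by (rule finite_subset[of _ "{..N * 2 ^ m}"]) auto
  have Em [measurable]: "E m i \<in> sets P" for m i unfolding E_def by measurable
  have Am [measurable]: "A N m \<in> sets P" for N m unfolding A_def using fin by (intro sets.finite_UN) auto
  have probE: "P.prob (E m i) \<le> 676 * C\<^sup>2 * (1 / (4 * (9/10) ^ 4)) ^ m" for m i
  proof -
    have "P.prob (E m i) \<le> 4 / ((9/10) ^ m) ^ 4 * ((13 * C * (real (i + 1) / 2 ^ m - real i / 2 ^ m)) * (13 * C * (real (i + 2) / 2 ^ m - real (i + 1) / 2 ^ m)))"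
      unfolding E_def by (rule triple_prob_bound) (rule zero_less_power power_le_one dyadic_timesI divide_right_mono; simp)+
    also have "real (i + 1) / 2 ^ m - real i / 2 ^ m = 1 / 2 ^ m" by (simp add: add_divide_distrib)
    also have "real (i + 2) / 2 ^ m - real (i + 1) / 2 ^ m = 1 / 2 ^ m" by (simp add: add_divide_distrib)
    also have "4 / ((9/10) ^ m) ^ 4 * ((13 * C * (1 / 2 ^ m)) * (13 * C * (1 / 2 ^ m))) = 676 * C\<^sup>2 * (1 / (((9/10) ^ m) ^ 4 * (2 ^ m * 2 ^ m)))"
      by (simp add: power2_eq_square)
    also have "((9/10::real) ^ m) ^ 4 * (2 ^ m * 2 ^ m) = (4 * (9/10) ^ 4) ^ m"
    proof -
      have "((9/10::real) ^ m) ^ 4 = ((9/10) ^ 4) ^ m" by (simp only: power_mult[symmetric] mult.commute)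
      moreover have "(2::real) ^ m * 2 ^ m = 4 ^ m" by (simp flip: power_mult_distrib)
      ultimately show ?thesis by (simp only: power_mult_distrib mult.commute)
    qed
    finally show ?thesis by (simp add: power_one_over)
  qed
  have probA: "P.prob (A N m) \<le> 676 * real N * C\<^sup>2 * (1 / (2 * (9/10) ^ 4)) ^ m" for N m
  proof -
    have "P.prob (A N m) \<le> (\<Sum>i\<in>{i. i + 2 \<le> N * 2 ^ m}. P.prob (E m i))"
      unfolding A_def using fin by (intro P.finite_measure_subadditive_finite) auto
    also have "\<dots> \<le> real (card {i. i + 2 \<le> N * 2 ^ m}) * (676 * C\<^sup>2 * (1 / (4 * (9/10) ^ 4)) ^ m)"
      by (rule sum_bounded_above[OF probE])
    also have "\<dots> \<le> real (N * 2 ^ m) * (676 * C\<^sup>2 * (1 / (4 * (9/10) ^ 4)) ^ m)"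
    proof (intro mult_right_mono)
      have "card {i. i + 2 \<le> N * 2 ^ m} \<le> card {..<N * 2 ^ m}" by (intro card_mono) auto
      then show "real (card {i. i + 2 \<le> N * 2 ^ m}) \<le> real (N * 2 ^ m)"
        by (simp only: card_lessThan of_nat_le_iff)
    qed auto
    also have "\<dots> = 676 * real N * C\<^sup>2 * (2 * (1 / (4 * (9/10) ^ 4))) ^ m"
      unfolding power_mult_distrib by simp
    finally show ?thesis by simp
  qed
  have "summable (\<lambda>m. P.prob (A N m))" for N
  proof (rule summable_comparison_test')
    show "summable (\<lambda>m. 676 * real N * C\<^sup>2 * (1 / (2 * (9/10) ^ 4)) ^ m)"
      by (intro summable_mult summable_geometric) (simp add: power4_eq_xxxx)
    show "norm (P.prob (A N m)) \<le> 676 * real N * C\<^sup>2 * (1 / (2 * (9/10) ^ 4)) ^ m" for m using probA by simp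
  qed
  then have "AE \<omega> in P. \<forall>\<^sub>F m in sequentially. \<omega> \<in> space P - A N m" for N
    by (intro borel_cantelli_AE1) (auto simp: less_top[symmetric])
  then have "AE \<omega> in P. \<forall>N. \<forall>\<^sub>F m in sequentially. \<omega> \<in> space P - A N m" by (simp add: AE_all_countable)
  then show ?thesis
  proof eventually_elim
    case (elim \<omega>)
    show ?case
    proof (rule three_point_regular_chaining[of "9/10"])
      fix N :: nat
      obtain m0 where "\<And>m. m \<ge> m0 \<Longrightarrow> \<omega> \<in> space P - A N m" using elim unfolding eventually_sequentially by blast
      note m0 = this
      have "min (norm (Z (real (i + 1) / 2 ^ m) \<omega> - Z (real i / 2 ^ m) \<omega>))
            (norm (Z (real (i + 2) / 2 ^ m) \<omega> - Z (real (i + 1) / 2 ^ m) \<omega>)) \<le> (9/10) ^ m"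
        if "m0 \<le> m" "i + 2 \<le> N * 2 ^ m" for m i
      proof -
        have "\<omega> \<in> space P" "\<omega> \<notin> E m i" using m0[OF that(1)] that(2) by (auto simp: A_def)
        then show ?thesis unfolding E_def by (simp only: mem_Collect_eq not_less simp_thms)
      qed
      then show "\<exists>m0. \<forall>m\<ge>m0. \<forall>i. i + 2 \<le> N * 2 ^ m \<longrightarrow>
        min (norm (Z (real (i + 1) / 2 ^ m) \<omega> - Z (real i / 2 ^ m) \<omega>))
            (norm (Z (real (i + 2) / 2 ^ m) \<omega> - Z (real (i + 1) / 2 ^ m) \<omega>)) \<le> (9/10) ^ m"
        by blast
    qed auto
  qed
qed

section \<open>The process of right limits\<close>

text \<open>The right limit is taken along one explicit sequence, so that measurability is immediate
  at every time; where that sequence diverges, the value is whatever \<open>lim\<close>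
  returns.\<close>

definition Y :: "real \<Rightarrow> 'b \<Rightarrow> 'a" where
  "Y t \<omega> = lim (\<lambda>m. Z (dyadic_above m t) \<omega>)"

lemma Y_meas [measurable]: "Y t \<in> borel_measurable P"
  unfolding Y_def by measurable

text \<open>One exceptional set has to serve all times at once; it is the null set on which
  \<open>three_point_regular\<close> fails, a property of the whole path.\<close>

lemma AE_Y: "AE \<omega> in P. cadlag (\<lambda>t. Y t \<omega>) \<and>
  (\<forall>t\<ge>0. ((\<lambda>s. Z s \<omega>) \<longlongrightarrow> Y t \<omega>) (at t within dyadic_times \<inter> {t<..}))"
  using AE_three_point_regular
proof eventually_elim
  case (elim \<omega>)
  have right: "((\<lambda>s. Z s \<omega>) \<longlongrightarrow> Y t \<omega>) (at t within dyadic_times \<inter> {t<..})" if "0 \<le> t" for t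
  proof -
    obtain l where l: "((\<lambda>s. Z s \<omega>) \<longlongrightarrow> l) (at t within dyadic_times \<inter> {t<..})"
      using three_point_regular_right[OF elim \<open>0 \<le> t\<close>] by blast
    have "(\<lambda>m. Z (dyadic_above m t) \<omega>) \<longlonglongrightarrow> l"
      by (rule tendsto_within_dyadic_times_above[OF l]) (use that in \<open>auto intro: dyadic_above_gt dyadic_above_tendsto\<close>)
    then show ?thesis using l unfolding Y_def by (simp add: limI)
  qed
  then show ?case
    using cadlag_right_limits[of "\<lambda>s. Z s \<omega>" "\<lambda>t. Y t \<omega>"] three_point_regular_left[OF elim] by blast
qed

lemma Z_tendsto_Y:
  assumes "0 \<le> t" "\<And>m. q m \<in> dyadic_times" "\<And>m. t < q m" "q \<longlonglongrightarrow> t"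
  shows "AE \<omega> in P. (\<lambda>m. Z (q m) \<omega>) \<longlonglongrightarrow> Y t \<omega>"
  using AE_Y by eventually_elim (rule tendsto_within_dyadic_times_above; use assms in auto)

lemma Z_dyadic_above_tendsto_Y: "0 \<le> t \<Longrightarrow> AE \<omega> in P. (\<lambda>m. Z (dyadic_above m t) \<omega>) \<longlonglongrightarrow> Y t \<omega>"
  by (rule Z_tendsto_Y) (auto intro: dyadic_above_gt dyadic_above_tendsto)

lemma Y_increment:
  fixes f :: "'a \<Rightarrow> real"
  assumes s: "0 \<le> s" "0 \<le> u" and f: "uniformly_continuous_on UNIV f" and B: "\<And>x. \<bar>f x\<bar> \<le> B"
  shows "(\<integral>\<omega>. f (Y (s + u) \<omega> - Y s \<omega>) \<partial>P) = (\<integral>\<omega>. f (Y u \<omega>) \<partial>P)"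
proof (rule LIMSEQ_unique)
  \<comment> \<open>The later time is approximated by a sum of two roundings rather than by the
    rounding of \<open>s + u\<close>, so that \<open>b m - a m\<close> is exactly
    \<open>dyadic_above m u\<close> and stationarity on dyadic times applies.\<close>
  define a b where "a m = dyadic_above m s" and "b m = dyadic_above m s + dyadic_above m u" for m
  show "(\<lambda>m. \<integral>\<omega>. f (Z (b m) \<omega> - Z (a m) \<omega>) \<partial>P) \<longlonglongrightarrow> (\<integral>\<omega>. f (Y (s + u) \<omega> - Y s \<omega>) \<partial>P)"
  proof (rule expectation_tendsto[OF f B])
    have "AE \<omega> in P. (\<lambda>m. Z (b m) \<omega>) \<longlonglongrightarrow> Y (s + u) \<omega>"
      unfolding b_def using s
      by (intro Z_tendsto_Y dyadic_times_add tendsto_add dyadic_above_tendsto add_strict_mono dyadic_above_gt) auto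
    with Z_dyadic_above_tendsto_Y[OF s(1)] show "AE \<omega> in P. (\<lambda>m. Z (b m) \<omega> - Z (a m) \<omega>) \<longlonglongrightarrow> Y (s + u) \<omega> - Y s \<omega>"
      unfolding a_def by eventually_elim (rule tendsto_diff)
  qed measurable
  have "(\<integral>\<omega>. f (Z (b m) \<omega> - Z (a m) \<omega>) \<partial>P) = (\<integral>\<omega>. f (Z (dyadic_above m u) \<omega>) \<partial>P)" for m
    using Z_increment[of "a m" "b m", OF _ _ _ f B] dyadic_times_nonneg[of "dyadic_above m u"]
    by (simp add: a_def b_def dyadic_times_add)
  moreover have "(\<lambda>m. \<integral>\<omega>. f (Z (dyadic_above m u) \<omega>) \<partial>P) \<longlonglongrightarrow> (\<integral>\<omega>. f (Y u \<omega>) \<partial>P)"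
    by (rule expectation_tendsto[OF f B]) (use Z_dyadic_above_tendsto_Y[OF s(2)] in auto)
  ultimately show "(\<lambda>m. \<integral>\<omega>. f (Z (b m) \<omega> - Z (a m) \<omega>) \<partial>P) \<longlonglongrightarrow> (\<integral>\<omega>. f (Y u \<omega>) \<partial>P)" by simp
qed

lemma Y_saturated_bound:
  assumes "0 \<le> t" shows "(\<integral>\<omega>. saturated (Y t \<omega>) \<partial>P) \<le> 13 * C * t"
proof (rule LIMSEQ_le)
  show "(\<lambda>m. \<integral>\<omega>. saturated (Z (dyadic_above m t) \<omega>) \<partial>P) \<longlonglongrightarrow> (\<integral>\<omega>. saturated (Y t \<omega>) \<partial>P)"
    by (rule expectation_tendsto[OF uniformly_continuous_saturated, of 1])
       (use Z_dyadic_above_tendsto_Y[OF assms] in \<open>auto simp: saturated_nonneg saturated_le_1\<close>)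
  show "(\<lambda>m. 13 * C * dyadic_above m t) \<longlonglongrightarrow> 13 * C * t"
    by (intro tendsto_mult_left dyadic_above_tendsto assms)
qed (use Z_saturated_bound in auto)

lemma Y_saturated_increment:
  assumes "0 \<le> s" "0 \<le> t" shows "(\<integral>\<omega>. saturated (Y t \<omega> - Y s \<omega>) \<partial>P) \<le> 13 * C * \<bar>t - s\<bar>"
proof -
  have *: "(\<integral>\<omega>. saturated (Y t \<omega> - Y s \<omega>) \<partial>P) \<le> 13 * C * (t - s)" if "0 \<le> s" "s \<le> t" for s t
    using Y_increment[of s "t - s", OF _ _ uniformly_continuous_saturated, of 1] Y_saturated_bound[of "t - s"] that
    by (simp add: saturated_nonneg saturated_le_1)
  show ?thesis
  proof (cases "s \<le> t")
    case True then show ?thesis using *[of s t] assms by simp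
  next
    case False
    then show ?thesis using *[of t s] assms by (simp add: saturated_minus)
  qed
qed

text \<open>As a right limit, \<open>Y 0\<close> does not vanish by definition; the linear bound at
  time 0 forces it to vanish almost surely.\<close>

lemma AE_Y_0: "AE \<omega> in P. Y 0 \<omega> = 0"
proof -
  have "(\<integral>\<omega>. saturated (Y 0 \<omega>) \<partial>P) \<le> 0" using Y_saturated_bound[of 0] by simp
  moreover have "0 \<le> (\<integral>\<omega>. saturated (Y 0 \<omega>) \<partial>P)"
    by (intro Bochner_Integration.integral_nonneg) (simp add: saturated_nonneg)
  ultimately have "(\<integral>\<omega>. saturated (Y 0 \<omega>) \<partial>P) = 0" by simp
  moreover have "integrable P (\<lambda>\<omega>. saturated (Y 0 \<omega>))"
    by (rule P.integrable_const_bound[where B = 1]) (auto simp: saturated_nonneg saturated_le_1)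
  ultimately have "AE \<omega> in P. saturated (Y 0 \<omega>) = 0"
    by (subst integral_nonneg_eq_0_iff_AE[symmetric]) (auto simp: saturated_nonneg)
  then show ?thesis by (simp add: saturated_eq_0_iff)
qed

lemma Y_increments:
  fixes f :: "nat \<Rightarrow> 'a \<Rightarrow> real"
  assumes s: "\<And>i. 0 \<le> s i" "\<And>i. i < m \<Longrightarrow> s i \<le> s (Suc i)"
    and f: "\<And>i. uniformly_continuous_on UNIV (f i)" and B: "\<And>i x. \<bar>f i x\<bar> \<le> B i"
  shows "(\<integral>\<omega>. (\<Prod>i<m. f i (Y (s (Suc i)) \<omega> - Y (s i) \<omega>)) \<partial>P) = (\<Prod>i<m. \<integral>\<omega>. f i (Y (s (Suc i)) \<omega> - Y (s i) \<omega>) \<partial>P)"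
proof (rule LIMSEQ_unique)
  define q where "q k i = dyadic_above k (s i)" for k i
  have conv: "AE \<omega> in P. (\<lambda>k. Z (q k (Suc i)) \<omega> - Z (q k i) \<omega>) \<longlonglongrightarrow> Y (s (Suc i)) \<omega> - Y (s i) \<omega>" for i
    unfolding q_def using Z_dyadic_above_tendsto_Y[OF s(1), of i] Z_dyadic_above_tendsto_Y[OF s(1), of "Suc i"]
    by eventually_elim (rule tendsto_diff)
  show "(\<lambda>k. \<integral>\<omega>. (\<Prod>i<m. f i (Z (q k (Suc i)) \<omega> - Z (q k i) \<omega>)) \<partial>P) \<longlonglongrightarrow> (\<integral>\<omega>. (\<Prod>i<m. f i (Y (s (Suc i)) \<omega> - Y (s i) \<omega>)) \<partial>P)"
    by (rule expectation_prod_tendsto[where U = "\<lambda>i k \<omega>. Z (q k (Suc i)) \<omega> - Z (q k i) \<omega>" and V = "\<lambda>i \<omega>. Y (s (Suc i)) \<omega> - Y (s i) \<omega>", OF f B _ _ conv])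
       measurable
  have "(\<integral>\<omega>. (\<Prod>i<m. f i (Z (q k (Suc i)) \<omega> - Z (q k i) \<omega>)) \<partial>P) = (\<Prod>i<m. \<integral>\<omega>. f i (Z (q k (Suc i)) \<omega> - Z (q k i) \<omega>) \<partial>P)" for k
  proof -
    have mono: "q k i \<le> q k (Suc i)" if "i < m" for i unfolding q_def by (intro dyadic_above_mono s that)
    have "(\<integral>\<omega>. (\<Prod>i<m. f i (Z (q k (Suc i)) \<omega> - Z (q k i) \<omega>)) \<partial>P) = (\<Prod>i<m. \<integral>\<omega>. f i (Z (q k (Suc i) - q k i) \<omega>) \<partial>P)"
      by (rule Z_increments[where s = "q k" and B = B]) (use mono f B in \<open>auto simp: q_def\<close>)
    \<comment> \<open>Stationarity is used backwards, to return from \<open>Z\<close> at a time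
      difference to a difference of values of \<open>Z\<close>, which converges to an increment of
      \<open>Y\<close>.\<close>
    also have "\<dots> = (\<Prod>i<m. \<integral>\<omega>. f i (Z (q k (Suc i)) \<omega> - Z (q k i) \<omega>) \<partial>P)"
      by (intro prod.cong refl Z_increment[symmetric, OF _ _ _ f B]) (use mono in \<open>auto simp: q_def\<close>)
    finally show ?thesis .
  qed
  moreover have "(\<lambda>k. \<Prod>i<m. \<integral>\<omega>. f i (Z (q k (Suc i)) \<omega> - Z (q k i) \<omega>) \<partial>P) \<longlonglongrightarrow> (\<Prod>i<m. \<integral>\<omega>. f i (Y (s (Suc i)) \<omega> - Y (s i) \<omega>) \<partial>P)"
    by (intro tendsto_prod expectation_tendsto[OF f B _ _ conv]) measurable
  ultimately show "(\<lambda>k. \<integral>\<omega>. (\<Prod>i<m. f i (Z (q k (Suc i)) \<omega> - Z (q k i) \<omega>)) \<partial>P) \<longlonglongrightarrow> (\<Prod>i<m. \<integral>\<omega>. f i (Y (s (Suc i)) \<omega> - Y (s i) \<omega>) \<partial>P)"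
    by simp
qed

text \<open>Markov's inequality for \<open>saturated\<close>; the linear factor in time yields
  stochastic continuity.\<close>

lemma prob_increment_bound:
  assumes "0 \<le> s" "0 \<le> t" "\<epsilon> > 0"
  shows "P.prob {\<omega> \<in> space P. norm (Y s \<omega> - Y t \<omega>) > \<epsilon>} \<le> (1 + \<epsilon>\<^sup>2) / \<epsilon>\<^sup>2 * (13 * C * \<bar>s - t\<bar>)"
proof -
  let ?E = "{\<omega> \<in> space P. norm (Y s \<omega> - Y t \<omega>) > \<epsilon>}"
  have E: "?E \<in> sets P" by measurable
  have pos: "0 < 1 + \<epsilon>\<^sup>2" by (simp add: add_pos_nonneg)
  have int: "integrable P (\<lambda>\<omega>. saturated (Y s \<omega> - Y t \<omega>))"
    by (rule P.integrable_const_bound[where B = 1]) (auto simp: saturated_nonneg saturated_le_1)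
  have "P.prob ?E = (\<integral>\<omega>. indicator ?E \<omega> \<partial>P)" using E by simp
  also have "\<dots> \<le> (\<integral>\<omega>. (1 + \<epsilon>\<^sup>2) / \<epsilon>\<^sup>2 * saturated (Y s \<omega> - Y t \<omega>) \<partial>P)"
  proof (rule integral_mono)
    show "integrable P (indicat_real ?E)" using E by (intro integrable_real_indicator) (auto simp: less_top[symmetric])
    show "indicat_real ?E \<omega> \<le> (1 + \<epsilon>\<^sup>2) / \<epsilon>\<^sup>2 * saturated (Y s \<omega> - Y t \<omega>)" for \<omega>
    proof (cases "\<omega> \<in> ?E")
      case True
      then have "(1 + \<epsilon>\<^sup>2) / \<epsilon>\<^sup>2 * (\<epsilon>\<^sup>2 / (1 + \<epsilon>\<^sup>2)) \<le> (1 + \<epsilon>\<^sup>2) / \<epsilon>\<^sup>2 * saturated (Y s \<omega> - Y t \<omega>)"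
        using assms pos by (intro mult_left_mono saturated_ge) auto
      then show ?thesis using True assms pos by simp
    next
      case False
      then show ?thesis using assms pos by (simp add: saturated_nonneg)
    qed
  qed (use int in simp)
  also have "\<dots> = (1 + \<epsilon>\<^sup>2) / \<epsilon>\<^sup>2 * (\<integral>\<omega>. saturated (Y s \<omega> - Y t \<omega>) \<partial>P)" by simp
  also have "\<dots> \<le> (1 + \<epsilon>\<^sup>2) / \<epsilon>\<^sup>2 * (13 * C * \<bar>s - t\<bar>)"
    using Y_saturated_increment[OF assms(2,1)] pos by (intro mult_left_mono) auto
  finally show ?thesis .
qed

lemma levy_process_Y: "levy_process P Y"
  unfolding levy_process_def
proof (intro conjI allI impI)
  show "prob_space P" by (rule prob_P)
  show "Y t \<in> borel_measurable P" for t by measurable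
  show "AE \<omega> in P. Y 0 \<omega> = 0" by (rule AE_Y_0)
  show "AE \<omega> in P. cadlag (\<lambda>t. Y t \<omega>)" using AE_Y by eventually_elim simp
  show "distr P borel (\<lambda>\<omega>. Y (s + u) \<omega> - Y s \<omega>) = distr P borel (\<lambda>\<omega>. Y u \<omega> - Y 0 \<omega>)" if "0 \<le> s" "0 \<le> u" for s u
  proof (rule measure_eqI_uniformly_continuous)
    show "prob_space (distr P borel (\<lambda>\<omega>. Y (s + u) \<omega> - Y s \<omega>))" "prob_space (distr P borel (\<lambda>\<omega>. Y u \<omega> - Y 0 \<omega>))"
      by (intro P.prob_space_distr; measurable)+
    fix f :: "'a \<Rightarrow> real" and B assume f: "uniformly_continuous_on UNIV f" and B: "\<And>x. \<bar>f x\<bar> \<le> B"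
    note uniformly_continuous_measurable[OF f, measurable]
    \<comment> \<open>Both sides equal the expectation of \<open>f (Y u)\<close>; the right one is
      the case of starting time 0.\<close>
    show "(\<integral>x. f x \<partial>distr P borel (\<lambda>\<omega>. Y (s + u) \<omega> - Y s \<omega>)) = (\<integral>x. f x \<partial>distr P borel (\<lambda>\<omega>. Y u \<omega> - Y 0 \<omega>))"
      using Y_increment[OF that f B] Y_increment[OF order_refl that(2) f B] by (simp add: integral_distr)
  qed auto
  show "P.indep_vars (\<lambda>_. borel) (\<lambda>i \<omega>. Y (t (Suc i)) \<omega> - Y (t i) \<omega>) {..<n}"
    if t: "0 \<le> t 0 \<and> (\<forall>i<n. t i \<le> t (Suc i))" for n t
  proof (rule P.indep_vars_uniformly_continuousI)
    fix f :: "nat \<Rightarrow> 'a \<Rightarrow> real"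
    assume f: "\<And>i. uniformly_continuous_on UNIV (f i)" "\<And>i x. 0 \<le> f i x" "\<And>i x. f i x \<le> 1"
    \<comment> \<open>\<open>Y_increments\<close> wants nonnegative times at every index, while
      \<open>t\<close> is controlled only up to \<open>n\<close>; freezing it there changes none of
      the increments in question.\<close>
    define s where "s i = t (min i n)" for i
    have nonneg: "0 \<le> t i" if "i \<le> n" for i
      using that
    proof (induction i)
      case (Suc i)
      then have "0 \<le> t i" by simp
      also have "t i \<le> t (Suc i)" using t Suc by simp
      finally show ?case .
    qed (use t in simp)
    have "(\<integral>\<omega>. (\<Prod>i<n. f i (Y (s (Suc i)) \<omega> - Y (s i) \<omega>)) \<partial>P) = (\<Prod>i<n. \<integral>\<omega>. f i (Y (s (Suc i)) \<omega> - Y (s i) \<omega>) \<partial>P)"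
      by (rule Y_increments[where B = "\<lambda>_. 1"]) (use f t nonneg in \<open>auto simp: s_def\<close>)
    then show "(\<integral>\<omega>. (\<Prod>i<n. f i (Y (t (Suc i)) \<omega> - Y (t i) \<omega>)) \<partial>P) = (\<Prod>i<n. \<integral>\<omega>. f i (Y (t (Suc i)) \<omega> - Y (t i) \<omega>) \<partial>P)"
      by (simp add: s_def)
  qed measurable
  show "((\<lambda>s. P.prob {\<omega> \<in> space P. norm (Y s \<omega> - Y t \<omega>) > \<epsilon>}) \<longlongrightarrow> 0) (at t within {0..})"
    if "0 \<le> t" "0 < \<epsilon>" for t \<epsilon>
  proof (rule tendsto_sandwich[OF _ _ tendsto_const])
    show "\<forall>\<^sub>F s in at t within {0..}. P.prob {\<omega> \<in> space P. norm (Y s \<omega> - Y t \<omega>) > \<epsilon>} \<le> (1 + \<epsilon>\<^sup>2) / \<epsilon>\<^sup>2 * (13 * C * \<bar>s - t\<bar>)"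
      using prob_increment_bound that by (auto simp: eventually_at intro!: exI[of _ 1])
    have "((\<lambda>s. (1 + \<epsilon>\<^sup>2) / \<epsilon>\<^sup>2 * (13 * C * \<bar>s - t\<bar>)) \<longlongrightarrow> (1 + \<epsilon>\<^sup>2) / \<epsilon>\<^sup>2 * (13 * C * \<bar>t - t\<bar>)) (at t within {0..})"
      by (intro tendsto_intros)
    then show "((\<lambda>s. (1 + \<epsilon>\<^sup>2) / \<epsilon>\<^sup>2 * (13 * C * \<bar>s - t\<bar>)) \<longlongrightarrow> 0) (at t within {0..})" by simp
  qed simp
qed

section \<open>Convergence of the laws for arbitrary numbers of steps\<close>

text \<open>Since \<open>t\<close> may fail to be dyadic, \<open>Y t\<close> is compared with
  \<open>Z\<close> at a dyadic time \<open>q\<close> to its right. The estimate between two dyadic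
  times is carried to the limit along \<open>dyadic_above m t\<close>, which eventually drops below
  \<open>q\<close>.\<close>

lemma Z_Y_expectation_diff:
  fixes f :: "'a \<Rightarrow> real"
  assumes f: "uniformly_continuous_on UNIV f" and B: "\<And>x. \<bar>f x\<bar> \<le> B"
    and A: "A \<ge> 0" "\<And>x y. \<bar>f x - f y\<bar> \<le> e + A * saturated (x - y)"
    and t: "0 \<le> t" "t < q" "q \<in> dyadic_times"
  shows "\<bar>(\<integral>\<omega>. f (Z q \<omega>) \<partial>P) - (\<integral>\<omega>. f (Y t \<omega>) \<partial>P)\<bar> \<le> e + A * (13 * C * (q - t))"
proof (rule tendsto_le[OF sequentially_bot])
  note uniformly_continuous_measurable[OF f, measurable]
  show "(\<lambda>m. \<bar>(\<integral>\<omega>. f (Z q \<omega>) \<partial>P) - (\<integral>\<omega>. f (Z (dyadic_above m t) \<omega>) \<partial>P)\<bar>)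
      \<longlonglongrightarrow> \<bar>(\<integral>\<omega>. f (Z q \<omega>) \<partial>P) - (\<integral>\<omega>. f (Y t \<omega>) \<partial>P)\<bar>"
    by (intro tendsto_intros expectation_tendsto[OF f B] Z_dyadic_above_tendsto_Y t) measurable
  show "(\<lambda>m. e + A * (13 * C * (q - dyadic_above m t))) \<longlonglongrightarrow> e + A * (13 * C * (q - t))"
    by (intro tendsto_intros dyadic_above_tendsto t)
  have "\<forall>\<^sub>F m in sequentially. dyadic_above m t < q" using order_tendstoD(2)[OF dyadic_above_tendsto[OF t(1)] t(2)] .
  then show "\<forall>\<^sub>F m in sequentially. \<bar>(\<integral>\<omega>. f (Z q \<omega>) \<partial>P) - (\<integral>\<omega>. f (Z (dyadic_above m t) \<omega>) \<partial>P)\<bar>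
      \<le> e + A * (13 * C * (q - dyadic_above m t))"
  proof eventually_elim
    case (elim m)
    let ?p = "dyadic_above m t"
    have int: "integrable P (\<lambda>\<omega>. f (Z s \<omega>))" for s
      by (rule P.integrable_const_bound[where B = B]) (use B in auto)
    have ints: "integrable P (\<lambda>\<omega>. saturated (Z q \<omega> - Z ?p \<omega>))"
      by (rule P.integrable_const_bound[where B = 1]) (auto simp: saturated_nonneg saturated_le_1)
    have "\<bar>(\<integral>\<omega>. f (Z q \<omega>) \<partial>P) - (\<integral>\<omega>. f (Z ?p \<omega>) \<partial>P)\<bar> = \<bar>\<integral>\<omega>. f (Z q \<omega>) - f (Z ?p \<omega>) \<partial>P\<bar>"
      using int by simp
    also have "\<dots> \<le> (\<integral>\<omega>. e + A * saturated (Z q \<omega> - Z ?p \<omega>) \<partial>P)"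
      using int ints A by (intro order_trans[OF integral_abs_bound integral_mono]) auto
    also have "\<dots> = e + A * (\<integral>\<omega>. saturated (Z q \<omega> - Z ?p \<omega>) \<partial>P)" using ints P.prob_space by simp
    also have "\<dots> \<le> e + A * (13 * C * (q - ?p))"
      using Z_saturated_increment[of ?p q] t elim A by (intro add_left_mono mult_left_mono) auto
    finally show ?case .
  qed
qed

lemma laws_tendsto_Y:
  fixes f :: "'a \<Rightarrow> real"
  assumes f: "uniformly_continuous_on UNIV f" and B: "\<And>x. \<bar>f x\<bar> \<le> B"
    and t: "0 \<le> t" and k: "(\<lambda>n. real (k n) * h (r n)) \<longlonglongrightarrow> t"
  shows "(\<lambda>n. \<integral>x. f x \<partial>convolution_power (\<nu> (r n)) (k n)) \<longlonglongrightarrow> (\<integral>\<omega>. f (Y t \<omega>) \<partial>P)"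
proof (rule LIMSEQ_I)
  fix e :: real assume e: "e > 0"
  \<comment> \<open>Five errors of at most \<open>e / 6\<close> each: a constant and a time term for
    passing from \<open>k n\<close> to \<open>steps (r n) q\<close>, the same for passing from
    \<open>Z q\<close> to \<open>Y t\<close>, and the convergence at \<open>q\<close>. The time
    \<open>q\<close> is fixed before \<open>n\<close> grows.\<close>
  then have "e / 6 > 0" by simp
  from uniformly_continuous_saturated_modulus[OF f B this]
  obtain A where A: "A \<ge> 0" "\<And>x y. \<bar>f x - f y\<bar> \<le> e / 6 + A * saturated (x - y)" by blast
  have "(\<lambda>m. A * (13 * C * (dyadic_above m t - t))) \<longlonglongrightarrow> A * (13 * C * (t - t))"
    by (intro tendsto_intros dyadic_above_tendsto t)
  then have "\<forall>\<^sub>F m in sequentially. A * (13 * C * (dyadic_above m t - t)) < e / 6" using e by (elim order_tendstoD(2)) auto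
  then obtain m where m: "A * (13 * C * (dyadic_above m t - t)) < e / 6" by (auto simp: eventually_sequentially)
  define q where "q = dyadic_above m t"
  have q: "q \<in> dyadic_times" "t < q" "0 \<le> q" using dyadic_above_gt[OF t, of m] t by (auto simp: q_def)
  have steps: "(\<lambda>n. real (steps (r n) q) * h (r n)) \<longlonglongrightarrow> q"
  proof (rule tendsto_sandwich[OF _ _ _ tendsto_const])
    show "\<forall>\<^sub>F n in sequentially. q - h (r n) \<le> real (steps (r n) q) * h (r n)"
      using steps_gt[OF q(3)] by (intro always_eventually allI less_imp_le)
    show "\<forall>\<^sub>F n in sequentially. real (steps (r n) q) * h (r n) \<le> q"
      using steps_le[OF q(3)] by (intro always_eventually allI)
    show "(\<lambda>n. q - h (r n)) \<longlonglongrightarrow> q" using tendsto_diff[OF tendsto_const hr_null, of q] by simp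
  qed
  let ?I = "\<lambda>k n. \<integral>x. f x \<partial>convolution_power (\<nu> (r n)) (k n)"
  have eq: "\<bar>real (k n) - real (steps (r n) q)\<bar> * h (r n) = \<bar>real (k n) * h (r n) - real (steps (r n) q) * h (r n)\<bar>" for n
    using h_pos[of "r n"] abs_mult[of "real (k n) - real (steps (r n) q)" "h (r n)"] by (simp add: left_diff_distrib)
  have "(\<lambda>n. A * (13 * C * (\<bar>real (k n) - real (steps (r n) q)\<bar> * h (r n)))) \<longlonglongrightarrow> A * (13 * C * \<bar>t - q\<bar>)"
    unfolding eq by (intro tendsto_intros k steps)
  then have "\<forall>\<^sub>F n in sequentially. A * (13 * C * (\<bar>real (k n) - real (steps (r n) q)\<bar> * h (r n))) < e / 6"
    using m q(2) by (elim order_tendstoD(2)) (simp add: q_def)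
  moreover have "\<forall>\<^sub>F n in sequentially. dist (?I (\<lambda>n. steps (r n) q) n) (\<integral>\<omega>. f (Z q \<omega>) \<partial>P) < e / 6"
    using tendstoD[OF Z_law_tendsto[OF f B q(1)], of "e / 6"] e by simp
  ultimately have "\<forall>\<^sub>F n in sequentially. norm (?I k n - (\<integral>\<omega>. f (Y t \<omega>) \<partial>P)) < e"
  proof eventually_elim
    case (elim n)
    have "\<bar>?I k n - ?I (\<lambda>n. steps (r n) q) n\<bar> \<le> e / 6 + A * (13 * C * (\<bar>real (k n) - real (steps (r n) q)\<bar> * h (r n)))"
      by (rule law_integral_diff[OF uniformly_continuous_measurable[OF f] B A])
    moreover have "\<bar>(\<integral>\<omega>. f (Z q \<omega>) \<partial>P) - (\<integral>\<omega>. f (Y t \<omega>) \<partial>P)\<bar> \<le> e / 6 + A * (13 * C * (q - t))"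
      by (rule Z_Y_expectation_diff[OF f B A t q(2,1)])
    ultimately show ?case using elim m unfolding q_def[symmetric] dist_real_def real_norm_def by linarith
  qed
  then show "\<exists>no. \<forall>n\<ge>no. norm (?I k n - (\<integral>\<omega>. f (Y t \<omega>) \<partial>P)) < e" by (simp add: eventually_sequentially)
qed

lemma laws_converge_to_Y:
  assumes "0 \<le> t" "(\<lambda>n. real (k n) * h (r n)) \<longlonglongrightarrow> t"
  shows "converges_in_distribution (\<lambda>n. convolution_power (\<nu> (r n)) (k n)) (distr P borel (Y t))"
proof (rule converges_in_distributionI_uniformly_continuous)
  show "prob_space (convolution_power (\<nu> (r n)) (k n))" for n by (rule prob_law)
  show "prob_space (distr P borel (Y t))" by (intro P.prob_space_distr) measurable
  fix f :: "'a \<Rightarrow> real" and B assume f: "uniformly_continuous_on UNIV f" and B: "\<And>x. \<bar>f x\<bar> \<le> B"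
  note uniformly_continuous_measurable[OF f, measurable]
  show "(\<lambda>n. \<integral>x. f x \<partial>convolution_power (\<nu> (r n)) (k n)) \<longlonglongrightarrow> (\<integral>x. f x \<partial>distr P borel (Y t))"
    using laws_tendsto_Y[OF f B assms] by (simp add: integral_distr)
qed auto

end

theorem (in null_array) levy_limit:
  assumes "inj (e :: real \<Rightarrow> 'b)"
  shows "\<exists>r (P :: 'b measure) Y. strict_mono r \<and> levy_process P Y \<and>
    (\<forall>k t. 0 \<le> t \<and> (\<lambda>n. real (k n) * h (r n)) \<longlonglongrightarrow> t \<longrightarrow>
      converges_in_distribution (\<lambda>n. convolution_power (\<nu> (r n)) (k n)) (distr P borel (Y t)))"
proof -
  obtain r and P :: "'b measure" and X Z where 1: "strict_mono r" "prob_space P" "\<forall>n t. X n t \<in> borel_measurable P"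
    "\<forall>t. Z t \<in> borel_measurable P"
    "\<forall>t\<in>dyadic_times. AE \<omega> in P. (\<lambda>n. X n t \<omega>) \<longlonglongrightarrow> Z t \<omega>"
    "\<forall>n. \<forall>t\<in>dyadic_times. distr P borel (X n t) = convolution_power (\<nu> (r n)) (steps (r n) t)"
    "\<forall>n m s f B. (\<forall>i. s i \<in> dyadic_times) \<longrightarrow> (\<forall>i<m. s i \<le> s (Suc i)) \<longrightarrow>
      (\<forall>i. f i \<in> borel_measurable borel) \<longrightarrow> (\<forall>i x. \<bar>f i x\<bar> \<le> B i) \<longrightarrow>
      (\<integral>\<omega>. (\<Prod>i<m. f i (X n (s (Suc i)) \<omega> - X n (s i) \<omega>)) \<partial>P) =
      (\<Prod>i<m. \<integral>x. (f i x :: real) \<partial>convolution_power (\<nu> (r n)) (steps (r n) (s (Suc i)) - steps (r n) (s i)))"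
    using coupled_walks_exist[OF assms] by - (elim exE conjE, rule that)
  interpret coupled_walks \<nu> h C r P X Z
  proof (intro coupled_walks.intro coupled_walks_axioms.intro)
    show "null_array \<nu> h C" by (rule null_array_axioms)
    show "X n t \<in> borel_measurable P" for n t using 1(3) by simp
    show "Z t \<in> borel_measurable P" for t using 1(4) by simp
    show "AE \<omega> in P. (\<lambda>n. X n t \<omega>) \<longlonglongrightarrow> Z t \<omega>" if "t \<in> dyadic_times" for t using 1(5) that by simp
    show "distr P borel (X n t) = convolution_power (\<nu> (r n)) (steps (r n) t)" if "t \<in> dyadic_times" for n t
      using 1(6) that by simp
    fix n m and s :: "nat \<Rightarrow> real" and f :: "nat \<Rightarrow> 'a \<Rightarrow> real" and B
    assume "\<And>i. s i \<in> dyadic_times" "\<And>i. i < m \<Longrightarrow> s i \<le> s (Suc i)"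
      "\<And>i. f i \<in> borel_measurable borel" "\<And>i x. \<bar>f i x\<bar> \<le> B i"
    then show "(\<integral>\<omega>. (\<Prod>i<m. f i (X n (s (Suc i)) \<omega> - X n (s i) \<omega>)) \<partial>P) =
      (\<Prod>i<m. \<integral>x. f i x \<partial>convolution_power (\<nu> (r n)) (steps (r n) (s (Suc i)) - steps (r n) (s i)))"
      using 1(7)[rule_format, of s m f B n] by simp
  qed (rule 1)+
  show ?thesis
    by (intro exI[of _ r] exI[of _ P] exI[of _ Y] conjI 1(1) levy_process_Y allI impI laws_converge_to_Y) auto
qed

section \<open>Reduction of the family to a null array\<close>

theorem corollary2p2:
  fixes \<mu> :: "real \<Rightarrow> (real ^ 'd) measure"
  assumes prob: "\<And>t. t > 0 \<Longrightarrow> prob_space (\<mu> t)"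
    and borel: "\<And>t. t > 0 \<Longrightarrow> sets (\<mu> t) = sets borel"
    and bounded: "\<exists>h0>0. (SUP h\<in>{0<..<h0}. ereal (1 / h *
        ((\<integral>y. min 1 ((norm y)\<^sup>2) \<partial>\<mu> h) + norm (LINT y:{y. norm y \<le> 1}|\<mu> h. y)))) < \<infinity>"
    and tails: "\<And>\<epsilon>::real. \<epsilon> > 0 \<Longrightarrow> \<exists>M>0.
        Limsup (at_right 0) (\<lambda>h. ereal (1 / h * measure (\<mu> h) {y. norm y > M})) < ereal \<epsilon>"
  shows "\<forall>a :: nat \<Rightarrow> real. (\<forall>n. a n > 0) \<and> a \<longlonglongrightarrow> 0 \<longrightarrow>
    (\<exists>(r :: nat \<Rightarrow> nat) (P :: (real \<Rightarrow> real ^ 'd) measure) Y.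
       strict_mono r \<and> levy_process P Y \<and>
       (\<forall>(k :: nat \<Rightarrow> nat) t. t \<ge> 0 \<and> (\<lambda>n. real (k n) * a (r n)) \<longlonglongrightarrow> t \<longrightarrow>
          converges_in_distribution (\<lambda>n. convolution_power (\<mu> (a (r n))) (k n))
            (distr P borel (Y t))))"
proof (intro allI impI)
  fix a :: "nat \<Rightarrow> real"
  assume "(\<forall>n. a n > 0) \<and> a \<longlonglongrightarrow> 0"
  then have a_pos: "\<And>n. a n > 0" and a_null: "a \<longlonglongrightarrow> 0" by auto
  obtain h0 where h0: "h0 > 0" and sup: "(SUP h\<in>{0<..<h0}. ereal (1 / h *
      ((\<integral>y. min 1 ((norm y)\<^sup>2) \<partial>\<mu> h) + norm (LINT y:{y. norm y \<le> 1}|\<mu> h. y)))) < \<infinity>"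
    using bounded by blast
  \<comment> \<open>The supremum is an extended real; a bound from above still admits the value
    \<open>-\<infinity>\<close>, for which any constant serves.\<close>
  obtain C where C: "(SUP h\<in>{0<..<h0}. ereal (1 / h *
      ((\<integral>y. min 1 ((norm y)\<^sup>2) \<partial>\<mu> h) + norm (LINT y:{y. norm y \<le> 1}|\<mu> h. y)))) \<le> ereal C"
  proof (cases "SUP h\<in>{0<..<h0}. ereal (1 / h *
      ((\<integral>y. min 1 ((norm y)\<^sup>2) \<partial>\<mu> h) + norm (LINT y:{y. norm y \<le> 1}|\<mu> h. y)))")
    case (real c) then show ?thesis by (intro that[of c]) simp
  next
    case PInf then show ?thesis using sup by simp
  next
    case MInf then show ?thesis by (intro that[of 0]) simp
  qed
  have moments: "(\<integral>y. min 1 ((norm y)\<^sup>2) \<partial>\<mu> t) + norm (LINT y:{y. norm y \<le> 1}|\<mu> t. y) \<le> C * t"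
    if "0 < t" "t < h0" for t
  proof -
    have "ereal (1 / t * ((\<integral>y. min 1 ((norm y)\<^sup>2) \<partial>\<mu> t) + norm (LINT y:{y. norm y \<le> 1}|\<mu> t. y))) \<le> ereal C"
      using that by (intro order_trans[OF SUP_upper C]) auto
    then show ?thesis using that by (simp add: field_simps)
  qed
  \<comment> \<open>The first \<open>N\<close> terms are dropped so that the moment bounds hold at
    every index, as \<open>null_array\<close> demands; the final subsequence adds \<open>N\<close>
    back.\<close>
  obtain N where N: "\<And>n. n \<ge> N \<Longrightarrow> a n < h0"
    using order_tendstoD(2)[OF a_null h0] unfolding eventually_sequentially by blast
  define h where "h n = a (n + N)" for n
  have h: "0 < h n" "h n < h0" for n using a_pos N by (auto simp: h_def)
  have h_null: "h \<longlonglongrightarrow> 0" unfolding h_def using a_null by (rule LIMSEQ_ignore_initial_segment)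
  have h_filter: "filterlim h (at_right 0) sequentially"
    unfolding filterlim_at using h_null h by (auto intro!: always_eventually simp: less_imp_neq[symmetric])
  interpret null_array "\<lambda>n. \<mu> (h n)" h C
  proof (rule null_array.intro)
    show "prob_space (\<mu> (h n))" "sets (\<mu> (h n)) = sets borel" "h n > 0" for n using h prob borel by auto
    show "h \<longlonglongrightarrow> 0" by (rule h_null)
    fix n
    have "0 \<le> (\<integral>y. min 1 ((norm y)\<^sup>2) \<partial>\<mu> (h n))" by (intro Bochner_Integration.integral_nonneg) auto
    then show "(\<integral>y. min 1 ((norm y)\<^sup>2) \<partial>\<mu> (h n)) \<le> C * h n" "norm (LINT y:{y. norm y \<le> 1}|\<mu> (h n). y) \<le> C * h n"
      using moments[OF h[of n]] norm_ge_zero[of "LINT y:{y. norm y \<le> 1}|\<mu> (h n). y"] by linarith+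
  next
    fix \<epsilon> :: real assume "\<epsilon> > 0"
    then obtain M where "Limsup (at_right 0) (\<lambda>h. ereal (1 / h * measure (\<mu> h) {y. norm y > M})) < ereal \<epsilon>"
      using tails by blast
    then have "\<forall>\<^sub>F t in at_right 0. ereal (1 / t * measure (\<mu> t) {y. norm y > M}) < ereal \<epsilon>"
      by (rule Limsup_lessD)
    then have "\<forall>\<^sub>F n in sequentially. ereal (1 / h n * measure (\<mu> (h n)) {y. norm y > M}) < ereal \<epsilon>"
      by (rule eventually_compose_filterlim[OF _ h_filter])
    then have "\<forall>\<^sub>F n in sequentially. measure (\<mu> (h n)) {y. norm y > M} \<le> \<epsilon> * h n"
      by eventually_elim (use h in \<open>simp add: field_simps\<close>)
    then show "\<exists>M. \<forall>\<^sub>F n in sequentially. measure (\<mu> (h n)) {y. norm y > M} \<le> \<epsilon> * h n" by blast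
  qed
  \<comment> \<open>Constant functions with a diagonal vector as value embed the reals into the
    prescribed type of sample points.\<close>
  have "inj (\<lambda>x::real. \<lambda>_::real. (\<chi> i::'d. x))" by (auto simp: inj_def fun_eq_iff vec_eq_iff)
  from levy_limit[OF this]
  obtain r and P :: "(real \<Rightarrow> real ^ 'd) measure" and Y where r: "strict_mono r" "levy_process P Y"
    and conv: "\<forall>k t. 0 \<le> t \<and> (\<lambda>n. real (k n) * h (r n)) \<longlonglongrightarrow> t \<longrightarrow>
      converges_in_distribution (\<lambda>n. convolution_power (\<mu> (h (r n))) (k n)) (distr P borel (Y t))"
    by - (elim exE conjE, rule that)
  show "\<exists>(r :: nat \<Rightarrow> nat) (P :: (real \<Rightarrow> real ^ 'd) measure) Y.
       strict_mono r \<and> levy_process P Y \<and>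
       (\<forall>(k :: nat \<Rightarrow> nat) t. t \<ge> 0 \<and> (\<lambda>n. real (k n) * a (r n)) \<longlonglongrightarrow> t \<longrightarrow>
          converges_in_distribution (\<lambda>n. convolution_power (\<mu> (a (r n))) (k n))
            (distr P borel (Y t)))"
  proof (intro exI conjI)
    show "strict_mono (\<lambda>n. r n + N)" using r(1) by (simp add: strict_mono_def)
    show "levy_process P Y" by (rule r)
    show "\<forall>(k :: nat \<Rightarrow> nat) t. t \<ge> 0 \<and> (\<lambda>n. real (k n) * a (r n + N)) \<longlonglongrightarrow> t \<longrightarrow>
          converges_in_distribution (\<lambda>n. convolution_power (\<mu> (a (r n + N))) (k n)) (distr P borel (Y t))"
      using conv unfolding h_def .
  qed
qed

end
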